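(* Let $0<\mu\le 1$, let $K\ge 1$, and let $\Omega\subset\mathbf C$ be a Jordan domain whose boundary $\gamma=\partial\Omega$ is a Jordan curve of class $C^{1,\mu}$. Let $B>1$ be a constant such that $\gamma$ satisfies the $B$-chord-arc condition. Then there exists a constant $L=L(\gamma,K)$ satisfying $$L\le 4\pi\left(\frac{\pi}{2}\,\frac{K^3}{1+K^2}\,C_\gamma\,\frac{2-\alpha}{\mu\alpha}\right)^{\frac{2-\alpha}{\mu\alpha}}\left\{4B(1+2B)\sqrt{\frac{K|\Omega|}{\pi\log 2}}\right\}^{\frac{2}{\alpha}},\qquad \alpha=\frac{1}{K(1+2B)^2},$$ such that for every harmonic normalized $K$-quasiconformal mapping $w=P[f]$ of the unit disk $\mathbf U$ onto $\Omega$, $$|f'(\varphi)|\le L\quad\text{for almost every }\varphi\in[0,2\pi],$$ and $$|w(z_1)-w(z_2)|\le KL|z_1-z_2|\quad\text{for all }z_1,z_2\in\mathbf U.$$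
   Context: $\mathbf U=\{z\in\mathbf C:|z|<1\}$ and $S^1=\{z:|z|=1\}$. Quasiconformality: a sense-preserving homeomorphism $w:D\to G$ between plane domains is $K$-quasiconformal ($K\ge1$) if it is absolutely continuous on a.e. horizontal and a.e. vertical line and $|w_z|+|w_{\bar z}|\le K\,\big||w_z|-|w_{\bar z}|\big|$ a.e. on $D$, where $w_z=\frac12(w_x+\frac1i w_y)$ and $w_{\bar z}=\frac12(w_x-\frac1i w_y)$. A complex-valued function is harmonic if its real and imaginary parts are harmonic. For a bounded integrable $f$ on $S^1$, $P[f](re^{i\varphi})=\int_0^{2\pi}P(r,x-\varphi)f(e^{ix})\,dx$, where $P(r,x-\varphi)=\frac{1-r^2}{2\pi(1-2r\cos(x-\varphi)+r^2)}$. Here $f$ is the boundary function of $w$ on $S^1$, and $f'(\varphi):=\frac{d}{d\varphi}f(e^{i\varphi})$. Normalization: a quasiconformal mapping $w:\mathbf U\to\Omega$ (extended continuously to $\overline{\mathbf U}$) is normalized if $w(1)=w_0$, $w(e^{2\pi i/3})=w_1$, $w(e^{-2\pi i/3})=w_2$, where the points $w_0,w_1,w_2\in\gamma$ divide $\gamma$ into three arcs $w_0w_1$, $w_1w_2$, $w_2w_0$ of the same length $|\gamma|/3$ ($|\gamma|$ is the length of $\gamma$). Chord-arc condition: for points $z_1,z_2\in\gamma$, $d_\gamma(z_1,z_2)$ denotes the distance between them along $\gamma$, i.e. the length of the shorter of the two arcs of $\gamma$ with endpoints $z_1,z_2$. A closed rectifiable Jordan curve $\gamma$ satisfies the $B$-chord-arc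 condition, $B>1$, if $d_\gamma(z_1,z_2)\le B|z_1-z_2|$ for all $z_1,z_2\in\gamma$. (Every Jordan curve of class $C^{1,\mu}$ satisfies such a condition for some $B>1$.) The constant $C_\gamma$: let $l=|\gamma|$ and let $g:\mathbf R\to\gamma$ be the $l$-periodic arc length parameterization of $\gamma$ (so $|g'(s)|=1$). Then $$C_\gamma=\frac{1}{1+\mu}\sup_{s\ne t}\frac{|g'(s)-g'(t)|}{|s-t|^\mu}.$$ $|\Omega|$ denotes the area of $\Omega$. *)

theory Defs
  imports "HOL-Complex_Analysis.Complex_Analysis"
begin

definition jordan_curve :: "complex set \<Rightarrow> bool" where
  "jordan_curve \<gamma> \<longleftrightarrow>
     (\<exists>c. simple_path c \<and> pathfinish c = pathstart c \<and> path_image c = \<gamma>)"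

definition plane_domain :: "complex set \<Rightarrow> bool" where
  "plane_domain D \<longleftrightarrow> open D \<and> connected D \<and> D \<noteq> {}"

definition jordan_domain :: "complex set \<Rightarrow> bool" where
  "jordan_domain \<Omega> \<longleftrightarrow> plane_domain \<Omega> \<and> bounded \<Omega> \<and> jordan_curve (frontier \<Omega>)"

text \<open>Supremum of the lengths of the polygonal lines inscribed in the restriction of
  \<open>c\<close> to \<open>[a, b]\<close>; infinite for a non-rectifiable curve.\<close>

definition length_on :: "(real \<Rightarrow> complex) \<Rightarrow> real \<Rightarrow> real \<Rightarrow> ereal" where
  "length_on c a b =
     (SUP ts \<in> {ts. sorted ts \<and> set ts \<subseteq> {a..b}}.
        ereal (\<Sum>i<length ts - 1. dist (c (ts ! i)) (c (ts ! Suc i))))"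

definition path_length :: "(real \<Rightarrow> complex) \<Rightarrow> ereal" where
  "path_length p = length_on p 0 1"

text \<open>The length of a Jordan curve as a point set. All simple closed parametrizations of
  \<open>\<gamma>\<close> have the same length; the infimum only serves to avoid choosing one.\<close>

definition curve_length :: "complex set \<Rightarrow> ereal" where
  "curve_length \<gamma> =
     (INF c \<in> {c. simple_path c \<and> pathfinish c = pathstart c \<and> path_image c = \<gamma>}. path_length c)"

text \<open>For distinct points of a Jordan curve \<open>\<gamma>\<close> the infimum ranges over the parametrizations
  of exactly two arcs, so it is the length of the shorter one.\<close>

definition curve_dist :: "complex set \<Rightarrow> complex \<Rightarrow> complex \<Rightarrow> ereal" where
  "curve_dist \<gamma> z1 z2 =
     (if z1 = z2 then 0
      else INF p \<in> {p. arc p \<and> path_image p \<subseteq> \<gamma> \<and> pathstart p = z1 \<and> pathfinish p = z2}.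
             path_length p)"

definition chord_arc :: "real \<Rightarrow> complex set \<Rightarrow> bool" where
  "chord_arc B \<gamma> \<longleftrightarrow>
     1 < B \<and> jordan_curve \<gamma> \<and> curve_length \<gamma> < \<infinity> \<and>
     (\<forall>z1\<in>\<gamma>. \<forall>z2\<in>\<gamma>. curve_dist \<gamma> z1 z2 \<le> ereal (B * dist z1 z2))"

text \<open>The points \<open>w0, w1, w2\<close> divide \<open>\<gamma>\<close> into three arcs of length \<open>|\<gamma>|/3\<close>.\<close>

definition trisects :: "complex set \<Rightarrow> complex \<Rightarrow> complex \<Rightarrow> complex \<Rightarrow> bool" where
  "trisects \<gamma> w0 w1 w2 \<longleftrightarrow>
     (\<exists>p0 p1 p2. arc p0 \<and> arc p1 \<and> arc p2 \<and>
        pathstart p0 = w0 \<and> pathfinish p0 = w1 \<and>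
        pathstart p1 = w1 \<and> pathfinish p1 = w2 \<and>
        pathstart p2 = w2 \<and> pathfinish p2 = w0 \<and>
        path_image p0 \<union> path_image p1 \<union> path_image p2 = \<gamma> \<and>
        path_image p0 \<inter> path_image p1 = {w1} \<and>
        path_image p1 \<inter> path_image p2 = {w2} \<and>
        path_image p2 \<inter> path_image p0 = {w0} \<and>
        path_length p0 = curve_length \<gamma> / 3 \<and>
        path_length p1 = curve_length \<gamma> / 3 \<and>
        path_length p2 = curve_length \<gamma> / 3)"

definition is_arc_length_param :: "complex set \<Rightarrow> (real \<Rightarrow> complex) \<Rightarrow> bool" where
  "is_arc_length_param \<gamma> g \<longleftrightarrow>
     (\<exists>l>0. curve_length \<gamma> = ereal l \<and> (\<forall>s. g (s + l) = g s) \<and>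
            inj_on g {0..<l} \<and> range g = \<gamma> \<and>
            (\<forall>a b. a \<le> b \<longrightarrow> length_on g a b = ereal (b - a)))"

text \<open>Unique up to the choice of the starting point and of the orientation, which affect
  neither of the two definitions below.\<close>

definition arc_length_param :: "complex set \<Rightarrow> real \<Rightarrow> complex" where
  "arc_length_param \<gamma> = (SOME g. is_arc_length_param \<gamma> g)"

definition jordan_curve_C1_holder :: "real \<Rightarrow> complex set \<Rightarrow> bool" where
  "jordan_curve_C1_holder \<mu> \<gamma> \<longleftrightarrow>
     jordan_curve \<gamma> \<and> is_arc_length_param \<gamma> (arc_length_param \<gamma>) \<and>
     (\<forall>s. arc_length_param \<gamma> differentiable (at s)) \<and>
     (\<exists>C. \<forall>s t. norm (vector_derivative (arc_length_param \<gamma>) (at s)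
                      - vector_derivative (arc_length_param \<gamma>) (at t)) \<le> C * \<bar>s - t\<bar> powr \<mu>)"

definition curve_const :: "real \<Rightarrow> complex set \<Rightarrow> real" where
  "curve_const \<mu> \<gamma> =
     1 / (1 + \<mu>) *
     (SUP (s, t) \<in> {(s, t). s \<noteq> t}.
        norm (vector_derivative (arc_length_param \<gamma>) (at s)
              - vector_derivative (arc_length_param \<gamma>) (at t)) / \<bar>s - t\<bar> powr \<mu>)"

definition dx :: "(complex \<Rightarrow> 'a::real_normed_vector) \<Rightarrow> complex \<Rightarrow> 'a" where
  "dx u z = vector_derivative (\<lambda>t. u (z + of_real t)) (at 0)"

definition dy :: "(complex \<Rightarrow> 'a::real_normed_vector) \<Rightarrow> complex \<Rightarrow> 'a" where
  "dy u z = vector_derivative (\<lambda>t. u (z + \<i> * of_real t)) (at 0)"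

definition C1_on :: "(complex \<Rightarrow> real) \<Rightarrow> complex set \<Rightarrow> bool" where
  "C1_on u S \<longleftrightarrow>
     (\<forall>z\<in>S. (\<lambda>t::real. u (z + of_real t)) differentiable (at 0) \<and>
            (\<lambda>t::real. u (z + \<i> * of_real t)) differentiable (at 0)) \<and>
     continuous_on S (dx u) \<and> continuous_on S (dy u)"

definition harmonic_real_on :: "(complex \<Rightarrow> real) \<Rightarrow> complex set \<Rightarrow> bool" where
  "harmonic_real_on u S \<longleftrightarrow>
     C1_on u S \<and> C1_on (dx u) S \<and> C1_on (dy u) S \<and>
     (\<forall>z\<in>S. dx (dx u) z + dy (dy u) z = 0)"

definition harmonic_on :: "(complex \<Rightarrow> complex) \<Rightarrow> complex set \<Rightarrow> bool" where
  "harmonic_on w S \<longleftrightarrow>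
     harmonic_real_on (\<lambda>z. Re (w z)) S \<and> harmonic_real_on (\<lambda>z. Im (w z)) S"

definition poisson_kernel :: "real \<Rightarrow> real \<Rightarrow> real" where
  "poisson_kernel r x = (1 - r\<^sup>2) / (2 * pi * (1 - 2 * r * cos x + r\<^sup>2))"

definition poisson_integral :: "(complex \<Rightarrow> complex) \<Rightarrow> complex \<Rightarrow> complex" where
  "poisson_integral f z =
     integral {0..2*pi} (\<lambda>x. poisson_kernel (cmod z) (x - Arg z) *\<^sub>R f (cis x))"

definition abs_continuous_on :: "real set \<Rightarrow> (real \<Rightarrow> complex) \<Rightarrow> bool" where
  "abs_continuous_on S g \<longleftrightarrow>
     (\<forall>\<epsilon>>0. \<exists>\<delta>>0. \<forall>n::nat. \<forall>a b :: nat \<Rightarrow> real.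
        (\<forall>i<n. a i \<le> b i \<and> {a i..b i} \<subseteq> S) \<longrightarrow>
        disjoint_family_on (\<lambda>i. {a i<..<b i}) {..<n} \<longrightarrow>
        (\<Sum>i<n. b i - a i) < \<delta> \<longrightarrow>
        (\<Sum>i<n. dist (g (a i)) (g (b i))) < \<epsilon>)"

text \<open>Absolute continuity on a line is understood, as usual, on every compact segment of the
  line that lies in the domain.\<close>

definition ACL_on :: "complex set \<Rightarrow> (complex \<Rightarrow> complex) \<Rightarrow> bool" where
  "ACL_on D w \<longleftrightarrow>
     (AE y in lebesgue. \<forall>a b. (\<forall>x\<in>{a..b}. Complex x y \<in> D) \<longrightarrow>
        abs_continuous_on {a..b} (\<lambda>x. w (Complex x y))) \<and>
     (AE x in lebesgue. \<forall>a b. (\<forall>y\<in>{a..b}. Complex x y \<in> D) \<longrightarrow>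
        abs_continuous_on {a..b} (\<lambda>y. w (Complex x y)))"

text \<open>For a homeomorphism \<open>w\<close> of \<open>D\<close>: the image of every positively oriented circle bounding
  a disk in \<open>D\<close> winds once, in the positive direction, around the image of the centre.\<close>

definition sense_preserving_on :: "complex set \<Rightarrow> (complex \<Rightarrow> complex) \<Rightarrow> bool" where
  "sense_preserving_on D w \<longleftrightarrow>
     (\<forall>z r. 0 < r \<and> cball z r \<subseteq> D \<longrightarrow> winding_number (w \<circ> circlepath z r) (w z) = 1)"

definition d_z :: "(complex \<Rightarrow> complex) \<Rightarrow> complex \<Rightarrow> complex" where
  "d_z w z = 1 / 2 * (dx w z + 1 / \<i> * dy w z)"

definition d_zbar :: "(complex \<Rightarrow> complex) \<Rightarrow> complex \<Rightarrow> complex" where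
  "d_zbar w z = 1 / 2 * (dx w z - 1 / \<i> * dy w z)"

text \<open>The partial derivatives exist almost everywhere by the ACL property, so their values
  elsewhere do not matter.\<close>

definition quasiconformal :: "real \<Rightarrow> complex set \<Rightarrow> complex set \<Rightarrow> (complex \<Rightarrow> complex) \<Rightarrow> bool" where
  "quasiconformal K D G w \<longleftrightarrow>
     1 \<le> K \<and> plane_domain D \<and> plane_domain G \<and>
     (\<exists>v. homeomorphism D G w v) \<and> sense_preserving_on D w \<and> ACL_on D w \<and>
     (AE z in lebesgue. z \<in> D \<longrightarrow>
        cmod (d_z w z) + cmod (d_zbar w z) \<le> K * \<bar>cmod (d_z w z) - cmod (d_zbar w z)\<bar>)"

text \<open>Here \<open>w\<close> stands for the mapping of the open unit disk together with its continuous
  extension to the closed disk.\<close>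

definition normalized_quasiconformal :: "real \<Rightarrow> complex set \<Rightarrow> (complex \<Rightarrow> complex) \<Rightarrow> bool" where
  "normalized_quasiconformal K \<Omega> w \<longleftrightarrow>
     quasiconformal K (ball 0 1) \<Omega> w \<and> continuous_on (cball 0 1) w \<and>
     trisects (frontier \<Omega>) (w 1) (w (cis (2 * pi / 3))) (w (cis (- (2 * pi / 3))))"

end

theory Submission
  imports Defs
begin

text \<open>All estimates concern the boundary values \<open>F x = w (cis x)\<close>.

\<^emph>\<open>Topology.\<close> Let \<open>g\<close> be an arc length parameter of the boundary curve and lift \<open>F = g \<circ> \<sigma>\<close>.
If \<open>F\<close> takes the same value at the ends of a chord of the disc, the image of the chord is a Jordan
curve touching the boundary in one point, so \<open>F\<close> is constant on one side of the chord
(\<open>boundary_fibre\<close>). Hence \<open>\<sigma>\<close> is monotone and runs through one period (\<open>monotone_lift\<close>), and the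
normalization makes every arc of \<open>F\<close> over an angle below \<open>2 * pi / 3\<close> at most twice as long as the
distance of its end points along the curve (\<open>boundary_parameter\<close>).

\<^emph>\<open>Length and area.\<close> Let \<open>A v\<close> be the area of the image of the part of the disc at distance less than
\<open>exp v\<close> from a boundary point. This image lies in a box whose sides are controlled by the length of
its boundary. By the chord-arc condition that length is at most \<open>1 + 2 * B\<close> times the length of the
image of the circular crosscut, and quasiconformality and the Cauchy-Schwarz inequality bound the
latter by the derivative of \<open>A\<close>. So \<open>A v \<le> \<kappa> * A' v\<close>, the area decays exponentially, and crosscuts
with short images exist at every scale (\<open>bdry_holder\<close>). This gives a Hoelder estimate for \<open>F\<close> with
the exponent \<open>\<alpha>\<close> and an explicit constant. The bounding box bounds the area by an eighth of the
square of the length; this constant exceeds the isoperimetric one, but it is small enough for the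
decay rate \<open>1 / \<kappa>\<close> to be at least \<open>2 * \<alpha>\<close>.

\<^emph>\<open>The gradient.\<close> As \<open>w\<close> is the Poisson integral of \<open>F\<close>, the gradient of its component in a direction
\<open>N\<close> at \<open>z = r * cis \<phi>\<close> is at most the integral of \<open>\<bar>(F x - F \<phi>) \<bullet> N\<bar>\<close> against the kernel
\<open>1 / (pi * \<bar>cis x - z\<bar>\<^sup>2)\<close> (\<open>kernel_transform_normal\<close>). Take for \<open>N\<close> the normal of the curve at
\<open>F \<phi>\<close>: the curve deviates from its tangent by at most \<open>C * d powr (1 + \<mu>)\<close>, where \<open>d\<close> is the distance
along the curve. By quasiconformality the gradient of one component controls the whole derivative of
\<open>w\<close>. This is used twice. First, a Hoelder exponent \<open>\<beta>\<close> of \<open>F\<close> improves to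
\<open>\<beta> * (1 + \<mu> / 2)\<close>, so that after finitely many steps \<open>F\<close> is Lipschitz
(\<open>bdry_lipschitz_of_holder\<close>). Second, if \<open>M\<close> is the least Lipschitz constant, then \<open>d\<close> is bounded by
\<open>M * \<bar>x - \<phi>\<bar>\<close> as well as by the Hoelder estimate, and interpolating between the two yields
\<open>M \<le> T * M powr (1 - \<epsilon>)\<close>, that is \<open>M \<le> T powr (1 / \<epsilon>)\<close> (\<open>explicit_lipschitz\<close>).

The same estimate holds for the derivative of \<open>w\<close> in the disc by the maximum principle, and a
Lipschitz function of a real variable is differentiable almost everywhere
(\<open>lipschitz_complex_differentiable_AE\<close>). Since the constant \<open>L\<close> may not depend on \<open>\<mu>\<close> and \<open>B\<close>, it
is taken to be the infimum of all bounds obtained.\<close>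

section \<open>Lipschitz functions of a real variable\<close>

text \<open>The Vitali covering theorem for compact intervals that contain the given points without being
centred at them.\<close>

lemma Vitali_intervals:
  fixes S :: "real set"
  assumes "\<And>x d. x \<in> S \<Longrightarrow> 0 < d \<Longrightarrow> \<exists>u v. u < v \<and> u \<le> x \<and> x \<le> v \<and> v - u < d \<and> P u v"
  obtains C where "countable C" "\<And>u v. (u, v) \<in> C \<Longrightarrow> u < v \<and> P u v"
    "disjoint_family_on (\<lambda>(u, v). {u..v}) C" "negligible (S - (\<Union>(u, v)\<in>C. {u..v}))"
proof -
  define K where "K = {(u::real, v). u < v \<and> P u v}"
  define a where "a i = (fst i + snd i) / 2" for i :: "real \<times> real"
  define r where "r i = (snd i - fst i) / 2" for i :: "real \<times> real"
  have cball: "cball (a (u, v)) (r (u, v)) = {u..v}" for u v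
    by (auto simp: a_def r_def cball_def dist_real_def field_simps abs_le_iff)
  obtain C where C: "countable C" "C \<subseteq> K"
     "pairwise (\<lambda>i j. disjnt (cball (a i) (r i)) (cball (a j) (r j))) C"
     "negligible (S - (\<Union>i\<in>C. cball (a i) (r i)))"
  proof (rule Vitali_covering_theorem_cballs[of K r S a])
    show "0 < r i" if "i \<in> K" for i using that by (auto simp: K_def r_def)
    show "\<exists>i. i \<in> K \<and> x \<in> cball (a i) (r i) \<and> r i < d" if "x \<in> S" "0 < d" for x d
    proof -
      obtain u v where uv: "u < v" "u \<le> x" "x \<le> v" "v - u < d" "P u v" using assms \<open>x \<in> S\<close> \<open>0 < d\<close> by blast
      then have "(u, v) \<in> K" "x \<in> cball (a (u, v)) (r (u, v))" "r (u, v) < d"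
        unfolding cball by (auto simp: K_def r_def)
      then show ?thesis by blast
    qed
  qed blast
  show thesis
  proof
    show "countable C" by fact
    show "u < v \<and> P u v" if "(u, v) \<in> C" for u v using C(2) that by (auto simp: K_def)
    show "disjoint_family_on (\<lambda>(u, v). {u..v}) C"
      using C(3) unfolding disjoint_family_on_def pairwise_def disjnt_def
      by (metis (no_types, lifting) case_prod_beta cball prod.collapse)
    have "(\<Union>i\<in>C. cball (a i) (r i)) = (\<Union>(u, v)\<in>C. {u..v})"
      by (intro SUP_cong) (auto simp: cball simp del: mem_cball)
    then show "negligible (S - (\<Union>(u, v)\<in>C. {u..v}))" using C(4) by simp
  qed
qed

text \<open>Every Lipschitz function becomes such an \<open>h\<close> after adding a multiple of the identity. Being
increasing, \<open>h\<close> has a Stieltjes measure, which turns bounds for difference quotients into bounds for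
measures.\<close>

locale bilipschitz_real =
  fixes h :: "real \<Rightarrow> real" and L :: real
  assumes lower: "\<And>x y. x \<le> y \<Longrightarrow> y - x \<le> h y - h x" and upper: "\<And>x y. x \<le> y \<Longrightarrow> h y - h x \<le> L * (y - x)"
begin

definition slope :: "real \<Rightarrow> real \<Rightarrow> real" where "slope x t = (h (x + t) - h x) / t"

lemma slope_bounds:
  assumes "t \<noteq> 0" shows "1 \<le> slope x t" "slope x t \<le> L"
proof -
  consider "0 < t" | "t < 0" using assms by linarith
  then have "1 \<le> slope x t \<and> slope x t \<le> L"
  proof cases
    case 1 then show ?thesis using lower[of x "x + t"] upper[of x "x + t"] by (simp add: slope_def field_simps)
  next
    case 2 then show ?thesis using lower[of "x + t" x] upper[of "x + t" x] by (simp add: slope_def field_simps)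
  qed
  then show "1 \<le> slope x t" "slope x t \<le> L" by auto
qed

lemma cont_h: "continuous_on S h"
proof (rule continuous_on_subset)
  have "0 \<le> L" using slope_bounds[of 1 0] by simp
  then have "L-lipschitz_on UNIV h"
    using lower upper by (intro lipschitz_on_leI) (auto simp: dist_real_def, smt (verit) lower upper)
  then show "continuous_on UNIV h" by (rule lipschitz_on_continuous_on)
qed auto

definition oscillating :: "real \<Rightarrow> real \<Rightarrow> real set" where
  "oscillating a b = {x. (\<exists>\<^sub>F t in at 0. slope x t < a) \<and> (\<exists>\<^sub>F t in at 0. b < slope x t)}"

text \<open>The limit of the difference quotients, if it exists, is the supremum of the numbers that they
eventually exceed.\<close>

lemma differentiable_unless_oscillating:
  assumes no: "\<And>a b. a \<in> \<rat> \<Longrightarrow> b \<in> \<rat> \<Longrightarrow> a < b \<Longrightarrow> x \<notin> oscillating a b"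
  shows "h differentiable (at x)"
proof -
  define A where "A = {a. \<forall>\<^sub>F t in at 0. a \<le> slope x t}"
  define l where "l = Sup A"
  have "\<forall>\<^sub>F t::real in at 0. t \<noteq> 0" by (simp add: eventually_at_filter)
  then have 1: "1 \<in> A" unfolding A_def by (auto elim!: eventually_mono intro: slope_bounds)
  have bdd: "a \<le> L" if "a \<in> A" for a
  proof -
    have "\<forall>\<^sub>F t::real in at 0. a \<le> slope x t \<and> t \<noteq> 0"
      using that \<open>\<forall>\<^sub>F t::real in at 0. t \<noteq> 0\<close> unfolding A_def by (auto intro: eventually_conj)
    then obtain t where "a \<le> slope x t" "t \<noteq> 0" using eventually_happens'[of "at (0::real)"] by auto
    then show ?thesis using slope_bounds[of t x] by linarith
  qed
  then have bA: "bdd_above A" by (rule bdd_aboveI)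
  have down: "a' \<in> A" if "a \<in> A" "a' \<le> a" for a a' using that unfolding A_def by (auto elim!: eventually_mono)
  have "((slope x) \<longlongrightarrow> l) (at 0)"
  proof (rule order_tendstoI)
    fix a assume "a < l"
    then obtain a' where a': "a' \<in> A" "a < a'" unfolding l_def using less_cSup_iff[of A a] 1 bA by blast
    then show "\<forall>\<^sub>F t in at 0. a < slope x t" unfolding A_def by (auto elim!: eventually_mono)
  next
    fix c assume c: "l < c"
    obtain a where a: "a \<in> \<rat>" "l < a" "a < c" using Rats_dense_in_real[OF c] by blast
    obtain b where b: "b \<in> \<rat>" "a < b" "b < c" using Rats_dense_in_real[OF a(3)] by blast
    have "a \<notin> A" using a(2) cSup_upper[OF _ bA, of a] unfolding l_def by auto
    then have "\<exists>\<^sub>F t in at 0. slope x t < a" unfolding A_def by (auto simp: frequently_def not_less)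
    then have "\<not> (\<exists>\<^sub>F t in at 0. b < slope x t)" using no[OF a(1) b(1,2)] by (auto simp: oscillating_def)
    then have "\<forall>\<^sub>F t in at 0. slope x t \<le> b" by (auto simp: frequently_def not_less)
    then show "\<forall>\<^sub>F t in at 0. slope x t < c" using b(3) by (auto elim!: eventually_mono)
  qed
  then have "(h has_field_derivative l) (at x)" by (simp add: DERIV_def slope_def[abs_def])
  then show ?thesis by (auto simp: differentiable_def has_field_derivative_def)
qed

lemma small_intervals:
  assumes f: "\<exists>\<^sub>F t in at 0. Q (slope x t)" and V: "open V" "x \<in> V" and d: "0 < d"
  shows "\<exists>u v. u < v \<and> u \<le> x \<and> x \<le> v \<and> v - u < d \<and> {u..v} \<subseteq> V \<and> Q ((h v - h u) / (v - u))"
proof -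
  obtain e where e: "0 < e" "ball x e \<subseteq> V" using V open_contains_ball by blast
  have "\<forall>\<^sub>F t::real in at 0. \<bar>t\<bar> < min d e \<and> t \<noteq> 0"
    using d e by (auto simp: eventually_at dist_real_def intro!: exI[of _ "min d e"])
  from frequently_eventually_conj[OF f this] obtain t where t: "Q (slope x t)" "\<bar>t\<bar> < min d e" "t \<noteq> 0"
    using frequently_ex by blast
  show ?thesis
  proof (cases "0 < t")
    case True
    have "{x..x + t} \<subseteq> ball x e" using t True by (auto simp: dist_real_def)
    then show ?thesis using t True e by (intro exI[of _ x] exI[of _ "x + t"]) (auto simp: slope_def)
  next
    case False
    have "{x + t..x} \<subseteq> ball x e" using t False by (auto simp: dist_real_def)
    moreover have "(h x - h (x + t)) / (x - (x + t)) = slope x t" using t by (simp add: slope_def field_simps)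
    ultimately show ?thesis using t False e by (intro exI[of _ "x + t"] exI[of _ x]) auto
  qed
qed

text \<open>Cover the set by intervals on which \<open>h\<close> grows at a rate below \<open>a\<close>, and then, inside their interiors,
by intervals on which it grows at a rate above \<open>b\<close>. Comparing the Stieltjes measures of the two
unions shows that the second one is shorter than \<open>V\<close> by the factor \<open>a / b\<close>.\<close>

lemma oscillating_cover:
  assumes a0: "0 \<le> a" and ab: "a < b" and V: "open V" "bounded V"
  obtains U where "oscillating a b \<inter> V \<subseteq> U" "U \<in> lmeasurable" "b * measure lebesgue U \<le> a * measure lebesgue V"
proof -
  define \<nu> where "\<nu> = interval_measure h"
  have mono: "h x \<le> h y" if "x \<le> y" for x y using lower[OF that] that by linarith
  have \<nu>: "emeasure \<nu> {u..v} = ennreal (h v - h u)" if "u \<le> v" for u v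
    unfolding \<nu>_def using that mono cont_h by (intro emeasure_interval_measure_Icc) auto
  have sets_\<nu>: "sets \<nu> = sets borel" by (simp add: \<nu>_def)
  have b0: "0 < b" using a0 ab by simp
    define E where "E = oscillating a b \<inter> V"
    obtain C where C: "countable C" "\<And>u v. (u, v) \<in> C \<Longrightarrow> u < v \<and> {u..v} \<subseteq> V \<and> (h v - h u) / (v - u) < a"
        "disjoint_family_on (\<lambda>(u, v). {u..v}) C" "negligible (E - (\<Union>(u, v)\<in>C. {u..v}))"
    proof (rule Vitali_intervals[of E "\<lambda>u v. {u..v} \<subseteq> V \<and> (h v - h u) / (v - u) < a"])
      show "\<exists>u v. u < v \<and> u \<le> x \<and> x \<le> v \<and> v - u < d \<and> {u..v} \<subseteq> V \<and> (h v - h u) / (v - u) < a"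
        if "x \<in> E" "0 < d" for x d
        using that V by (intro small_intervals[where Q="\<lambda>s. s < a"]) (auto simp: E_def oscillating_def)
    qed blast
    define W where "W = (\<Union>(u, v)\<in>C. {u<..<v})"
    have oW: "open W" unfolding W_def by auto
    obtain D where D: "countable D" "\<And>u v. (u, v) \<in> D \<Longrightarrow> u < v \<and> {u..v} \<subseteq> W \<and> b < (h v - h u) / (v - u)"
        "disjoint_family_on (\<lambda>(u, v). {u..v}) D" "negligible (E \<inter> W - (\<Union>(u, v)\<in>D. {u..v}))"
    proof (rule Vitali_intervals[of "E \<inter> W" "\<lambda>u v. {u..v} \<subseteq> W \<and> b < (h v - h u) / (v - u)"])
      show "\<exists>u v. u < v \<and> u \<le> x \<and> x \<le> v \<and> v - u < d \<and> {u..v} \<subseteq> W \<and> b < (h v - h u) / (v - u)"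
        if "x \<in> E \<inter> W" "0 < d" for x d
        using that oW by (intro small_intervals[where Q="\<lambda>s. b < s"]) (auto simp: E_def oscillating_def)
    qed blast
    define UC where "UC = (\<Union>(u, v)\<in>C. {u..v})"
    define UD where "UD = (\<Union>(u, v)\<in>D. {u..v})"
    have sum: "emeasure M (\<Union>(u, v)\<in>X. {u..v}) = (\<integral>\<^sup>+i. emeasure M {fst i..snd i} \<partial>count_space X)"
      if "countable X" "disjoint_family_on (\<lambda>(u, v). {u..v}) X" "sets M = sets borel" for X and M :: "real measure"
      using emeasure_UN_countable[of X "\<lambda>i. {fst i..snd i}" M] that by (simp add: case_prod_unfold)
    have m: "UC \<in> sets borel" "UD \<in> sets borel"
      unfolding UC_def UD_def using C(1) D(1) by (intro sets.countable_UN''; force)+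
    have "W \<subseteq> UC" unfolding W_def UC_def by (intro UN_mono) auto
    moreover have "UD \<subseteq> W" unfolding UD_def
    proof (rule UN_least)
      fix i assume "i \<in> D"
      then show "(case i of (u, v) \<Rightarrow> {u..v}) \<subseteq> W" using D(2)[of "fst i" "snd i"] by (simp add: case_prod_unfold)
    qed
    ultimately have DW: "UD \<subseteq> UC" by simp
    have CV: "UC \<subseteq> V" unfolding UC_def
    proof (rule UN_least)
      fix i assume "i \<in> C"
      then show "(case i of (u, v) \<Rightarrow> {u..v}) \<subseteq> V" using C(2)[of "fst i" "snd i"] by (simp add: case_prod_unfold)
    qed
    have "ennreal b * emeasure lborel UD = (\<integral>\<^sup>+i. ennreal b * emeasure lborel {fst i..snd i} \<partial>count_space D)"
      unfolding UD_def sum[OF D(1,3) sets_lborel] by (rule nn_integral_cmult[symmetric]) simp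
    also have "\<dots> \<le> (\<integral>\<^sup>+i. emeasure \<nu> {fst i..snd i} \<partial>count_space D)"
    proof (rule nn_integral_mono, clarsimp)
      fix u v assume "(u, v) \<in> D"
      then have "u < v" "b * (v - u) \<le> h v - h u" using D(2)[of u v] by (auto simp: field_simps)
      then show "ennreal b * emeasure lborel {u..v} \<le> emeasure \<nu> {u..v}"
        using b0 by (simp add: \<nu> ennreal_mult[symmetric] ennreal_leI)
    qed
    also have "\<dots> = emeasure \<nu> UD" unfolding UD_def sum[OF D(1,3) sets_\<nu>] ..
    also have "\<dots> \<le> emeasure \<nu> UC" using DW m sets_\<nu> by (intro emeasure_mono) auto
    also have "\<dots> = (\<integral>\<^sup>+i. emeasure \<nu> {fst i..snd i} \<partial>count_space C)" unfolding UC_def sum[OF C(1,3) sets_\<nu>] ..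
    also have "\<dots> \<le> (\<integral>\<^sup>+i. ennreal a * emeasure lborel {fst i..snd i} \<partial>count_space C)"
    proof (rule nn_integral_mono, clarsimp)
      fix u v assume "(u, v) \<in> C"
      then have "u < v" "h v - h u \<le> a * (v - u)" using C(2)[of u v] by (auto simp: field_simps)
      then show "emeasure \<nu> {u..v} \<le> ennreal a * emeasure lborel {u..v}"
        using a0 by (simp add: \<nu> ennreal_mult[symmetric] ennreal_leI)
    qed
    also have "\<dots> = ennreal a * emeasure lborel UC"
      unfolding UC_def sum[OF C(1,3) sets_lborel] by (rule nn_integral_cmult) simp
    also have "\<dots> \<le> ennreal a * emeasure lborel V"
      using CV V by (intro mult_left_mono emeasure_mono) auto
    finally have ineq: "ennreal b * emeasure lborel UD \<le> ennreal a * emeasure lborel V" .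
    have Vm: "V \<in> lmeasurable" using V by (rule lmeasurable_open[rotated])
    have UDV: "UD \<subseteq> V" using DW CV by auto
    have UDm: "UD \<in> lmeasurable"
      using bounded_subset[OF V(2) UDV] m by (intro bounded_set_imp_lmeasurable) auto
    have em: "emeasure lborel X = ennreal (measure lebesgue X)" if "X \<in> lmeasurable" "X \<in> sets borel" for X :: "real set"
      using emeasure_eq_measure2[OF that(1)] that(2) by (simp add: emeasure_completion)
    have "ennreal (b * measure lebesgue UD) \<le> ennreal (a * measure lebesgue V)"
      using ineq em[OF UDm m(2)] em[OF Vm] V a0 b0 by (simp add: ennreal_mult)
    then have le: "b * measure lebesgue UD \<le> a * measure lebesgue V"
      using a0 by (simp add: zero_le_mult_iff)
    define R where "R = (E - UC) \<union> (\<Union>(u, v)\<in>C. {u, v}) \<union> (E \<inter> W - UD)"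
    have "negligible (\<Union>(u, v)\<in>C. {u, v})"
      unfolding negligible_iff_null_sets using C(1)
      by (intro null_sets_completionI countable_imp_null_set_lborel countable_UN) (auto simp: case_prod_unfold)
    then have nR: "negligible R" using C(4) D(4) by (simp add: R_def UC_def UD_def)
    have cov: "E \<subseteq> UD \<union> R"
    proof
      fix x assume x: "x \<in> E"
      show "x \<in> UD \<union> R"
      proof (cases "x \<in> UC")
        case True
        then obtain u v where uv: "(u, v) \<in> C" "u \<le> x" "x \<le> v" by (auto simp: UC_def)
        then have "x \<in> W \<or> x = u \<or> x = v" by (force simp: W_def)
        then show ?thesis using x uv by (auto simp: R_def)
      qed (use x in \<open>auto simp: R_def\<close>)
    qed
    have "measure lebesgue (UD \<union> R) = measure lebesgue UD"
      using nR UDm by (simp add: measure_Un_null_set negligible_iff_null_sets fmeasurableD)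
    moreover have "UD \<union> R \<in> lmeasurable" using UDm nR by (simp add: fmeasurable.Un negligible_imp_measurable)
    ultimately show thesis using that[of "UD \<union> R"] cov le by (simp add: E_def)
qed

lemma negligible_oscillating:
  assumes ab: "a < b"
  shows "negligible (oscillating a b)"
proof (cases "0 \<le> a")
  case False
  have "x \<notin> oscillating a b" for x
  proof
    assume "x \<in> oscillating a b"
    then have "\<exists>\<^sub>F t in at 0. slope x t < a" by (simp add: oscillating_def)
    moreover have "\<forall>\<^sub>F t::real in at 0. t \<noteq> 0" by (simp add: eventually_at_filter)
    ultimately obtain t where "slope x t < a" "t \<noteq> 0" using frequently_eventually_conj frequently_ex by blast
    then show False using slope_bounds(1)[of t x] False by simp
  qed
  then have "oscillating a b = {}" by blast
  then show ?thesis by simp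
next
  case a0: True
  \<comment> \<open>The gap between \<open>a / b\<close> and \<open>\<theta>\<close> leaves room for enlarging a cover to an open set.\<close>
  define \<theta> where "\<theta> = (1 + a / b) / 2"
  have \<theta>: "a / b < \<theta>" "0 < \<theta>" "\<theta> < 1" using ab a0 by (auto simp: \<theta>_def field_simps)
  have "negligible (oscillating a b \<inter> V)" if V: "open V" "bounded V" for V
  proof -
    define m where "m = measure lebesgue V + 1"
    have m: "0 < m" by (simp add: m_def add_nonneg_pos)
    \<comment> \<open>Each step covers the set by an open set of \<open>\<theta>\<close> times the measure.\<close>
    have iter: "\<exists>W. open W \<and> bounded W \<and> oscillating a b \<inter> V \<subseteq> W \<and> measure lebesgue W \<le> \<theta> ^ n * m" for n
    proof (induction n)
      case 0 then show ?case using V by (intro exI[of _ V]) (simp add: m_def)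
    next
      case (Suc n)
      then obtain W where W: "open W" "bounded W" "oscillating a b \<inter> V \<subseteq> W" "measure lebesgue W \<le> \<theta> ^ n * m" by blast
      obtain U where U: "oscillating a b \<inter> W \<subseteq> U" "U \<in> lmeasurable" "b * measure lebesgue U \<le> a * measure lebesgue W"
        using oscillating_cover[OF a0 ab W(1,2)] .
      define e where "e = (\<theta> - a / b) * (\<theta> ^ n * m)"
      have e: "0 < e" using \<theta> m by (simp add: e_def)
      obtain T where T: "open T" "U \<subseteq> T" "T - U \<in> lmeasurable" "emeasure lebesgue (T - U) < ennreal e"
        using sets_lebesgue_outer_open[OF fmeasurableD[OF U(2)] e] by blast
      have d: "measure lebesgue (T - U) \<le> e"
        using T(4) emeasure_eq_measure2[OF T(3)] e by (simp add: ennreal_less_iff)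
      have "T = U \<union> (T - U)" using T(2) by auto
      then have Tm: "T \<in> lmeasurable" using U(2) T(3) fmeasurable.Un by metis
      have "measure lebesgue T \<le> measure lebesgue U + measure lebesgue (T - U)"
        using \<open>T = U \<union> (T - U)\<close> measure_Un_le[of U lebesgue "T - U"] U(2) T(3) by (metis fmeasurableD)
      also have "\<dots> \<le> a / b * measure lebesgue W + e"
      proof -
        have "measure lebesgue U \<le> a / b * measure lebesgue W" using U(3) ab a0 by (simp add: field_simps)
        then show ?thesis using d by simp
      qed
      also have "\<dots> \<le> a / b * (\<theta> ^ n * m) + e" using W(4) ab a0 by (intro add_right_mono mult_left_mono) auto
      also have "\<dots> = \<theta> ^ Suc n * m" by (simp add: e_def algebra_simps)
      finally have "measure lebesgue T \<le> \<theta> ^ Suc n * m" .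
      moreover have "measure lebesgue (T \<inter> W) \<le> measure lebesgue T"
        using Tm T(1) W(1) by (intro measure_mono_fmeasurable) auto
      ultimately show ?case using T W U(1) by (intro exI[of _ "T \<inter> W"]) (auto intro: bounded_subset[OF W(2)])
    qed
    show ?thesis
      unfolding negligible_outer
    proof (intro allI impI)
      fix e :: real assume e: "0 < e"
      obtain n where "\<theta> ^ n < e / m" using real_arch_pow_inv[of "e / m" \<theta>] \<theta> e m by auto
      then have n: "\<theta> ^ n * m < e" using m by (simp add: field_simps)
      obtain W where W: "open W" "bounded W" "oscillating a b \<inter> V \<subseteq> W" "measure lebesgue W \<le> \<theta> ^ n * m"
        using iter by blast
      then show "\<exists>T. oscillating a b \<inter> V \<subseteq> T \<and> T \<in> lmeasurable \<and> measure lebesgue T < e"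
        using n lmeasurable_open[OF W(2,1)] by (intro exI[of _ W]) auto
    qed
  qed
  then have "negligible (\<Union>n::nat. oscillating a b \<inter> ball 0 (real n))" by (intro negligible_Union_nat) auto
  moreover have "(\<Union>n::nat. oscillating a b \<inter> ball 0 (real n)) = oscillating a b"
    using reals_Archimedean2 by (auto simp: dist_real_def)
  ultimately show ?thesis by simp
qed

lemma differentiable_AE: "AE x in lebesgue. h differentiable (at x)"
proof -
  define N where "N = (\<Union>(a, b)\<in>{(a, b). a \<in> \<rat> \<and> b \<in> \<rat> \<and> a < b}. oscillating a b)"
  have "countable {(a::real, b). a \<in> \<rat> \<and> b \<in> \<rat> \<and> a < b}"
    by (rule countable_subset[of _ "\<rat> \<times> \<rat>"]) (auto intro: countable_SIGMA countable_rat)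
  then have "N \<in> null_sets lebesgue"
    unfolding N_def using negligible_oscillating
    by (intro null_sets_UN') (auto simp: negligible_iff_null_sets)
  then have "AE x in lebesgue. x \<notin> N" by (rule AE_not_in)
  then show ?thesis
    by (rule eventually_mono) (rule differentiable_unless_oscillating, auto simp: N_def)
qed

end

lemma lipschitz_real_differentiable_AE:
  fixes f :: "real \<Rightarrow> real"
  assumes lip: "\<And>x y. \<bar>f x - f y\<bar> \<le> M * \<bar>x - y\<bar>"
  shows "AE x in lebesgue. f differentiable (at x)"
proof -
  \<comment> \<open>The linear summand makes all difference quotients at least 1.\<close>
  define h where "h x = f x + (M + 1) * x" for x
  interpret bilipschitz_real h "2 * M + 1"
  proof
    fix x y :: real assume "x \<le> y"
    then have "\<bar>f y - f x\<bar> \<le> M * (y - x)" using lip[of y x] by simp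
    then show "y - x \<le> h y - h x" "h y - h x \<le> (2 * M + 1) * (y - x)"
      by (auto simp: h_def algebra_simps abs_le_iff)
  qed
  have "f differentiable (at x)" if "h differentiable (at x)" for x
  proof -
    have "(\<lambda>x. h x - (M + 1) * x) differentiable (at x)"
      using that by (intro derivative_intros) auto
    then show ?thesis by (simp add: h_def)
  qed
  then show ?thesis using differentiable_AE by (auto elim: eventually_mono)
qed

lemma lipschitz_complex_differentiable_AE:
  fixes F :: "real \<Rightarrow> complex"
  assumes lip: "\<And>x y. cmod (F x - F y) \<le> M * \<bar>x - y\<bar>"
  shows "AE x in lebesgue. \<exists>D. (F has_vector_derivative D) (at x)"
proof -
  have "\<bar>Re (F x) - Re (F y)\<bar> \<le> M * \<bar>x - y\<bar>" "\<bar>Im (F x) - Im (F y)\<bar> \<le> M * \<bar>x - y\<bar>" for x y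
    using order_trans[OF abs_Re_le_cmod[of "F x - F y"] lip[of x y]]
      order_trans[OF abs_Im_le_cmod[of "F x - F y"] lip[of x y]] by simp_all
  then have "AE x in lebesgue. (\<lambda>x. Re (F x)) differentiable (at x)"
    "AE x in lebesgue. (\<lambda>x. Im (F x)) differentiable (at x)"
    by (intro lipschitz_real_differentiable_AE[where M=M]; simp)+
  then show ?thesis
  proof eventually_elim
    case (elim x)
    then obtain a b where "((\<lambda>x. Re (F x)) has_vector_derivative a) (at x)" "((\<lambda>x. Im (F x)) has_vector_derivative b) (at x)"
      by (meson vector_derivative_works)
    then have "((\<lambda>x. of_real (Re (F x)) + \<i> * of_real (Im (F x))) has_vector_derivative (of_real a + \<i> * of_real b)) (at x)"
      by (intro has_vector_derivative_add has_vector_derivative_mult_right has_vector_derivative_of_real)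
        (auto simp: has_real_derivative_iff_has_vector_derivative)
    then show ?case by (auto simp: complex_eq[symmetric])
  qed
qed

lemma lipschitz_vector_derivative_le:
  fixes f :: "real \<Rightarrow> 'a::real_normed_vector"
  assumes der: "(f has_vector_derivative D) (at x)" and lip: "\<And>y. norm (f y - f x) \<le> L * \<bar>y - x\<bar>"
  shows "norm D \<le> L"
proof (rule field_le_epsilon)
  fix e :: real assume "0 < e"
  then obtain d where d: "0 < d" "\<And>y. norm (y - x) < d \<Longrightarrow> norm (f y - f x - (y - x) *\<^sub>R D) \<le> e * norm (y - x)"
    using der unfolding has_vector_derivative_def has_derivative_at_alt by metis
  define h where "h = d / 2"
  have h: "0 < h" "h < d" using d by (auto simp: h_def)
  have "norm (h *\<^sub>R D) \<le> norm (f (x + h) - f x) + norm (f (x + h) - f x - h *\<^sub>R D)"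
    using norm_triangle_sub[of "h *\<^sub>R D" "f (x + h) - f x"] by (simp add: norm_minus_commute)
  also have "\<dots> \<le> L * h + e * h"
    using lip[of "x + h"] d(2)[of "x + h"] h by (intro add_mono) auto
  finally have "norm D * h \<le> (L + e) * h" using h by (simp add: algebra_simps)
  then show "norm D \<le> L + e" using h by simp
qed

section \<open>Area of images in the plane\<close>

text \<open>Carries the change of variables formula from \<open>real^2\<close> over to the complex plane.\<close>

definition plane :: "real^2 \<Rightarrow> complex" where "plane v = Complex (v$1) (v$2)"

lemma plane_linear: "linear plane"
  by (rule linearI) (auto simp: plane_def complex_eq_iff)

lemma plane_bij: "bij plane"
  by (rule o_bij[of "\<lambda>z. vector [Re z, Im z]"])
     (auto simp: fun_eq_iff plane_def complex_eq_iff vec_eq_iff forall_2)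

lemma plane_inv: "inv plane z = vector [Re z, Im z]"
  by (rule inv_f_eq) (use plane_bij in \<open>auto simp: bij_def plane_def complex_eq_iff\<close>)

lemma plane_inv_linear: "linear (inv plane)"
  unfolding plane_inv by (rule linearI) (auto simp: vec_eq_iff forall_2)

lemma plane_measurable [measurable]: "plane \<in> borel_measurable borel"
  using plane_linear linear_continuous_on linear_linear borel_measurable_continuous_onI
  by (metis linear_conv_bounded_linear)

lemma lborel_plane: "distr lborel borel plane = lborel"
proof (rule lborel_eqI[symmetric])
  fix l u :: complex
  assume lu: "\<And>b. b \<in> Basis \<Longrightarrow> l \<bullet> b \<le> u \<bullet> b"
  have lu': "Re l \<le> Re u" "Im l \<le> Im u"
    using lu[of 1] lu[of "\<i>"] by (auto simp: Basis_complex_def)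
  have *: "plane -` box l u = box (inv plane l) (inv plane u)"
    by (auto simp: plane_inv box_def Basis_complex_def plane_def Basis_vec_def inner_axis forall_2)
  have "emeasure (distr lborel borel plane) (box l u) = emeasure lborel (box (inv plane l) (inv plane u))"
    by (subst emeasure_distr) (auto simp: *)
  also have "\<dots> = (\<Prod>b\<in>Basis. (u - l) \<bullet> b)"
    using lu' by (subst emeasure_lborel_box)
      (auto simp: plane_inv Basis_complex_def Basis_vec_def inner_axis UNIV_2 axis_eq_axis ac_simps)
  finally show "emeasure (distr lborel borel plane) (box l u) = (\<Prod>b\<in>Basis. (u - l) \<bullet> b)" .
qed simp

lemma Complex_measurable: "(\<lambda>(x, y). Complex x y) \<in> borel_measurable (lborel \<Otimes>\<^sub>M lborel)"
  unfolding lborel_prod measurable_lborel2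
  by (intro borel_measurable_continuous_onI)
     (auto intro!: continuous_intros simp: Complex_eq case_prod_unfold)

lemma lborel_Complex: "distr (lborel \<Otimes>\<^sub>M lborel) borel (\<lambda>(x, y). Complex x y) = lborel"
proof (rule lborel_eqI[symmetric])
  have m [measurable]: "(\<lambda>(x, y). Complex x y) \<in> borel_measurable (lborel \<Otimes>\<^sub>M lborel)" by (rule Complex_measurable)
  fix l u :: complex
  assume lu: "\<And>b. b \<in> Basis \<Longrightarrow> l \<bullet> b \<le> u \<bullet> b"
  have lu': "Re l \<le> Re u" "Im l \<le> Im u"
    using lu[of 1] lu[of "\<i>"] by (auto simp: Basis_complex_def)
  have *: "(\<lambda>(x, y). Complex x y) -` box l u = {Re l<..<Re u} \<times> {Im l<..<Im u}"
    by (auto simp: box_def Basis_complex_def)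
  have "emeasure (distr (lborel \<Otimes>\<^sub>M lborel) borel (\<lambda>(x, y). Complex x y)) (box l u)
        = emeasure (lborel \<Otimes>\<^sub>M lborel) ({Re l<..<Re u} \<times> {Im l<..<Im u})"
    by (subst emeasure_distr[OF m]) (auto simp: * space_pair_measure)
  also have "\<dots> = (\<Prod>b\<in>Basis. (u - l) \<bullet> b)"
    using lu' by (subst lborel.emeasure_pair_measure_Times)
      (auto simp: Basis_complex_def ennreal_mult)
  finally show "emeasure (distr (lborel \<Otimes>\<^sub>M lborel) borel (\<lambda>(x, y). Complex x y)) (box l u)
     = (\<Prod>b\<in>Basis. (u - l) \<bullet> b)" .
qed simp

lemma nn_integral_complex_iterated:
  assumes [measurable]: "f \<in> borel_measurable (borel :: complex measure)"
  shows "(\<integral>\<^sup>+z. f z \<partial>lborel) = (\<integral>\<^sup>+x. \<integral>\<^sup>+y. f (Complex x y) \<partial>lborel \<partial>lborel)"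
proof -
  have m [measurable]: "(\<lambda>(x, y). Complex x y) \<in> borel_measurable (lborel \<Otimes>\<^sub>M lborel)" by (rule Complex_measurable)
  have "(\<integral>\<^sup>+z. f z \<partial>lborel) = (\<integral>\<^sup>+z. f z \<partial>distr (lborel \<Otimes>\<^sub>M lborel) borel (\<lambda>(x, y). Complex x y))"
    by (simp add: lborel_Complex)
  also have "\<dots> = (\<integral>\<^sup>+z. f (case z of (x, y) \<Rightarrow> Complex x y) \<partial>(lborel \<Otimes>\<^sub>M lborel))"
    by (subst nn_integral_distr) auto
  also have "\<dots> = (\<integral>\<^sup>+x. \<integral>\<^sup>+y. f (Complex x y) \<partial>lborel \<partial>lborel)"
    by (subst lborel.nn_integral_fst[symmetric]) auto
  finally show ?thesis .
qed

text \<open>The determinant of \<open>h \<mapsto> p * h + cnj (q * h)\<close> is \<open>\<bar>p\<bar>\<^sup>2 - \<bar>q\<bar>\<^sup>2\<close>.\<close>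

lemma area_of_image:
  fixes f :: "complex \<Rightarrow> complex"
  assumes S: "open S" and inj: "inj_on f S"
    and der: "\<And>z. z \<in> S \<Longrightarrow> (f has_derivative (\<lambda>h. p z * h + cnj (q z * h))) (at z)"
    and cont: "continuous_on S p" "continuous_on S q"
    and fin: "emeasure lborel (f ` S) < \<infinity>"
  shows "(\<integral>\<^sup>+z\<in>S. ennreal \<bar>(cmod (p z))\<^sup>2 - (cmod (q z))\<^sup>2\<bar> \<partial>lborel) = emeasure lborel (f ` S)"
proof -
  define J where "J z = \<bar>(cmod (p z))\<^sup>2 - (cmod (q z))\<^sup>2\<bar>" for z
  have contJ: "continuous_on S J"
    unfolding J_def using cont by (intro continuous_intros)
  have cf: "continuous_on S f"
    using der by (meson continuous_at_imp_continuous_on has_derivative_continuous)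
  have ofS: "open (f ` S)"
    using invariance_of_domain[OF cf S inj] .
  define S' where "S' = plane -` S"
  define F where "F = inv plane \<circ> f \<circ> plane"
  have oS': "open S'"
    unfolding S'_def using S plane_linear
    by (intro open_vimage) (auto simp: linear_continuous_on linear_conv_bounded_linear)
  have injF: "inj_on F S'"
    using inj inj_on_subset[OF bij_is_inj[OF plane_bij]] bij_is_inj[OF bij_imp_bij_inv[OF plane_bij]]
    unfolding F_def S'_def by (intro comp_inj_on) (auto intro: inj_on_subset)
  have surj: "surj plane" using plane_bij by (auto simp: bij_def)
  have injp: "inj plane" using plane_bij by (auto simp: bij_def)
  define F' where "F' v = inv plane \<circ> (\<lambda>h. p (plane v) * h + cnj (q (plane v) * h)) \<circ> plane" for v
  have derF: "(F has_derivative F' v) (at v within S')" if "v \<in> S'" for v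
  proof -
    have 1: "(plane has_derivative plane) (at v within S')"
      using plane_linear by (simp add: linear_imp_has_derivative)
    have 2: "(f has_derivative (\<lambda>h. p (plane v) * h + cnj (q (plane v) * h))) (at (plane v))"
      using der that by (auto simp: S'_def)
    have 3: "(inv plane has_derivative inv plane) (at (f (plane v)))"
      using plane_inv_linear by (simp add: linear_imp_has_derivative)
    show ?thesis
      using has_derivative_compose[OF has_derivative_compose[OF 1 2] 3]
      by (simp add: F_def F'_def o_def)
  qed
  have det: "\<bar>det (matrix (F' v))\<bar> = J (plane v)" for v
    by (simp add: det_2 matrix_def F'_def plane_inv plane_def axis_def J_def cmod_def)
      (simp add: power2_eq_square algebra_simps)
  have eq: "F ` S' = plane -` (f ` S)"
  proof -
    have "F ` S' = inv plane ` f ` (plane ` plane -` S)"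
      by (simp only: F_def S'_def image_comp o_assoc)
    also have "plane ` plane -` S = S"
      using surj by (simp add: surj_image_vimage_eq)
    also have "inv plane ` f ` S = plane -` (f ` S)"
      using bij_vimage_eq_inv_image[OF plane_bij] by simp
    finally show ?thesis .
  qed
  have emF: "emeasure lborel (F ` S') = emeasure lborel (f ` S)"
  proof -
    have "emeasure (distr lborel borel plane) (f ` S) = emeasure lborel (plane -` (f ` S))"
      by (subst emeasure_distr) (use ofS in auto)
    then show ?thesis unfolding lborel_plane eq by simp
  qed
  have oF: "open (F ` S')"
    unfolding eq using ofS plane_linear
    by (intro open_vimage) (auto simp: linear_continuous_on linear_conv_bounded_linear)
  then have lm: "F ` S' \<in> lmeasurable"
    using fin emF by (auto simp: fmeasurable_def)
  have "((\<lambda>x. \<bar>det (matrix (F' x))\<bar>) has_integral measure lebesgue (F ` S')) S'"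
    using has_measure_differentiable_image[of S' F F' "measure lebesgue (F ` S')"] lm oS' derF injF by auto
  then have hi: "((\<lambda>v. J (plane v)) has_integral measure lebesgue (F ` S')) S'"
    by (simp add: det)
  have cJ: "continuous_on S' (\<lambda>v. J (plane v))"
    using plane_linear unfolding S'_def
    by (intro continuous_on_compose2[OF contJ])
       (auto simp: linear_continuous_on linear_conv_bounded_linear)
  have "(\<lambda>x. ennreal (indicator S x *\<^sub>R J x)) \<in> borel_measurable borel"
    using borel_measurable_continuous_on_indicator[OF _ contJ] S by auto
  also have "(\<lambda>x. ennreal (indicator S x *\<^sub>R J x)) = (\<lambda>z. ennreal (J z) * indicator S z)"
    by (auto simp: indicator_def)
  finally have [measurable]: "(\<lambda>z. ennreal (J z) * indicator S z) \<in> borel_measurable borel" .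
  have "(\<integral>\<^sup>+z\<in>S. ennreal (J z) \<partial>lborel) = (\<integral>\<^sup>+z. ennreal (J z) * indicator S z \<partial>distr lborel borel plane)"
    by (simp add: lborel_plane)
  also have "\<dots> = (\<integral>\<^sup>+v. ennreal (J (plane v)) * indicator S (plane v) \<partial>lborel)"
    by (rule nn_integral_distr) auto
  also have "\<dots> = (\<integral>\<^sup>+v. ennreal (indicator S' v * J (plane v)) \<partial>lborel)"
    by (intro nn_integral_cong) (auto simp: indicator_def S'_def)
  also have "\<dots> = ennreal (measure lebesgue (F ` S'))"
  proof (rule nn_integral_has_integral_lborel[OF _ _ ])
    show "(\<lambda>v. indicator S' v * J (plane v)) \<in> borel_measurable borel"
      using borel_measurable_continuous_on_indicator[OF _ cJ] oS' by auto
    show "0 \<le> indicator S' v * J (plane v)" for v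
      by (auto simp: J_def)
    show "((\<lambda>v. indicator S' v * J (plane v)) has_integral measure lebesgue (F ` S')) UNIV"
      using has_integral_restrict_UNIV[THEN iffD2, OF hi]
      by (rule has_integral_eq[rotated]) auto
  qed
  also have "\<dots> = emeasure lborel (F ` S')"
    using emeasure_eq_measure2[OF lm] oF by (simp add: emeasure_completion)
  finally show ?thesis by (simp add: emF J_def)
qed

text \<open>The total variation of each coordinate along a closed polygon is at least twice its range. Adding up
the vectors of absolute coordinate differences gives a vector that is no longer than the polygon.\<close>

lemma closed_polygon_bounding_box:
  fixes z :: "nat \<Rightarrow> complex"
  assumes closed: "z n = z 0" and le: "i \<le> n" "j \<le> n" "i' \<le> n" "j' \<le> n"
  shows "4 * ((Re (z i) - Re (z j))\<^sup>2 + (Im (z i') - Im (z j'))\<^sup>2)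
           \<le> (\<Sum>k<n. cmod (z (Suc k) - z k))\<^sup>2"
proof -
  have step: "\<bar>f j - f i\<bar> \<le> (\<Sum>k=i..<j. \<bar>f (Suc k) - f k\<bar>)" if "i \<le> j" for f :: "nat \<Rightarrow> real" and i j
  proof -
    have "f j - f i = (\<Sum>k=i..<j. f (Suc k) - f k)"
      using that by (simp add: sum_Suc_diff')
    then show ?thesis by (metis sum_abs)
  qed
  have aux: "2 * \<bar>f j - f i\<bar> \<le> (\<Sum>k<n. \<bar>f (Suc k) - f k\<bar>)"
    if "i \<le> j" "j \<le> n" "f n = f 0" for f :: "nat \<Rightarrow> real" and i j
  proof -
    have "(\<Sum>k<n. \<bar>f (Suc k) - f k\<bar>) = (\<Sum>k=0..<i. \<bar>f (Suc k) - f k\<bar>)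
        + (\<Sum>k=i..<j. \<bar>f (Suc k) - f k\<bar>) + (\<Sum>k=j..<n. \<bar>f (Suc k) - f k\<bar>)"
      using that by (simp add: sum.atLeastLessThan_concat lessThan_atLeast0)
    moreover have "\<bar>f j - f i\<bar> \<le> \<bar>f i - f 0\<bar> + \<bar>f n - f j\<bar>" using that by linarith
    ultimately show ?thesis
      using step[OF le0, of f i] step[OF that(1), of f] step[OF that(2), of f] by (smt (verit))
  qed
  have excursion: "2 * \<bar>f i - f j\<bar> \<le> (\<Sum>k<n. \<bar>f (Suc k) - f k\<bar>)"
    if "i \<le> n" "j \<le> n" "f n = f 0" for f :: "nat \<Rightarrow> real" and i j
    using aux[of i j f] aux[of j i f] that by (cases "i \<le> j") (auto simp: abs_minus_commute)
  define X where "X = (\<Sum>k<n. \<bar>Re (z (Suc k)) - Re (z k)\<bar>)"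
  define Y where "Y = (\<Sum>k<n. \<bar>Im (z (Suc k)) - Im (z k)\<bar>)"
  have X: "2 * \<bar>Re (z i) - Re (z j)\<bar> \<le> X"
    using excursion[of i j "\<lambda>k. Re (z k)"] le closed by (simp add: X_def)
  have Y: "2 * \<bar>Im (z i') - Im (z j')\<bar> \<le> Y"
    using excursion[of i' j' "\<lambda>k. Im (z k)"] le closed by (simp add: Y_def)
  have "cmod (Complex X Y) = cmod (\<Sum>k<n. Complex \<bar>Re (z (Suc k)) - Re (z k)\<bar> \<bar>Im (z (Suc k)) - Im (z k)\<bar>)"
    by (rule arg_cong[where f=cmod]) (simp add: complex_eq_iff X_def Y_def)
  also have "\<dots> \<le> (\<Sum>k<n. cmod (Complex \<bar>Re (z (Suc k)) - Re (z k)\<bar> \<bar>Im (z (Suc k)) - Im (z k)\<bar>))"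
    by (rule norm_sum)
  also have "\<dots> = (\<Sum>k<n. cmod (z (Suc k) - z k))"
    by (rule sum.cong) (auto simp: cmod_def)
  finally have "(cmod (Complex X Y))\<^sup>2 \<le> (\<Sum>k<n. cmod (z (Suc k) - z k))\<^sup>2"
    by (intro power_mono) auto
  moreover have "(2 * \<bar>Re (z i) - Re (z j)\<bar>)\<^sup>2 + (2 * \<bar>Im (z i') - Im (z j')\<bar>)\<^sup>2 \<le> X\<^sup>2 + Y\<^sup>2"
    using X Y by (intro add_mono power_mono) auto
  ultimately show ?thesis
    by (simp add: cmod_power2 power_mult_distrib)
qed

lemma closed_curve_bounding_box:
  fixes c :: "real \<Rightarrow> complex" and N :: "real \<Rightarrow> real"
  assumes closed: "c b = c a"
    and len: "\<And>s t. a \<le> s \<Longrightarrow> s \<le> t \<Longrightarrow> t \<le> b \<Longrightarrow> cmod (c t - c s) \<le> N t - N s"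
    and t: "{t1, t2, t3, t4} \<subseteq> {a..b}"
  shows "4 * ((Re (c t1) - Re (c t2))\<^sup>2 + (Im (c t3) - Im (c t4))\<^sup>2) \<le> (N b - N a)\<^sup>2"
proof -
  define xs where "xs = [a, t1, t2, t3, t4, b]"
  define ts where "ts = sort xs"
  have st: "sorted ts" "set ts = {a, t1, t2, t3, t4, b}" "length ts = 6"
    by (simp_all add: ts_def) (simp_all add: xs_def)
  have nth: "ts ! i \<le> ts ! j" if "i \<le> j" "j \<le> 5" for i j
    using st that by (intro sorted_nth_mono) auto
  have in_ab: "ts ! i \<in> {a..b}" if "i \<le> 5" for i
    using st that nth_mem[of i ts] t by auto
  have ex: "\<exists>i\<le>5. ts ! i = x" if "x \<in> {a, t1, t2, t3, t4, b}" for x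
  proof -
    have "x \<in> set ts" using that st by simp
    then obtain i where "i < length ts" "ts ! i = x" by (meson in_set_conv_nth)
    then show ?thesis using st by (intro exI[of _ i]) auto
  qed
  obtain i1 i2 i3 i4 ia ib where ii: "i1 \<le> 5" "ts ! i1 = t1" "i2 \<le> 5" "ts ! i2 = t2"
      "i3 \<le> 5" "ts ! i3 = t3" "i4 \<le> 5" "ts ! i4 = t4" "ia \<le> 5" "ts ! ia = a" "ib \<le> 5" "ts ! ib = b"
    using ex[of t1] ex[of t2] ex[of t3] ex[of t4] ex[of a] ex[of b] by auto
  have 0: "ts ! 0 = a" using nth[of 0 ia] in_ab[of 0] ii by auto
  have 5: "ts ! 5 = b" using nth[of ib 5] in_ab[of 5] ii by auto
  have "4 * ((Re (c t1) - Re (c t2))\<^sup>2 + (Im (c t3) - Im (c t4))\<^sup>2)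
      \<le> (\<Sum>k<5. cmod (c (ts ! Suc k) - c (ts ! k)))\<^sup>2"
    using closed_polygon_bounding_box[of "\<lambda>k. c (ts ! k)" 5 i1 i2 i3 i4] ii 0 5 closed by simp
  also have "\<dots> \<le> (N b - N a)\<^sup>2"
  proof (intro power_mono sum_nonneg)
    have "(\<Sum>k<5. cmod (c (ts ! Suc k) - c (ts ! k))) \<le> (\<Sum>k<5. N (ts ! Suc k) - N (ts ! k))"
      using in_ab nth by (intro sum_mono len) auto
    also have "\<dots> = N b - N a"
      using sum_lessThan_telescope[of "\<lambda>k. N (ts ! k)" 5] 0 5 by simp
    finally show "(\<Sum>k<5. cmod (c (ts ! Suc k) - c (ts ! k))) \<le> N b - N a" .
  qed auto
  finally show ?thesis .
qed

text \<open>The closed curve runs through \<open>c\<close> and returns along \<open>e\<close>; \<open>N\<close> and \<open>M\<close> are upper bounds for the lengths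
measured from the initial points.\<close>

lemma two_arcs_bounding_box:
  fixes c e :: "real \<Rightarrow> complex" and N M :: "real \<Rightarrow> real"
  assumes ends: "c a = e a'" "c b = e b'" and ab: "a \<le> b" "a' \<le> b'"
    and c: "\<And>s t. a \<le> s \<Longrightarrow> s \<le> t \<Longrightarrow> t \<le> b \<Longrightarrow> cmod (c t - c s) \<le> N t - N s"
    and e: "\<And>s t. a' \<le> s \<Longrightarrow> s \<le> t \<Longrightarrow> t \<le> b' \<Longrightarrow> cmod (e t - e s) \<le> M t - M s"
    and z: "{z1, z2, z3, z4} \<subseteq> c ` {a..b} \<union> e ` {a'..b'}"
  shows "4 * ((Re z1 - Re z2)\<^sup>2 + (Im z3 - Im z4)\<^sup>2) \<le> (N b - N a + (M b' - M a'))\<^sup>2"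
proof -
  define T where "T = b + (b' - a')"
  define f where "f t = (if t \<le> b then c t else e (b' - (t - b)))" for t
  define L where "L t = (if t \<le> b then N t else N b + M b' - M (b' - (t - b)))" for t
  have f1: "f t = c t" "L t = N t" if "t \<le> b" for t using that by (auto simp: f_def L_def)
  have f2: "f t = e (b' - (t - b))" "L t = N b + M b' - M (b' - (t - b))" if "b \<le> t" for t
    using that ends by (auto simp: f_def L_def)
  have closed: "f T = f a" using f1[of a] f2[of T] ab ends by (auto simp: T_def)
  have len: "cmod (f t - f s) \<le> L t - L s" if st: "a \<le> s" "s \<le> t" "t \<le> T" for s t
  proof -
    have 1: ?thesis if "t \<le> b" using f1[of s] f1[of t] c[of s t] that st by auto
    have 2: "cmod (f t - f s) \<le> L t - L s" if "b \<le> s" "s \<le> t" "t \<le> T" for s t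
      using f2[of s] f2[of t] e[of "b' - (t - b)" "b' - (s - b)"] that
      by (auto simp: T_def norm_minus_commute)
    have 3: ?thesis if "s \<le> b" "b \<le> t"
    proof -
      have "cmod (f t - f b) \<le> L t - L b" using 2[of b t] that st by auto
      moreover have "cmod (f b - f s) \<le> L b - L s" using f1[of s] f1[of b] c[of s b] that st by auto
      moreover have "cmod (f t - f s) \<le> cmod (f t - f b) + cmod (f b - f s)"
        using norm_triangle_ineq[of "f t - f b" "f b - f s"] by simp
      ultimately show ?thesis by linarith
    qed
    show ?thesis using 1 2[of s t] 3 st by linarith
  qed
  have ex: "\<exists>t\<in>{a..T}. z = f t" if "z \<in> c ` {a..b} \<union> e ` {a'..b'}" for z
    using that
  proof
    assume "z \<in> c ` {a..b}" then show ?thesis using f1 ab by (force simp: T_def)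
  next
    assume "z \<in> e ` {a'..b'}"
    then obtain t where "t \<in> {a'..b'}" "z = e t" by auto
    then show ?thesis using f2[of "b + (b' - t)"] ab by (intro bexI[of _ "b + (b' - t)"]) (auto simp: T_def)
  qed
  obtain t1 t2 t3 t4 where "{t1, t2, t3, t4} \<subseteq> {a..T}" "z1 = f t1" "z2 = f t2" "z3 = f t3" "z4 = f t4"
    using ex[of z1] ex[of z2] ex[of z3] ex[of z4] z by auto
  then have "4 * ((Re z1 - Re z2)\<^sup>2 + (Im z3 - Im z4)\<^sup>2) \<le> (L T - L a)\<^sup>2"
    using closed_curve_bounding_box[of f T a L t1 t2 t3 t4] closed len by auto
  moreover have "L T - L a = N b - N a + (M b' - M a')"
    using f1[of a] f2[of T] ab by (auto simp: T_def)
  ultimately show ?thesis by simp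
qed

text \<open>With sides \<open>a\<close> and \<open>b\<close> the area is at most \<open>a * b \<le> (a\<^sup>2 + b\<^sup>2) / 2\<close>. In comparison with the
isoperimetric inequality this loses the factor \<open>pi / 2\<close>.\<close>

lemma area_le_bounding_box:
  fixes X C :: "complex set"
  assumes "X \<subseteq> C" "compact C" "C \<noteq> {}" "X \<in> sets borel"
    and T: "\<And>z1 z2 z3 z4. \<lbrakk>\<forall>z\<in>C. Re z \<le> Re z1; \<forall>z\<in>C. Re z2 \<le> Re z; \<forall>z\<in>C. Im z \<le> Im z3; \<forall>z\<in>C. Im z4 \<le> Im z;
        {z1, z2, z3, z4} \<subseteq> C\<rbrakk>
      \<Longrightarrow> 4 * ((Re z1 - Re z2)\<^sup>2 + (Im z3 - Im z4)\<^sup>2) \<le> T\<^sup>2"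
  shows "measure lborel X \<le> T\<^sup>2 / 8"
proof -
  have cont: "continuous_on C Re" "continuous_on C Im" by (intro continuous_intros)+
  obtain z1 z2 z3 z4 where z: "z1 \<in> C" "\<forall>z\<in>C. Re z \<le> Re z1" "z2 \<in> C" "\<forall>z\<in>C. Re z2 \<le> Re z"
    "z3 \<in> C" "\<forall>z\<in>C. Im z \<le> Im z3" "z4 \<in> C" "\<forall>z\<in>C. Im z4 \<le> Im z"
    using continuous_attains_sup[OF assms(2,3) cont(1)] continuous_attains_inf[OF assms(2,3) cont(1)]
      continuous_attains_sup[OF assms(2,3) cont(2)] continuous_attains_inf[OF assms(2,3) cont(2)]
    by metis
  define a where "a = Re z1 - Re z2"
  define b where "b = Im z3 - Im z4"
  have ab: "a \<ge> 0" "b \<ge> 0" "4 * (a\<^sup>2 + b\<^sup>2) \<le> T\<^sup>2"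
    using z T[of z1 z2 z3 z4] by (auto simp: a_def b_def)
  let ?R = "cbox (Complex (Re z2) (Im z4)) (Complex (Re z1) (Im z3))"
  have "X \<subseteq> ?R" using assms(1) z by (auto simp: in_cbox_complex_iff)
  then have "measure lborel X \<le> measure lborel ?R"
    using assms(4) by (intro measure_mono_fmeasurable) (auto simp: fmeasurable_def emeasure_lborel_cbox_eq)
  also have "\<dots> = a * b"
    using ab by (subst content_cbox) (auto simp: Basis_complex_def a_def b_def)
  also have "\<dots> \<le> (a\<^sup>2 + b\<^sup>2) / 2" using sum_squares_bound[of a b] by simp
  finally show ?thesis using ab by simp
qed

section \<open>Length and arc length parameters\<close>

lemma length_on_ge:
  assumes "sorted ts" "set ts \<subseteq> {a..b}"
  shows "ereal (\<Sum>i<length ts - 1. dist (c (ts ! i)) (c (ts ! Suc i))) \<le> length_on c a b"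
  unfolding length_on_def using assms by (intro SUP_upper) auto

lemma length_on_le_lipschitz:
  assumes "a \<le> b" "0 \<le> M" and lip: "\<And>x y. a \<le> x \<Longrightarrow> x \<le> y \<Longrightarrow> y \<le> b \<Longrightarrow> dist (c x) (c y) \<le> M * (y - x)"
  shows "length_on c a b \<le> ereal (M * (b - a))"
  unfolding length_on_def
proof (rule SUP_least, clarify)
  fix ts :: "real list" assume ts: "sorted ts" "set ts \<subseteq> {a..b}"
  have nth: "ts ! i \<in> {a..b}" if "i < length ts" for i using ts that nth_mem by blast
  show "ereal (\<Sum>i<length ts - 1. dist (c (ts ! i)) (c (ts ! Suc i))) \<le> ereal (M * (b - a))"
  proof (cases "ts = []")
    case False
    then have len: "0 < length ts" by simp
    have "(\<Sum>i<length ts - 1. dist (c (ts ! i)) (c (ts ! Suc i))) \<le> (\<Sum>i<length ts - 1. M * (ts ! Suc i - ts ! i))"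
      using nth ts len by (intro sum_mono lip) (auto intro!: sorted_nth_mono)
    also have "\<dots> = M * (ts ! (length ts - 1) - ts ! 0)"
      by (simp add: sum_distrib_left[symmetric] sum_lessThan_telescope)
    also have "\<dots> \<le> M * (b - a)"
      using nth[of 0] nth[of "length ts - 1"] len assms by (intro mult_left_mono) auto
    finally show ?thesis by simp
  qed (use assms in auto)
qed

lemma length_on_reflect: "length_on c a b \<le> length_on (\<lambda>t. c (- t)) (- b) (- a)"
  unfolding length_on_def[of c]
proof (rule SUP_least, clarify)
  fix ts :: "real list" assume ts: "sorted ts" "set ts \<subseteq> {a..b}"
  define us where "us = rev (map uminus ts)"
  have us: "sorted us" "set us \<subseteq> {- b..- a}"
    using ts by (auto simp: us_def sorted_wrt_rev sorted_wrt_map)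
  let ?n = "length ts - 1"
  have "(\<Sum>i<?n. dist (c (ts ! i)) (c (ts ! Suc i))) = (\<Sum>i<?n. dist (c (ts ! (?n - Suc i))) (c (ts ! Suc (?n - Suc i))))"
    by (rule sum.nat_diff_reindex[symmetric])
  also have "\<dots> = (\<Sum>i<length us - 1. dist (c (- (us ! i))) (c (- (us ! Suc i))))"
  proof (rule sum.cong)
    fix i assume "i \<in> {..<length us - 1}"
    then have "i < length ts" "Suc i < length ts" by (auto simp: us_def)
    then show "dist (c (ts ! (?n - Suc i))) (c (ts ! Suc (?n - Suc i))) = dist (c (- (us ! i))) (c (- (us ! Suc i)))"
      by (simp add: us_def rev_nth dist_commute Suc_diff_Suc)
  qed (simp add: us_def)
  finally show "ereal (\<Sum>i<?n. dist (c (ts ! i)) (c (ts ! Suc i))) \<le> length_on (\<lambda>t. c (- t)) (- b) (- a)"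
    using length_on_ge[OF us, of "\<lambda>t. c (- t)"] by simp
qed

text \<open>A partition of the range of a continuous function pulls back to a partition of its domain; this is
what makes the length of a lifted path at least the length of the interval between its ends.\<close>

lemma monotone_preimages:
  fixes \<tau> :: "real \<Rightarrow> real"
  assumes "continuous_on {a..b} \<tau>" "a \<le> b" "sorted ts" "set ts \<subseteq> {\<tau> a..\<tau> b}"
  shows "\<exists>us. sorted us \<and> set us \<subseteq> {a..b} \<and> map \<tau> us = ts"
  using assms
proof (induction ts arbitrary: a)
  case (Cons x xs)
  have "\<exists>c. a \<le> c \<and> c \<le> b \<and> \<tau> c = x"
    using Cons.prems by (intro IVT') auto
  then obtain c where c: "a \<le> c" "c \<le> b" "\<tau> c = x" by blast
  have "\<exists>us. sorted us \<and> set us \<subseteq> {c..b} \<and> map \<tau> us = xs"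
    using Cons.prems c by (intro Cons.IH) (auto intro: continuous_on_subset)
  then obtain us where "sorted us" "set us \<subseteq> {c..b}" "map \<tau> us = xs" by blast
  then show ?case using c by (intro exI[of _ "c # us"]) auto
qed auto

lemma length_on_pullback:
  assumes \<tau>: "continuous_on {a..b} \<tau>" and "a \<le> b" "\<tau> a \<le> \<tau> b" and p: "\<And>t. t \<in> {a..b} \<Longrightarrow> p t = g (\<tau> t)"
  shows "length_on g (\<tau> a) (\<tau> b) \<le> length_on p a b"
  unfolding length_on_def[of g]
proof (rule SUP_least, clarify)
  fix ts :: "real list" assume ts: "sorted ts" "set ts \<subseteq> {\<tau> a..\<tau> b}"
  obtain us where us: "sorted us" "set us \<subseteq> {a..b}" "map \<tau> us = ts"
    using monotone_preimages[OF \<tau> \<open>a \<le> b\<close> ts] by blast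
  have len: "length us = length ts" using us(3) by auto
  have "p (us ! i) = g (ts ! i)" if "i < length ts" for i
  proof -
    have "us ! i \<in> {a..b}" using us(2) len that nth_mem[of i us] by (metis subsetD)
    moreover have "\<tau> (us ! i) = ts ! i" using us(3) len that by auto
    ultimately show ?thesis using p by auto
  qed
  then have "(\<Sum>i<length ts - 1. dist (g (ts ! i)) (g (ts ! Suc i))) = (\<Sum>i<length us - 1. dist (p (us ! i)) (p (us ! Suc i)))"
    using len by (intro sum.cong) auto
  then show "ereal (\<Sum>i<length ts - 1. dist (g (ts ! i)) (g (ts ! Suc i))) \<le> length_on p a b"
    using length_on_ge[OF us(1,2), of p] by simp
qed

locale arc_param =
  fixes g :: "real \<Rightarrow> complex" and l :: real
  assumes l_pos: "0 < l" and periodic: "\<And>s. g (s + l) = g s" and inj_g: "inj_on g {0..<l}"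
    and length_g: "\<And>a b. a \<le> b \<Longrightarrow> length_on g a b = ereal (b - a)"
begin

lemma g_lipschitz: "cmod (g s - g t) \<le> \<bar>s - t\<bar>"
proof -
  have *: "cmod (g s - g t) \<le> t - s" if "s \<le> t" for s t
    using length_on_ge[of "[s, t]" s t g] length_g[OF that] that by (simp add: dist_norm)
  show ?thesis using *[of s t] *[of t s] by (cases "s \<le> t") (auto simp: norm_minus_commute)
qed

lemma cont_g: "continuous_on S g"
  by (rule continuous_onI) (metis dist_norm dist_real_def g_lipschitz less_imp_le order_le_less_trans)

lemma periodic_int: "g (s + of_int n * l) = g s"
proof -
  have nat: "g (s + real n * l) = g s" for n s
  proof (induction n)
    case (Suc n)
    have "s + real (Suc n) * l = (s + real n * l) + l" by (simp add: algebra_simps)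
    then show ?case using periodic[of "s + real n * l"] Suc by metis
  qed simp
  show ?thesis
  proof (cases "0 \<le> n")
    case True then show ?thesis using nat[of s "nat n"] by simp
  next
    case False then show ?thesis using nat[of "s + of_int n * l" "nat (- n)"] by (simp add: algebra_simps)
  qed
qed

lemma residue: "x - of_int \<lfloor>x / l\<rfloor> * l \<in> {0..<l}"
proof -
  have "x / l < of_int \<lfloor>x / l\<rfloor> + 1" "of_int \<lfloor>x / l\<rfloor> \<le> x / l" by linarith+
  then have "x / l * l < (of_int \<lfloor>x / l\<rfloor> + 1) * l" "of_int \<lfloor>x / l\<rfloor> * l \<le> x / l * l"
    using l_pos by (simp_all only: mult_less_cancel_right_pos mult_le_cancel_right_pos)
  then show ?thesis using l_pos by (simp add: algebra_simps)
qed

lemma g_eq_iff: "g s = g t \<longleftrightarrow> (\<exists>n::int. s = t + of_int n * l)"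
proof
  assume eq: "g s = g t"
  define r where "r x = x - of_int \<lfloor>x / l\<rfloor> * l" for x
  have r: "r x \<in> {0..<l}" "g (r x) = g x" for x
  proof -
    show "r x \<in> {0..<l}" unfolding r_def by (rule residue)
    show "g (r x) = g x" using periodic_int[of x "- \<lfloor>x / l\<rfloor>"] by (simp add: r_def)
  qed
  have "r s = r t" using inj_g r eq by (metis inj_onD)
  then have "s = t + of_int (\<lfloor>s / l\<rfloor> - \<lfloor>t / l\<rfloor>) * l" by (simp add: r_def algebra_simps)
  then show "\<exists>n::int. s = t + of_int n * l" ..
qed (auto simp: periodic_int)

lemma g_image: "range g = g ` {0..l}"
proof -
  have "g s \<in> g ` {0..l}" for s
  proof -
    define t where "t = s - of_int \<lfloor>s / l\<rfloor> * l"
    have "t \<in> {0..l}" using residue[of s] by (simp add: t_def)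
    moreover have "g s = g t" using periodic_int[of s "- \<lfloor>s / l\<rfloor>"] by (simp add: t_def)
    ultimately show ?thesis by blast
  qed
  then show ?thesis by auto
qed

lemma cis_period: "cis (2 * pi * (t + of_int n * l) / l) = cis (2 * pi * t / l)"
proof -
  have "2 * pi * (t + of_int n * l) / l = 2 * pi * t / l + 2 * pi * of_int n"
    using l_pos by (simp add: field_simps)
  then show ?thesis by (simp add: cis_mult[symmetric] cis_multiple_2pi)
qed

text \<open>The inverse of \<open>s \<mapsto> g s\<close> modulo \<open>l\<close>, read as a point of the unit circle, is continuous because \<open>g\<close>
is a closed map on the compact interval of one period.\<close>

lemma angle_function:
  obtains \<theta> :: "complex \<Rightarrow> complex"
  where "continuous_on (range g) \<theta>" "\<And>s. \<theta> (g s) = cis (2 * pi * s / l)"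
proof -
  define \<theta> where "\<theta> z = cis (2 * pi * (SOME s. g s = z) / l)" for z
  have eq: "\<theta> (g s) = cis (2 * pi * s / l)" for s
  proof -
    have "g (SOME t. g t = g s) = g s" by (rule someI) (rule refl)
    then obtain n :: int where "(SOME t. g t = g s) = s + of_int n * l" using g_eq_iff by blast
    then show ?thesis unfolding \<theta>_def by (simp only: cis_period)
  qed
  have cl: "closed (range g)"
    unfolding g_image by (intro compact_imp_closed compact_continuous_image cont_g) auto
  have "closed (\<theta> -` T \<inter> range g)" if "closed T" for T
  proof -
    have "\<theta> -` T \<inter> range g = g ` ({0..l} \<inter> (\<lambda>s. cis (2 * pi * s / l)) -` T)"
      unfolding g_image by (auto simp: eq)
    moreover have "compact ({0..l} \<inter> (\<lambda>s. cis (2 * pi * s / l)) -` T)"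
      using that l_pos by (intro compact_Int_closed closed_vimage continuous_intros) auto
    ultimately show ?thesis
      by (metis cont_g compact_continuous_image compact_imp_closed)
  qed
  then have "continuous_on (range g) \<theta>"
    using continuous_on_closed_vimage[OF cl] by blast
  then show ?thesis using eq that by blast
qed

text \<open>Compose with the angle function and take a continuous logarithm.\<close>

lemma lift:
  fixes p :: "real \<Rightarrow> complex"
  assumes p: "continuous_on S p" "p ` S \<subseteq> range g" and S: "contractible S"
  obtains \<tau> where "continuous_on S \<tau>" "\<And>t. t \<in> S \<Longrightarrow> p t = g (\<tau> t)"
proof -
  obtain \<theta> :: "complex \<Rightarrow> complex" where \<theta>: "continuous_on (range g) \<theta>" "\<And>s. \<theta> (g s) = cis (2 * pi * s / l)"
    using angle_function by blast
  have "continuous_on S (\<lambda>t. \<theta> (p t))" using continuous_on_compose2[OF \<theta>(1) p] .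
  moreover have "\<theta> (p t) \<noteq> 0" if "t \<in> S" for t using p(2) that \<theta>(2) by (metis cis_neq_zero image_subset_iff rangeE)
  ultimately obtain L where L: "continuous_on S L" "\<And>t. t \<in> S \<Longrightarrow> \<theta> (p t) = exp (L t)"
    using continuous_logarithm_on_contractible[OF _ S] by metis
  show thesis
  proof
    show "continuous_on S (\<lambda>t. l * Im (L t) / (2 * pi))"
      by (intro continuous_intros L) auto
    fix t assume t: "t \<in> S"
    obtain s where s: "p t = g s" using p(2) t by auto
    have e: "exp (L t) = cis (2 * pi * s / l)" using L(2)[OF t] \<theta>(2) s by simp
    then have "cmod (exp (L t)) = 1" by simp
    then have "L t = \<i> * of_real (Im (L t))" by (simp add: complex_eq_iff)
    then have "exp (\<i> * of_real (Im (L t))) = exp (\<i> * of_real (2 * pi * s / l))"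
      using e by (simp add: cis_conv_exp)
    then obtain n :: int where "\<i> * of_real (Im (L t)) = \<i> * of_real (2 * pi * s / l) + (of_int (2 * n) * pi) * \<i>"
      unfolding exp_eq by blast
    then have "Im (\<i> * of_real (Im (L t))) = Im (\<i> * of_real (2 * pi * s / l) + (of_int (2 * n) * pi) * \<i>)" by simp
    then have "Im (L t) = 2 * pi * s / l + 2 * of_int n * pi" by simp
    then have "l * Im (L t) / (2 * pi) = s + of_int n * l"
      using l_pos by (simp add: field_simps)
    then show "p t = g (l * Im (L t) / (2 * pi))" by (simp add: s periodic_int)
  qed
qed

text \<open>Reflecting the path reduces a decreasing lift to an increasing one.\<close>

lemma lift_length:
  assumes \<tau>: "continuous_on {a..b} \<tau>" and "a \<le> b" and p: "\<And>t. t \<in> {a..b} \<Longrightarrow> p t = g (\<tau> t)"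
  shows "ereal \<bar>\<tau> b - \<tau> a\<bar> \<le> length_on p a b"
proof (cases "\<tau> a \<le> \<tau> b")
  case True
  then show ?thesis using length_on_pullback[OF \<tau> \<open>a \<le> b\<close> True, of p g] p length_g by auto
next
  case False
  have c: "continuous_on {-b..-a} (\<lambda>t. \<tau> (- t))"
    by (intro continuous_on_compose2[OF \<tau>] continuous_intros) auto
  have "length_on g (\<tau> b) (\<tau> a) \<le> length_on (\<lambda>t. p (- t)) (- b) (- a)"
    using length_on_pullback[OF c, of "\<lambda>t. p (- t)" g] False p \<open>a \<le> b\<close> by auto
  also have "\<dots> \<le> length_on p a b"
    using length_on_reflect[of "\<lambda>t. p (- t)" "- b" "- a"] by simp
  finally show ?thesis using length_g[of "\<tau> b" "\<tau> a"] False by auto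
qed

lemma lift_lipschitz:
  assumes \<tau>: "continuous_on UNIV \<tau>" and p: "\<And>t. p t = g (\<tau> t)"
    and lip: "\<And>x y. cmod (p x - p y) \<le> M * \<bar>x - y\<bar>"
  shows "\<bar>\<tau> x - \<tau> y\<bar> \<le> M * \<bar>x - y\<bar>"
proof -
  have M: "0 \<le> M" using order_trans[OF norm_ge_zero lip[of 1 0]] by simp
  have *: "\<bar>\<tau> y - \<tau> x\<bar> \<le> M * (y - x)" if "x \<le> y" for x y
  proof -
    have "ereal \<bar>\<tau> y - \<tau> x\<bar> \<le> length_on p x y"
      using \<tau> that p by (intro lift_length) (auto intro: continuous_on_subset)
    also have "\<dots> \<le> ereal (M * (y - x))"
      using that M lip by (intro length_on_le_lipschitz) (auto simp: dist_norm intro!: order_trans[OF lip])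
    finally show ?thesis by simp
  qed
  show ?thesis using *[of x y] *[of y x] by (cases "x \<le> y") (auto simp: abs_minus_commute)
qed

lemma lift_path:
  assumes p: "path p" "path_image p \<subseteq> range g" and s: "pathstart p = g s"
  obtains \<tau> where "continuous_on {0..1} \<tau>" "\<And>t. t \<in> {0..1} \<Longrightarrow> p t = g (\<tau> t)" "\<tau> 0 = s"
    "ereal \<bar>\<tau> 1 - s\<bar> \<le> path_length p"
proof -
  obtain \<tau> where \<tau>: "continuous_on {0..1} \<tau>" "\<And>t. t \<in> {0..1} \<Longrightarrow> p t = g (\<tau> t)"
    using lift[of "{0..1}" p] p by (metis convex_imp_contractible convex_real_interval(5) path_def path_image_def)
  have "g (\<tau> 0) = g s" using \<tau>(2)[of 0] s by (simp add: pathstart_def)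
  then obtain n :: int where n: "s = \<tau> 0 + of_int n * l" using g_eq_iff by metis
  show thesis
  proof
    show c: "continuous_on {0..1} (\<lambda>t. \<tau> t + of_int n * l)" by (intro continuous_intros \<tau>)
    show e: "p t = g (\<tau> t + of_int n * l)" if "t \<in> {0..1}" for t using \<tau>(2)[OF that] by (simp add: periodic_int)
    show 0: "\<tau> 0 + of_int n * l = s" using n by simp
    show "ereal \<bar>\<tau> 1 + of_int n * l - s\<bar> \<le> path_length p"
      using lift_length[OF c _ e] 0 by (simp add: path_length_def)
  qed
qed

text \<open>Among the representatives of \<open>s - t\<close> modulo \<open>l\<close> the smallest one is the distance along the curve: it
bounds the length of every arc between the two points from below.\<close>

lemma chord_arc_lift:
  assumes ca: "chord_arc B (range g)"
  shows "\<exists>n::int. \<bar>s - t + of_int n * l\<bar> \<le> B * cmod (g s - g t) \<and> \<bar>s - t + of_int n * l\<bar> \<le> \<bar>s - t\<bar>"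
proof (cases "g s = g t")
  case True
  then obtain n :: int where "s = t + of_int n * l" using g_eq_iff by blast
  then show ?thesis using True by (intro exI[of _ "- n"]) simp
next
  case False
  \<comment> \<open>The representative of \<open>s - t\<close> modulo \<open>l\<close> that is closest to 0.\<close>
  define n where "n = - round ((s - t) / l)"
  have min: "\<bar>s - t + of_int n * l\<bar> \<le> \<bar>s - t + of_int m * l\<bar>" for m :: int
  proof -
    have scale: "\<bar>s - t + of_int k * l\<bar> = l * \<bar>(s - t) / l - of_int (- k)\<bar>" for k :: int
    proof -
      have "s - t + of_int k * l = l * ((s - t) / l - of_int (- k))" using l_pos by (simp add: field_simps)
      then show ?thesis using l_pos by (simp add: abs_mult)
    qed
    show ?thesis unfolding scale using l_pos round_diff_minimal[of "(s - t) / l" "- m"]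
      by (intro mult_left_mono) (auto simp: n_def)
  qed
  have "ereal \<bar>s - t + of_int n * l\<bar> \<le> curve_dist (range g) (g s) (g t)"
  proof -
    have "ereal \<bar>s - t + of_int n * l\<bar> \<le> path_length p"
      if p: "arc p" "path_image p \<subseteq> range g" "pathstart p = g s" "pathfinish p = g t" for p
    proof -
      obtain \<tau> where \<tau>: "\<And>t. t \<in> {0..1} \<Longrightarrow> p t = g (\<tau> t)" "ereal \<bar>\<tau> 1 - s\<bar> \<le> path_length p"
        using lift_path[OF arc_imp_path[OF p(1)] p(2,3)] by metis
      have "g (\<tau> 1) = g t" using \<tau>(1)[of 1] p(4) by (simp add: pathfinish_def)
      then obtain m :: int where "\<tau> 1 = t + of_int m * l" using g_eq_iff by blast
      then have "\<bar>\<tau> 1 - s\<bar> = \<bar>s - t + of_int (- m) * l\<bar>" by (simp add: abs_minus_commute algebra_simps)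
      then show ?thesis using \<tau>(2) min[of "- m"] by (metis ereal_less_eq(3) order_trans)
    qed
    then show ?thesis unfolding curve_dist_def using False by (auto intro!: INF_greatest)
  qed
  also have "\<dots> \<le> ereal (B * dist (g s) (g t))" using ca by (auto simp: chord_arc_def)
  finally show ?thesis using min[of 0] by (auto simp: dist_norm)
qed

text \<open>If the lift turned back at the common end point, the two arcs would overlap near it.\<close>

lemma turn:
  assumes p: "arc p" "path_image p \<subseteq> range g" and q: "arc q" "path_image q \<subseteq> range g"
    and meet: "path_image p \<inter> path_image q = {pathfinish p}" and "pathstart q = pathfinish p"
    and \<tau>: "continuous_on {0..1} \<tau>" "\<And>t. t \<in> {0..1} \<Longrightarrow> p t = g (\<tau> t)"
    and \<rho>: "continuous_on {0..1} \<rho>" "\<And>t. t \<in> {0..1} \<Longrightarrow> q t = g (\<rho> t)" and "\<rho> 0 = \<tau> 1"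
  shows "0 < (\<tau> 1 - \<tau> 0) * (\<rho> 1 - \<rho> 0)"
proof -
  have ne: "\<tau> 1 \<noteq> \<tau> 0" "\<rho> 1 \<noteq> \<rho> 0"
    using \<tau>(2)[of 0] \<tau>(2)[of 1] \<rho>(2)[of 0] \<rho>(2)[of 1] arc_distinct_ends[OF p(1)] arc_distinct_ends[OF q(1)]
    by (auto simp: pathstart_def pathfinish_def)
  have img: "g y \<in> path_image f" if "continuous_on {0..1} \<sigma>" "\<And>t. t \<in> {0..1} \<Longrightarrow> f t = g (\<sigma> t)"
    "y \<in> closed_segment (\<sigma> 0) (\<sigma> 1)" for y f \<sigma>
  proof -
    have "y \<in> \<sigma> ` {0..1}"
      using that ivt_increasing_component_on_1[of 0 1 \<sigma> 1 y] ivt_decreasing_component_on_1[of 0 1 \<sigma> 1 y]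
      by (auto simp: closed_segment_eq_real_ivl split: if_splits)
    then show ?thesis using that(2) by (auto simp: path_image_def)
  qed
  have no: "y = \<tau> 1" if y: "y \<in> closed_segment (\<tau> 0) (\<tau> 1)" "y \<in> closed_segment (\<rho> 0) (\<rho> 1)" "\<bar>y - \<tau> 1\<bar> < l" for y
  proof -
    have "g y \<in> path_image p \<inter> path_image q" using img[OF \<tau> y(1)] img[OF \<rho> y(2)] by blast
    then have "g y = g (\<tau> 1)" using meet \<tau>(2)[of 1] by (auto simp: pathfinish_def)
    then obtain n :: int where n: "y = \<tau> 1 + of_int n * l" using g_eq_iff by blast
    then have "\<bar>of_int n\<bar> * l < 1 * l" using y(3) l_pos by (simp add: abs_mult)
    then have "\<bar>of_int n :: real\<bar> < 1" using l_pos by (simp only: mult_less_cancel_right_pos)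
    then have "n = 0" by linarith
    then show ?thesis using n by simp
  qed
  show ?thesis
  proof (rule ccontr)
    assume "\<not> ?thesis"
    then have "(\<tau> 1 - \<tau> 0) * (\<rho> 1 - \<rho> 0) < 0" using ne by (simp add: not_less order_le_less)
    then consider "\<tau> 1 > \<tau> 0" "\<rho> 1 < \<rho> 0" | "\<tau> 1 < \<tau> 0" "\<rho> 1 > \<rho> 0"
      by (auto simp: mult_less_0_iff)
    then show False
    proof cases
      case 1
      define y where "y = max (max (\<tau> 0) (\<rho> 1)) (\<tau> 1 - l / 2)"
      have "y = \<tau> 1"
        using 1 l_pos \<open>\<rho> 0 = \<tau> 1\<close> by (intro no) (auto simp: y_def closed_segment_eq_real_ivl)
      then show False using 1 l_pos \<open>\<rho> 0 = \<tau> 1\<close> by (auto simp: y_def max_def split: if_splits)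
    next
      case 2
      define y where "y = min (min (\<tau> 0) (\<rho> 1)) (\<tau> 1 + l / 2)"
      have "y = \<tau> 1"
        using 2 l_pos \<open>\<rho> 0 = \<tau> 1\<close> by (intro no) (auto simp: y_def closed_segment_eq_real_ivl)
      then show False using 2 l_pos \<open>\<rho> 0 = \<tau> 1\<close> by (auto simp: y_def min_def split: if_splits)
    qed
  qed
qed

text \<open>By \<open>turn\<close> the three lifted arcs continue in one direction. Their displacements add up to a nonzero
multiple of the period, and none exceeds a third of it, so each is exactly a third.\<close>

lemma trisects_apart:
  assumes tri: "trisects (range g) (w0::complex) w1 w2" and len: "curve_length (range g) = ereal l"
  shows "g s = w0 \<Longrightarrow> g t = w1 \<Longrightarrow> l / 3 \<le> \<bar>s - t\<bar>"
    "g s = w1 \<Longrightarrow> g t = w2 \<Longrightarrow> l / 3 \<le> \<bar>s - t\<bar>"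
    "g s = w2 \<Longrightarrow> g t = w0 \<Longrightarrow> l / 3 \<le> \<bar>s - t\<bar>"
proof -
  obtain p0 p1 p2 where arcs: "arc p0" "arc p1" "arc p2"
    and ends: "pathstart p0 = w0" "pathfinish p0 = w1" "pathstart p1 = w1" "pathfinish p1 = w2"
        "pathstart p2 = w2" "pathfinish p2 = w0"
    and un: "path_image p0 \<union> path_image p1 \<union> path_image p2 = range g"
    and int: "path_image p0 \<inter> path_image p1 = {w1}" "path_image p1 \<inter> path_image p2 = {w2}"
    and lens: "path_length p0 = curve_length (range g) / 3" "path_length p1 = curve_length (range g) / 3"
        "path_length p2 = curve_length (range g) / 3"
    using tri unfolding trisects_def by blast
  have img: "path_image p0 \<subseteq> range g" "path_image p1 \<subseteq> range g" "path_image p2 \<subseteq> range g" using un by auto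
  have l3: "curve_length (range g) / 3 = ereal (l / 3)"
    unfolding len using ereal_divide[of l 3] by simp
  have "w0 \<in> range g" using img ends by (metis pathstart_in_path_image subsetD)
  then obtain s0 where s0: "w0 = g s0" by auto
  obtain \<tau>0 where t0: "continuous_on {0..1} \<tau>0" "\<And>t. t \<in> {0..1} \<Longrightarrow> p0 t = g (\<tau>0 t)" "\<tau>0 0 = s0"
    "ereal \<bar>\<tau>0 1 - s0\<bar> \<le> path_length p0"
    using lift_path[OF arc_imp_path[OF arcs(1)] img(1)] ends s0 by metis
  have w1: "w1 = g (\<tau>0 1)" using t0(2)[of 1] ends(2) by (simp add: pathfinish_def)
  obtain \<tau>1 where t1: "continuous_on {0..1} \<tau>1" "\<And>t. t \<in> {0..1} \<Longrightarrow> p1 t = g (\<tau>1 t)" "\<tau>1 0 = \<tau>0 1"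
    "ereal \<bar>\<tau>1 1 - \<tau>0 1\<bar> \<le> path_length p1"
    using lift_path[OF arc_imp_path[OF arcs(2)] img(2)] ends w1 by metis
  have w2: "w2 = g (\<tau>1 1)" using t1(2)[of 1] ends(4) by (simp add: pathfinish_def)
  obtain \<tau>2 where t2: "continuous_on {0..1} \<tau>2" "\<And>t. t \<in> {0..1} \<Longrightarrow> p2 t = g (\<tau>2 t)" "\<tau>2 0 = \<tau>1 1"
    "ereal \<bar>\<tau>2 1 - \<tau>1 1\<bar> \<le> path_length p2"
    using lift_path[OF arc_imp_path[OF arcs(3)] img(3)] ends w2 by metis
  define a b c where "a = \<tau>0 1 - s0" and "b = \<tau>1 1 - \<tau>0 1" and "c = \<tau>2 1 - \<tau>1 1"
  have le: "\<bar>a\<bar> \<le> l / 3" "\<bar>b\<bar> \<le> l / 3" "\<bar>c\<bar> \<le> l / 3"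
    using t0(4) t1(4) t2(4) unfolding lens l3 a_def b_def c_def by simp_all
  have ab: "0 < a * b"
    using turn[OF arcs(1) img(1) arcs(2) img(2) _ _ t0(1,2) t1(1,2)] int ends t0 t1
    by (simp add: a_def b_def)
  have bc: "0 < b * c"
    using turn[OF arcs(2) img(2) arcs(3) img(3) _ _ t1(1,2) t2(1,2)] int ends t1 t2
    by (simp add: b_def c_def)
  have "g (\<tau>2 1) = g s0" using t2(2)[of 1] ends s0 by (simp add: pathfinish_def)
  then obtain n :: int where n: "\<tau>2 1 = s0 + of_int n * l" using g_eq_iff by blast
  then have sum: "a + b + c = of_int n * l" by (simp add: a_def b_def c_def)
  have sgn: "(0 < a \<and> 0 < b \<and> 0 < c) \<or> (a < 0 \<and> b < 0 \<and> c < 0)"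
    using ab bc by (auto simp: zero_less_mult_iff)
  then have "n \<noteq> 0" using sum by auto
  then have "1 \<le> \<bar>of_int n :: real\<bar>" by linarith
  then have "1 * l \<le> \<bar>of_int n\<bar> * l" using l_pos by (intro mult_right_mono) auto
  then have big: "l \<le> \<bar>a + b + c\<bar>" using sum l_pos by (simp add: abs_mult)
  have eq: "\<bar>a\<bar> = l / 3" "\<bar>b\<bar> = l / 3" "\<bar>c\<bar> = l / 3"
    using sgn le big by auto
  have key: "l / 3 \<le> \<bar>s - t\<bar>" if st: "g s = g x" "g t = g y" and d: "\<bar>y - x\<bar> = l / 3" for s t x y
  proof -
    obtain i j :: int where ij: "s = x + of_int i * l" "t = y + of_int j * l" using st g_eq_iff by metis
    define k where "k = i - j"
    have k: "s - t = x - y + of_int k * l" by (simp add: ij k_def algebra_simps)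
    consider "k = 0" | "k \<ge> 1" | "k \<le> -1" by linarith
    then show ?thesis
    proof cases
      case 1 then show ?thesis using k d by (simp add: abs_minus_commute)
    next
      case 2
      then have "1 * l \<le> of_int k * l" using l_pos by (intro mult_right_mono) auto
      then show ?thesis using k d l_pos by linarith
    next
      case 3
      then have "of_int k * l \<le> of_int (-1) * l" using l_pos by (intro mult_right_mono) (auto simp only: of_int_le_iff)
      then have "of_int k * l \<le> - l" by simp
      then show ?thesis using k d l_pos by linarith
    qed
  qed
  show "g s = w0 \<Longrightarrow> g t = w1 \<Longrightarrow> l / 3 \<le> \<bar>s - t\<bar>"
    using key[of s s0 t "\<tau>0 1"] s0 w1 eq(1) by (simp add: a_def)
  show "g s = w1 \<Longrightarrow> g t = w2 \<Longrightarrow> l / 3 \<le> \<bar>s - t\<bar>"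
    using key[of s "\<tau>0 1" t "\<tau>1 1"] w1 w2 eq(2) by (simp add: b_def)
  show "g s = w2 \<Longrightarrow> g t = w0 \<Longrightarrow> l / 3 \<le> \<bar>s - t\<bar>"
    using key[of s "\<tau>1 1" t "\<tau>2 1"] w2 s0 \<open>g (\<tau>2 1) = g s0\<close> eq(3) by (simp add: c_def)
qed

end

text \<open>The values of \<open>\<sigma>\<close> differ by multiples of \<open>l\<close>, hence lie in a discrete set.\<close>

lemma (in arc_param) lift_constant:
  fixes \<sigma> :: "real \<Rightarrow> real"
  assumes c: "continuous_on {a..b} \<sigma>" and g: "\<And>x. x \<in> {a..b} \<Longrightarrow> g (\<sigma> x) = g (\<sigma> a)" and z: "z \<in> {a..b}"
  shows "\<sigma> z = \<sigma> a"
proof (rule ccontr)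
  assume ne: "\<sigma> z \<noteq> \<sigma> a"
  define e where "e = min \<bar>\<sigma> z - \<sigma> a\<bar> (l / 2)"
  have e: "0 < e" "e < l" "e \<le> \<bar>\<sigma> z - \<sigma> a\<bar>" using ne l_pos by (auto simp: e_def)
  define v where "v = \<sigma> a + sgn (\<sigma> z - \<sigma> a) * e"
  have cz: "continuous_on {a..z} \<sigma>" using c z by (auto intro: continuous_on_subset)
  have "\<exists>x. a \<le> x \<and> x \<le> z \<and> \<sigma> x = v"
  proof (cases "\<sigma> a < \<sigma> z")
    case True
    then have "\<sigma> a \<le> v" "v \<le> \<sigma> z" using e by (auto simp: v_def)
    then show ?thesis using IVT'[of \<sigma> a v z] cz z by auto
  next
    case False
    then have "v \<le> \<sigma> a" "\<sigma> z \<le> v" using e ne by (auto simp: v_def)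
    then show ?thesis using IVT2'[of \<sigma> z v a] cz z by auto
  qed
  then obtain x where x: "a \<le> x" "x \<le> z" "\<sigma> x = v" by blast
  then have "g v = g (\<sigma> a)" using g[of x] z by auto
  then obtain n :: int where n: "v = \<sigma> a + of_int n * l" using g_eq_iff by blast
  have "of_int n * l = sgn (\<sigma> z - \<sigma> a) * e" using n by (simp add: v_def)
  then have "\<bar>of_int n * l\<bar> = e" using ne e by (simp add: abs_mult abs_sgn_eq)
  then have m: "\<bar>of_int n\<bar> * l = e" using l_pos by (simp add: abs_mult)
  then have "n \<noteq> 0" using e by auto
  then have "1 \<le> \<bar>of_int n :: real\<bar>" by linarith
  then have "1 * l \<le> \<bar>of_int n\<bar> * l" using l_pos by (intro mult_right_mono) auto
  then show False using m e by simp
qed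

locale smooth_arc_param = arc_param +
  fixes \<mu> H :: real
  assumes differentiable: "\<And>s. g differentiable (at s)" and \<mu>_pos: "0 < \<mu>"
    and holder: "\<And>s t. cmod (vector_derivative g (at s) - vector_derivative g (at t)) \<le> H * \<bar>s - t\<bar> powr \<mu>"
begin

abbreviation g' :: "real \<Rightarrow> complex" where "g' s \<equiv> vector_derivative g (at s)"

lemma g_deriv: "(g has_vector_derivative g' s) (at s)"
  using differentiable[of s] by (simp add: vector_derivative_works)

lemma H_nonneg: "0 \<le> H"
  using order_trans[OF norm_ge_zero holder[of 1 0]] by simp

lemma speed_le_1: "cmod (g' s) \<le> 1"
  using lipschitz_vector_derivative_le[OF g_deriv[of s], of 1] g_lipschitz by simp

text \<open>If the speed were below 1 at a point, then by continuity of the derivative a short piece of the curve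
would be shorter than its parameter interval.\<close>

lemma unit_speed: "cmod (g' s) = 1"
proof (rule ccontr)
  assume "cmod (g' s) \<noteq> 1"
  then have lt: "cmod (g' s) < 1" using speed_le_1[of s] by simp
  define c where "c = (1 + cmod (g' s)) / 2"
  have c: "cmod (g' s) < c" "c < 1" "0 \<le> c" using lt by (auto simp: c_def add_nonneg_nonneg)
  have "((\<lambda>h. H * h powr \<mu>) \<longlongrightarrow> H * 0 powr \<mu>) (at_right 0)"
    using \<mu>_pos by (intro tendsto_intros tendsto_powr') (auto simp: eventually_at_filter intro!: always_eventually)
  then have "eventually (\<lambda>h. H * h powr \<mu> < c - cmod (g' s)) (at_right 0)"
    using c by (intro order_tendstoD(2)) auto
  then obtain d where d: "0 < d" "\<And>h. 0 < h \<Longrightarrow> h < d \<Longrightarrow> H * h powr \<mu> < c - cmod (g' s)"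
    unfolding eventually_at_right_field by auto
  define e where "e = d / 2"
  have e: "0 < e" "e < d" using d by (auto simp: e_def)
  have bd: "cmod (g' x) \<le> c" if "s \<le> x" "x \<le> s + e" for x
  proof (cases "x = s")
    case False
    have "cmod (g' x) \<le> cmod (g' s) + cmod (g' x - g' s)" using norm_triangle_sub[of "g' x" "g' s"] by simp
    also have "\<dots> \<le> cmod (g' s) + H * \<bar>x - s\<bar> powr \<mu>" using holder by simp
    also have "\<dots> \<le> c" using d(2)[of "x - s"] False that e by simp
    finally show ?thesis .
  qed (use c in simp)
  have lip: "dist (g x) (g y) \<le> c * (y - x)" if "s \<le> x" "x \<le> y" "y \<le> s + e" for x y
  proof -
    have "cmod (g y - g x) \<le> c * cmod (of_real y - of_real x :: complex)" 
    proof (cases "x = y")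
      case False
      have "norm (g y - g x) \<le> c * y - c * x"
      proof (rule differentiable_bound_general[where f=g and \<phi>="\<lambda>x. c * x" and f'=g' and \<phi>'="\<lambda>_. c"])
        show "continuous_on {x..y} g" by (rule cont_g)
        show "(g has_vector_derivative g' z) (at z)" for z by (rule g_deriv)
        show "((*) c has_vector_derivative c) (at z)" for z
          by (auto intro!: derivative_eq_intros simp: has_real_derivative_iff_has_vector_derivative[symmetric])
        show "norm (g' z) \<le> c" if "x < z" "z < y" for z using bd[of z] that \<open>s \<le> x\<close> \<open>y \<le> s + e\<close> by auto
      qed (use False that in \<open>auto intro!: continuous_intros\<close>)
      then show ?thesis using that by (simp add: right_diff_distrib flip: of_real_diff)
    qed simp
    then show ?thesis using that by (simp add: dist_norm norm_minus_commute flip: of_real_diff)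
  qed
  have "length_on g s (s + e) \<le> ereal (c * (s + e - s))"
    using e c lip by (intro length_on_le_lipschitz) auto
  then have "e \<le> c * e" using length_g[of s "s + e"] e by simp
  then show False using c e by simp
qed

text \<open>The derivative of the normal component at \<open>x\<close> is the normal component of \<open>g' x - g' t\<close>.\<close>

lemma normal_deviation:
  "\<bar>(g s - g t) \<bullet> (\<i> * g' t)\<bar> \<le> H / (1 + \<mu>) * \<bar>s - t\<bar> powr (1 + \<mu>)"
proof -
  define N where "N = \<i> * g' t"
  have N: "norm N = 1" by (simp add: N_def norm_mult unit_speed)
  define k where "k x = (g x - g t) \<bullet> N" for x
  have kd: "(k has_vector_derivative (g' x - g' t) \<bullet> N) (at x)" for x
  proof -
    have "(k has_vector_derivative g' x \<bullet> N) (at x)"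
      unfolding k_def has_vector_derivative_def
      by (auto intro!: derivative_eq_intros g_deriv[unfolded has_vector_derivative_def] simp: inner_left_distrib)
    moreover have "g' t \<bullet> N = 0" by (simp add: N_def inner_complex_def)
    ultimately show ?thesis by (simp add: inner_diff_left)
  qed
  have kb: "norm ((g' x - g' t) \<bullet> N) \<le> H * \<bar>x - t\<bar> powr \<mu>" for x
    using Cauchy_Schwarz_ineq2[of "g' x - g' t" N] N holder[of x t] by simp
  have ck: "continuous_on S k" for S using kd by (meson continuous_at_imp_continuous_on has_vector_derivative_continuous)
  have pd: "((\<lambda>x. H / (1 + \<mu>) * (x - t) powr (1 + \<mu>)) has_vector_derivative H * (x - t) powr \<mu>) (at x)"
    if "t < x" for x
    unfolding has_real_derivative_iff_has_vector_derivative[symmetric] using that \<mu>_pos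
    by (auto intro!: derivative_eq_intros)
  have pd': "((\<lambda>x. - (H / (1 + \<mu>) * (t - x) powr (1 + \<mu>))) has_vector_derivative H * (t - x) powr \<mu>) (at x)"
    if "x < t" for x
    unfolding has_real_derivative_iff_has_vector_derivative[symmetric] using that \<mu>_pos
    by (auto intro!: derivative_eq_intros)
  have cp: "continuous_on {a..b} (\<lambda>x. f x powr (1 + \<mu>))" if "continuous_on {a..b} f" "\<And>x. x \<in> {a..b} \<Longrightarrow> 0 \<le> f x" for a b and f :: "real \<Rightarrow> real"
    using that \<mu>_pos by (intro continuous_on_powr') (auto intro!: continuous_intros)
  have "norm (k s) \<le> H / (1 + \<mu>) * \<bar>s - t\<bar> powr (1 + \<mu>)"
  proof (cases s t rule: linorder_cases)
    case equal then show ?thesis by (simp add: k_def)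
  next
    case greater
    have "norm (k s - k t) \<le> H / (1 + \<mu>) * (s - t) powr (1 + \<mu>) - H / (1 + \<mu>) * (t - t) powr (1 + \<mu>)"
    proof (rule differentiable_bound_general[where f=k and f'="\<lambda>x. (g' x - g' t) \<bullet> N" and \<phi>="\<lambda>x. H / (1 + \<mu>) * (x - t) powr (1 + \<mu>)" and \<phi>'="\<lambda>x. H * (x - t) powr \<mu>"])
      show "continuous_on {t..s} (\<lambda>x. H / (1 + \<mu>) * (x - t) powr (1 + \<mu>))"
        by (intro continuous_intros cp) auto
      show "norm ((g' x - g' t) \<bullet> N) \<le> H * (x - t) powr \<mu>" if "t < x" for x using kb[of x] that by simp
    qed (use greater ck kd pd in auto)
    then show ?thesis using greater by (simp add: k_def)
  next
    case less
    have "norm (k t - k s) \<le> - (H / (1 + \<mu>) * (t - t) powr (1 + \<mu>)) - - (H / (1 + \<mu>) * (t - s) powr (1 + \<mu>))"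
    proof (rule differentiable_bound_general[where f=k and f'="\<lambda>x. (g' x - g' t) \<bullet> N" and \<phi>="\<lambda>x. - (H / (1 + \<mu>) * (t - x) powr (1 + \<mu>))" and \<phi>'="\<lambda>x. H * (t - x) powr \<mu>"])
      show "continuous_on {s..t} (\<lambda>x. - (H / (1 + \<mu>) * (t - x) powr (1 + \<mu>)))"
        by (intro continuous_intros cp) auto
      show "norm ((g' x - g' t) \<bullet> N) \<le> H * (t - x) powr \<mu>" if "x < t" for x
        using kb[of x] that by (simp add: abs_minus_commute)
    qed (use less ck kd pd' in auto)
    then show ?thesis using less by (simp add: k_def)
  qed
  then show ?thesis by (simp add: k_def N_def)
qed

end

section \<open>The boundary correspondence is monotone\<close>

locale disc_homeo =
  fixes w :: "complex \<Rightarrow> complex"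
  assumes cont: "continuous_on (cball 0 1) w" and inj: "inj_on w (ball 0 1)"
begin

definition bdry :: "real \<Rightarrow> complex" where "bdry x = w (cis x)"

lemma open_image: "X \<subseteq> ball 0 1 \<Longrightarrow> open X \<Longrightarrow> open (w ` X)"
  by (intro invariance_of_domain continuous_on_subset[OF cont] inj_on_subset[OF inj])
     (auto simp: subset_iff intro: less_imp_le)

lemma cont_bdry: "continuous_on S bdry"
  unfolding bdry_def by (intro continuous_on_compose2[OF cont] continuous_intros) auto

lemma bdry_periodic: "bdry (x + 2 * pi) = bdry x"
  by (simp add: bdry_def cis_mult[symmetric])

end

text \<open>The hypothesis \<open>fibre\<close> says that two arguments with the same image bound an interval of constancy. By the intermediate value
theorem any value attained twice in a way that contradicts monotonicity, or any total increment
other than one period, yields two points with the same image such that the map is not constant on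
either arc between them.\<close>

lemma monotone_lift:
  fixes \<sigma> :: "real \<Rightarrow> real"
  assumes cont: "continuous_on UNIV \<sigma>" and T: "0 < T" and l: "0 < l"
    and shift: "\<And>x. \<sigma> (x + T) = \<sigma> x + of_int d * l"
    and fibre: "\<And>x y. x < y \<Longrightarrow> y < x + T \<Longrightarrow> \<exists>n::int. \<sigma> y = \<sigma> x + of_int n * l \<Longrightarrow>
        (\<forall>z\<in>{x..y}. \<sigma> z = \<sigma> x) \<or> (\<forall>z\<in>{y..x + T}. \<sigma> z = \<sigma> y)"
    and nonconst: "\<sigma> x0 \<noteq> \<sigma> y0"
  shows "(d = 1 \<and> mono \<sigma>) \<or> (d = -1 \<and> antimono \<sigma>)"
proof -
  have c: "continuous_on {a..b} \<sigma>" for a b using cont by (rule continuous_on_subset) auto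
  have shift_int: "\<sigma> (x + of_int n * T) = \<sigma> x + of_int n * (of_int d * l)" for x n
  proof -
    have nat: "\<sigma> (x + real m * T) = \<sigma> x + real m * (of_int d * l)" for m x
    proof (induction m)
      case (Suc m)
      show ?case using shift[of "x + real m * T"] Suc by (simp add: algebra_simps)
    qed simp
    show ?thesis
    proof (cases "0 \<le> n")
      case True then show ?thesis using nat[of x "nat n"] by simp
    next
      case False then show ?thesis using nat[of "x + of_int n * T" "nat (- n)"] by (simp add: algebra_simps)
    qed
  qed
  \<comment> \<open>If the total increment vanished, a value strictly between minimum and maximum would be
    taken on both sides of the maximum, and one of the two arcs between contains an extremum.\<close>
  have d0: "d \<noteq> 0"
  proof
    assume d: "d = 0"
    have per: "\<exists>y\<in>{a..a + T}. \<sigma> y = \<sigma> x" for x a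
    proof -
      define n where "n = \<lfloor>(x - a) / T\<rfloor>"
      have "of_int n \<le> (x - a) / T" "(x - a) / T < of_int n + 1" unfolding n_def by linarith+
      then have "of_int n * T \<le> x - a" "x - a < (of_int n + 1) * T" using T by (simp_all add: field_simps)
      then show ?thesis using shift_int[of x "- n"] d
        by (intro bexI[of _ "x + of_int (- n) * T"]) (auto simp: algebra_simps)
    qed
    obtain xm where xm: "xm \<in> {0..T}" "\<And>y. y \<in> {0..T} \<Longrightarrow> \<sigma> xm \<le> \<sigma> y"
      using continuous_attains_inf[of "{0..T}" \<sigma>] c T by fastforce
    have xm': "\<sigma> xm \<le> \<sigma> y" for y using xm(2) per[of 0 y] by (metis add_0)
    obtain xM where xM: "xM \<in> {xm..xm + T}" "\<And>y. y \<in> {xm..xm + T} \<Longrightarrow> \<sigma> y \<le> \<sigma> xM"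
      using continuous_attains_sup[of "{xm..xm + T}" \<sigma>] c T by fastforce
    have xM': "\<sigma> y \<le> \<sigma> xM" for y using xM(2) per[of xm y] by metis
    have lt: "\<sigma> xm < \<sigma> xM"
      using nonconst xm'[of x0] xm'[of y0] xM'[of x0] xM'[of y0] by linarith
    define v where "v = (\<sigma> xm + \<sigma> xM) / 2"
    have v: "\<sigma> xm < v" "v < \<sigma> xM" using lt by (auto simp: v_def)
    have end': "\<sigma> (xm + T) = \<sigma> xm" using shift[of xm] d by simp
    obtain x1 where x1: "xm \<le> x1" "x1 \<le> xM" "\<sigma> x1 = v"
      using IVT'[of \<sigma> xm v xM] v xM c by auto
    obtain x2 where x2: "xM \<le> x2" "x2 \<le> xm + T" "\<sigma> x2 = v"
      using IVT2'[of \<sigma> "xm + T" v xM] v xM c end' by auto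
    have ne: "x1 \<noteq> xm" "x1 \<noteq> xM" "x2 \<noteq> xM" "x2 \<noteq> xm + T" using v x1 x2 end' by auto
    have "\<exists>n::int. \<sigma> x2 = \<sigma> x1 + of_int n * l" using x1 x2 by (intro exI[of _ 0]) simp
    then have "(\<forall>z\<in>{x1..x2}. \<sigma> z = \<sigma> x1) \<or> (\<forall>z\<in>{x2..x1 + T}. \<sigma> z = \<sigma> x2)"
      using x1 x2 ne by (intro fibre) auto
    moreover have "xM \<in> {x1..x2}" "xm + T \<in> {x2..x1 + T}" using x1 x2 by auto
    ultimately have "\<sigma> xM = v \<or> \<sigma> (xm + T) = v" using x1(3) x2(3) by metis
    then show False using v end' by auto
  qed
  have main: "d = 1 \<and> mono \<sigma>"
    if cont: "continuous_on UNIV \<sigma>" and shift: "\<And>x. \<sigma> (x + T) = \<sigma> x + of_int d * l" and d: "0 < d"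
      and fibre: "\<And>x y. x < y \<Longrightarrow> y < x + T \<Longrightarrow> \<exists>n::int. \<sigma> y = \<sigma> x + of_int n * l \<Longrightarrow>
        (\<forall>z\<in>{x..y}. \<sigma> z = \<sigma> x) \<or> (\<forall>z\<in>{y..x + T}. \<sigma> z = \<sigma> y)"
    for \<sigma> :: "real \<Rightarrow> real" and d :: int
  proof
    have c: "continuous_on {a..b} \<sigma>" for a b using cont by (rule continuous_on_subset) auto
    show d1: "d = 1"
    proof (rule ccontr)
      assume "d \<noteq> 1"
      then have "2 \<le> d" using d by simp
      then have "2 * l \<le> of_int d * l" using l by (intro mult_right_mono) auto
      then have lt: "\<sigma> 0 + l < \<sigma> (0 + T)" using shift[of 0] l by simp
      obtain y where y: "0 \<le> y" "y \<le> 0 + T" "\<sigma> y = \<sigma> 0 + l"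
        using IVT'[of \<sigma> 0 "\<sigma> 0 + l" "0 + T"] lt l T c by auto
      have "y \<noteq> 0" "y \<noteq> 0 + T" using y lt l by auto
      moreover have "\<exists>n::int. \<sigma> y = \<sigma> 0 + of_int n * l" using y by (intro exI[of _ 1]) simp
      ultimately have "(\<forall>z\<in>{0..y}. \<sigma> z = \<sigma> 0) \<or> (\<forall>z\<in>{y..0 + T}. \<sigma> z = \<sigma> y)"
        using y by (intro fibre) auto
      moreover have "y \<in> {0..y}" "0 + T \<in> {y..0 + T}" using y by auto
      ultimately have "\<sigma> y = \<sigma> 0 \<or> \<sigma> (0 + T) = \<sigma> y" by blast
      then show False using y lt l by auto
    qed
    have local: "\<sigma> x \<le> \<sigma> y" if xy: "x \<le> y" "y < x + T" for x y
    proof (rule ccontr)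
      assume "\<not> \<sigma> x \<le> \<sigma> y"
      then have lt: "\<sigma> y < \<sigma> x" by simp
      have up: "\<sigma> (x + T) = \<sigma> x + l" using shift[of x] d1 by simp
      obtain z where z: "y \<le> z" "z \<le> x + T" "\<sigma> z = \<sigma> x"
        using IVT'[of \<sigma> y "\<sigma> x" "x + T"] lt up l xy c by auto
      have "z \<noteq> x + T" "x \<noteq> y" "z \<noteq> y" using z up l lt by auto
      then have "(\<forall>u\<in>{x..z}. \<sigma> u = \<sigma> x) \<or> (\<forall>u\<in>{z..x + T}. \<sigma> u = \<sigma> z)"
        using z xy by (intro fibre exI[of _ 0]) auto
      moreover have "y \<in> {x..z}" "x + T \<in> {z..x + T}" using z xy by auto
      ultimately have "\<sigma> y = \<sigma> x \<or> \<sigma> (x + T) = \<sigma> z" by blast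
      then show False using z up l lt by auto
    qed
    have steps: "\<sigma> x \<le> \<sigma> y" if "x \<le> y" "y - x \<le> real n * (T / 2)" for n x y
      using that
    proof (induction n arbitrary: y)
      case (Suc n)
      define y' where "y' = max x (y - T / 2)"
      have "\<sigma> x \<le> \<sigma> y'" using Suc.prems T by (intro Suc.IH) (auto simp: y'_def algebra_simps max_def)
      also have "\<dots> \<le> \<sigma> y" using Suc.prems T by (intro local) (auto simp: y'_def)
      finally show ?case .
    qed auto
    show "mono \<sigma>"
    proof (rule monoI)
      fix x y :: real assume "x \<le> y"
      moreover obtain n where "(y - x) / (T / 2) \<le> real n" using real_arch_simple by blast
      then have "y - x \<le> real n * (T / 2)" using T by (simp add: field_simps)
      ultimately show "\<sigma> x \<le> \<sigma> y" by (rule steps)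
    qed
  qed
  show ?thesis
  proof (cases "0 < d")
    case True
    then show ?thesis using main[OF cont shift True fibre] by blast
  next
    case False
    have "- d = 1 \<and> mono (\<lambda>x. - \<sigma> x)"
    proof (rule main)
      show "continuous_on UNIV (\<lambda>x. - \<sigma> x)" by (intro continuous_intros cont)
      show "- \<sigma> (x + T) = - \<sigma> x + of_int (- d) * l" for x using shift[of x] by simp
      show "0 < - d" using False d0 by simp
      fix x y :: real assume xy: "x < y" "y < x + T" "\<exists>n::int. - \<sigma> y = - \<sigma> x + of_int n * l"
      then obtain n :: int where "- \<sigma> y = - \<sigma> x + of_int n * l" by blast
      then have "\<sigma> y = \<sigma> x + of_int (- n) * l" by simp
      then have "\<exists>n::int. \<sigma> y = \<sigma> x + of_int n * l" by blast
      then show "(\<forall>z\<in>{x..y}. - \<sigma> z = - \<sigma> x) \<or> (\<forall>z\<in>{y..x + T}. - \<sigma> z = - \<sigma> y)"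
        using fibre[OF xy(1,2)] by simp
    qed
    then show ?thesis by (auto simp: monotone_def mono_def)
  qed
qed

context disc_homeo
begin

text \<open>If a boundary point had the image of an interior point \<open>z'\<close>, points close to the boundary would be
mapped into the image of a small disc about \<open>z'\<close>, against injectivity.\<close>

lemma sphere_avoids_image:
  assumes "cmod z = 1" shows "w z \<notin> w ` ball 0 1"
proof
  assume "w z \<in> w ` ball 0 1"
  then obtain z' where z': "z' \<in> ball 0 1" "w z = w z'" by auto
  define r where "r = (1 - cmod z') / 2"
  have r: "0 < r" using z' by (simp add: r_def)
  have sub: "ball z' r \<subseteq> ball 0 1"
  proof
    fix y assume "y \<in> ball z' r"
    then show "y \<in> ball 0 1" using z' norm_triangle_sub[of y z'] by (simp add: r_def dist_norm norm_minus_commute)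
  qed
  have o: "open (w ` ball z' r)" using sub by (intro open_image) auto
  have seq: "((\<lambda>t. w (of_real t * z)) \<longlongrightarrow> w z) (at_left 1)"
  proof -
    have "continuous_on {0..1::real} (\<lambda>t. w (of_real t * z))"
      by (intro continuous_on_compose2[OF cont] continuous_intros) (auto simp: norm_mult assms)
    then have "((\<lambda>t. w (of_real t * z)) \<longlongrightarrow> w (of_real 1 * z)) (at 1 within {0..1})"
      unfolding continuous_on_def by (rule bspec) simp
    then show ?thesis by (simp add: at_within_Icc_at_left)
  qed
  have "eventually (\<lambda>t. w (of_real t * z) \<in> w ` ball z' r) (at_left 1)"
    using topological_tendstoD[OF seq o] z' r by auto
  moreover have "eventually (\<lambda>t. max 0 (1 - r) < t \<and> t < (1::real)) (at_left 1)"
    using r by (auto simp: eventually_at_left_field intro: exI[of _ "max 0 (1 - r)"])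
  ultimately have "eventually (\<lambda>t::real. False) (at_left 1)"
  proof eventually_elim
    case (elim t)
    then obtain y where y: "y \<in> ball z' r" "w (of_real t * z) = w y" by auto
    have n: "cmod (of_real t * z) = t" using elim assms by (simp add: norm_mult)
    have "of_real t * z = y" using inj y sub elim n by (auto simp: inj_on_def)
    then have "t < cmod z' + r" using y n norm_triangle_sub[of y z'] by (simp add: dist_norm norm_minus_commute)
    moreover have "r + r + cmod z' = 1" by (simp add: r_def field_simps)
    ultimately show False using elim by simp
  qed
  then show False by simp
qed

lemma frontier_image: "frontier (w ` ball 0 1) = range bdry"
proof -
  have "closure (w ` ball 0 1) = w ` cball 0 1"
  proof
    have "closed (w ` cball 0 1)" by (intro compact_imp_closed compact_continuous_image cont) auto
    then show "closure (w ` ball 0 1) \<subseteq> w ` cball 0 1" by (intro closure_minimal) auto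
    show "w ` cball 0 1 \<subseteq> closure (w ` ball 0 1)"
      using image_closure_subset[of "ball 0 1" w "closure (w ` ball 0 1)"] cont
      by (simp add: closure_subset)
  qed
  moreover have "interior (w ` ball 0 1) = w ` ball 0 1"
    by (rule interior_open[OF open_image]) auto
  moreover have "range bdry = w ` sphere 0 1"
  proof -
    have "range cis = sphere 0 1"
    proof (intro equalityI subsetI)
      fix z :: complex assume "z \<in> sphere 0 1"
      then have "cis (Arg z) = z" by (subst cis_Arg) (auto simp: sgn_eq)
      then show "z \<in> range cis" by (metis rangeI)
    qed auto
    then show ?thesis unfolding bdry_def by (metis image_image)
  qed
  moreover have "w ` cball 0 1 - w ` ball 0 1 = w ` sphere 0 1"
  proof (intro equalityI subsetI)
    fix y assume "y \<in> w ` sphere 0 1"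
    then obtain z where z: "cmod z = 1" "y = w z" by auto
    then have "y \<in> w ` cball 0 1" by auto
    then show "y \<in> w ` cball 0 1 - w ` ball 0 1" using sphere_avoids_image[OF z(1)] z(2) by simp
  next
    fix y assume y: "y \<in> w ` cball 0 1 - w ` ball 0 1"
    then obtain z where "cmod z \<le> 1" "y = w z" by auto
    moreover from this have "\<not> cmod z < 1" using y by auto
    ultimately show "y \<in> w ` sphere 0 1" by auto
  qed
  ultimately show ?thesis by (simp add: frontier_def)
qed

lemma half_disc_limit:
  assumes S: "S \<subseteq> ball 0 1" "w ` S \<subseteq> C" "closed C" and lim: "cis x \<in> closure S"
  shows "bdry x \<in> C"
proof -
  have "S \<subseteq> cball 0 1" using S(1) by auto
  then have "closure S \<subseteq> cball 0 1" by (intro closure_minimal) auto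
  then have "w ` closure S \<subseteq> C"
    using S by (intro image_closure_subset) (auto intro: continuous_on_subset[OF cont])
  then show ?thesis using lim by (auto simp: bdry_def)
qed

lemma radial_closure:
  fixes n :: complex
  assumes "c < cis x \<bullet> n"
  shows "cis x \<in> closure {z \<in> ball 0 1. c < z \<bullet> n}"
proof -
  have "((\<lambda>t::real. of_real t * cis x) \<longlongrightarrow> of_real 1 * cis x) (at_left 1)"
    by (intro tendsto_intros)
  then have lim: "((\<lambda>t::real. of_real t * cis x) \<longlongrightarrow> cis x) (at_left 1)" by simp
  have "((\<lambda>t::real. (of_real t * cis x) \<bullet> n) \<longlongrightarrow> cis x \<bullet> n) (at_left 1)"
    by (intro tendsto_inner lim tendsto_const)
  then have "eventually (\<lambda>t::real. c < (of_real t * cis x) \<bullet> n) (at_left 1)"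
    using assms by (rule order_tendstoD)
  moreover have "eventually (\<lambda>t::real. 0 < t \<and> t < 1) (at_left 1)"
    by (auto simp: eventually_at_left_field intro: exI[of _ 0])
  ultimately have "eventually (\<lambda>t::real. of_real t * cis x \<in> {z \<in> ball 0 1. c < z \<bullet> n}) (at_left 1)"
    by eventually_elim (auto simp: norm_mult)
  then have "eventually (\<lambda>t::real. of_real t * cis x \<in> closure {z \<in> ball 0 1. c < z \<bullet> n}) (at_left 1)"
    by (rule eventually_mono) (erule subsetD[OF closure_subset])
  then show ?thesis
    by (rule Lim_in_closed_set[OF closed_closure _ _ lim]) simp
qed

text \<open>If two boundary points have the same image \<open>P\<close>, the image of the chord between them is a
  Jordan curve that meets the boundary curve in \<open>P\<close> only.\<close>

lemma boundary_fibre: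
  assumes \<gamma>: "connected (range bdry - {bdry x1})" and x: "x1 < x2" "x2 < x1 + 2 * pi" and eq: "bdry x1 = bdry x2"
  shows "(\<forall>x\<in>{x1..x2}. bdry x = bdry x1) \<or> (\<forall>x\<in>{x2..x1 + 2 * pi}. bdry x = bdry x2)"
proof -
  define m where "m = (x1 + x2) / 2"
  define h where "h = (x2 - x1) / 2"
  have h: "0 < h" "h < pi" "x1 = m - h" "x2 = m + h" using x by (auto simp: m_def h_def field_simps)
  define P where "P = bdry x1"
  define n where "n = cis m"
  have inn: "cis x \<bullet> n = cos (x - m)" for x
    by (simp add: n_def inner_complex_def cos_diff)
  have a1: "cis x1 \<bullet> n = cos h" "cis x2 \<bullet> n = cos h" using h by (simp_all add: inn)
  have cne: "cis x1 \<noteq> cis x2"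
  proof
    assume "cis x1 = cis x2"
    then have "sin (x2 - m) = sin (x1 - m)"
      by (simp add: sin_diff complex_eq_iff)
    then have "sin h = 0" using h by simp
    then show False using sin_gt_zero[of h] h by simp
  qed
  \<comment> \<open>The open half discs on the two sides of the chord.\<close>
  define U V where "U = {z \<in> ball 0 1. cos h < z \<bullet> n}" and "V = {z \<in> ball 0 1. - cos h < z \<bullet> (- n)}"
  define seg where "seg = open_segment (cis x1) (cis x2)"
  have seg_ball: "seg \<subseteq> ball 0 1"
    unfolding seg_def using dist_decreases_open_segment[of _ "cis x1" "cis x2" 0] by auto
  have seg_n: "z \<bullet> n = cos h" if z: "z \<in> seg" for z
  proof -
    obtain u where "z = (1 - u) *\<^sub>R cis x1 + u *\<^sub>R cis x2"
      using z unfolding seg_def in_segment by blast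
    then show ?thesis by (simp only: inner_left_distrib inner_scaleR_left a1) (simp add: algebra_simps)
  qed
  have cover: "ball 0 1 - seg \<subseteq> U \<union> V"
  proof
    fix z assume z: "z \<in> ball 0 1 - seg"
    show "z \<in> U \<union> V"
    proof (rule ccontr)
      assume "z \<notin> U \<union> V"
      then have zn: "z \<bullet> n = cos h" using z by (auto simp: U_def V_def)
      define \<xi> where "\<xi> = z * cnj n"
      have re: "Re \<xi> = cos h" using zn by (simp add: \<xi>_def inner_complex_def)
      have "cmod \<xi> < 1" using z by (simp add: \<xi>_def norm_mult n_def)
      then have "(Re \<xi>)\<^sup>2 + (Im \<xi>)\<^sup>2 < 1"
        using power_strict_mono[of "cmod \<xi>" 1 2] by (simp add: cmod_power2)
      then have "(Im \<xi>)\<^sup>2 < (sin h)\<^sup>2" using re sin_cos_squared_add[of h] by (simp only:)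
      moreover have sh: "0 < sin h" using h sin_gt_zero by auto
      ultimately have im: "\<bar>Im \<xi>\<bar> < sin h"
        by (metis abs_of_pos power2_abs power_less_imp_less_base less_imp_le)
      define u where "u = (Im \<xi> + sin h) / (2 * sin h)"
      have u: "0 < u" "u < 1" using im sh by (auto simp: u_def field_simps)
      have "\<xi> = (1 - u) *\<^sub>R cis (- h) + u *\<^sub>R cis h"
        using sh by (simp add: complex_eq_iff re u_def field_simps)
      then have "n * \<xi> = (1 - u) *\<^sub>R (n * cis (- h)) + u *\<^sub>R (n * cis h)"
        by (simp only: distrib_left mult_scaleR_right)
      moreover have "n * \<xi> = z" by (simp add: \<xi>_def n_def cis_cnj cis_mult)
      moreover have "n * cis (- h) = cis x1" "n * cis h = cis x2"
        by (simp_all add: n_def cis_mult h)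
      ultimately have "z \<in> seg" using u cne by (auto simp: seg_def in_segment)
      then show False using z by auto
    qed
  qed
  have conn: "connected U" "connected V"
  proof -
    have "U = ball 0 1 \<inter> {z. n \<bullet> z > cos h}" "V = ball 0 1 \<inter> {z. (- n) \<bullet> z > - cos h}"
      by (auto simp: U_def V_def inner_commute)
    then show "connected U" "connected V"
      by (auto intro!: convex_connected convex_Int convex_halfspace_gt simp del: inner_minus_left)
  qed
  have sub: "U \<subseteq> ball 0 1" "V \<subseteq> ball 0 1" "U \<inter> seg = {}" "V \<inter> seg = {}"
    using seg_n by (auto simp: U_def V_def)
  define c where "c = w \<circ> linepath (cis x1) (cis x2)"
  have wa: "w (cis x1) = P" "w (cis x2) = P" using eq by (auto simp: P_def bdry_def)
  have pic: "path_image c = insert P (w ` seg)"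
    by (auto simp: c_def path_image_compose seg_def closed_segment_eq_open wa image_insert)
  have Pball: "P \<notin> w ` ball 0 1"
    using sphere_avoids_image[of "cis x1"] wa by auto
  have pc: "path c"
    unfolding c_def
  proof (rule path_continuous_image)
    have "closed_segment (cis x1) (cis x2) \<subseteq> cball 0 1"
      by (rule closed_segment_subset) auto
    then show "continuous_on (path_image (linepath (cis x1) (cis x2))) w"
      using continuous_on_subset[OF cont] by simp
  qed simp
  have closed: "pathfinish c = pathstart c"
    by (simp add: c_def pathfinish_compose pathstart_compose wa)
  have simple: "simple_path c"
  proof -
    have lp: "linepath (cis x1) (cis x2) t \<in> seg" if "0 < t" "t < 1" for t
      using that cne by (auto simp: seg_def in_segment linepath_def)
    have end01: "c 0 = P" "c 1 = P" by (simp_all add: c_def linepath_def wa)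
    have int: "c t \<in> w ` ball 0 1" if "0 < t" "t < 1" for t
      using lp[OF that] seg_ball by (auto simp: c_def)
    have "s = t" if "c s = c t" "0 < s" "s < 1" "0 < t" "t < 1" for s t
    proof -
      have "linepath (cis x1) (cis x2) s = linepath (cis x1) (cis x2) t"
        using that(1) subsetD[OF seg_ball lp[OF that(2,3)]] subsetD[OF seg_ball lp[OF that(4,5)]] inj
        unfolding c_def o_def inj_on_def by blast
      then have "(s - t) *\<^sub>R (cis x2 - cis x1) = 0" by (simp add: linepath_def algebra_simps)
      then show ?thesis using cne by simp
    qed
    moreover have "\<not> (0 < t \<and> t < 1)" if "c t = P" for t using int[of t] that Pball by auto
    ultimately have "loop_free c"
      unfolding loop_free_def using end01 by (metis atLeastAtMost_iff order_le_less)
    then show ?thesis using pc by (simp add: simple_path_def)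
  qed
  have Pnot: "range bdry \<inter> w ` ball 0 1 = {}"
    using sphere_avoids_image by (force simp: bdry_def)
  define J where "J = path_image c"
  have jordan: "inside J \<noteq> {}" "open (inside J)" "connected (inside J)" "outside J \<noteq> {}" "open (outside J)"
      "connected (outside J)" "inside J \<inter> outside J = {}" "inside J \<union> outside J = - J"
      "frontier (inside J) = J" "frontier (outside J) = J"
    using Jordan_inside_outside[OF simple closed] by (auto simp: J_def)
  have J: "J = insert P (w ` seg)" by (simp add: J_def pic)
  have avoid: "w ` X \<inter> J = {}" if "X \<subseteq> ball 0 1" "X \<inter> seg = {}" for X
  proof -
    have "w ` X \<inter> w ` seg = w ` (X \<inter> seg)"
      using inj_on_image_Int[OF inj that(1) seg_ball] by simp
    then show ?thesis using that Pball J by auto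
  qed
  have side: "w ` S \<subseteq> inside J \<or> w ` S \<subseteq> outside J" if S: "connected S" "S \<subseteq> ball 0 1" "w ` S \<inter> J = {}" for S
  proof -
    have "connected (w ` S)" using S(1,2) by (intro connected_continuous_image continuous_on_subset[OF cont]) auto
    then show ?thesis
    proof -
      have "inside J \<inter> outside J \<inter> w ` S = {}" using jordan(7) by simp
      moreover have "w ` S \<subseteq> inside J \<union> outside J" unfolding jordan(8) using S(3) by blast
      ultimately have "inside J \<inter> w ` S = {} \<or> outside J \<inter> w ` S = {}"
        using connectedD[OF \<open>connected (w ` S)\<close> jordan(2) jordan(5)] by blast
      then show ?thesis using \<open>w ` S \<subseteq> inside J \<union> outside J\<close> by blast
    qed
  qed
  \<comment> \<open>Both sides of the Jordan curve are met by the image of the disc near the image of the chord.\<close>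
  have meets: "\<exists>S\<in>{U, V}. w ` S \<inter> X \<noteq> {}" if X: "frontier X = J" "X \<inter> J = {}" for X
  proof -
    obtain \<zeta> where \<zeta>: "\<zeta> \<in> seg" unfolding seg_def using cne by (metis open_segment_eq_empty ex_in_conv)
    have "w \<zeta> \<in> closure X" using X \<zeta> J frontier_closures[of X] by blast
    moreover have "open (w ` ball 0 1)" "w \<zeta> \<in> w ` ball 0 1"
      using \<zeta> seg_ball open_image[of "ball 0 1"] by auto
    ultimately obtain y where "y \<in> X" "y \<in> w ` ball 0 1"
      using closure_iff_nhds_not_empty[of "w \<zeta>" X] by blast
    then obtain z where z: "z \<in> ball 0 1" "w z \<in> X" by auto
    then have "z \<notin> seg" using X J by auto
    then have "z \<in> U \<or> z \<in> V" using z cover by blast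
    then show ?thesis using z by blast
  qed
  have UV: "(w ` U \<subseteq> inside J \<and> w ` V \<subseteq> outside J) \<or> (w ` U \<subseteq> outside J \<and> w ` V \<subseteq> inside J)"
    using side[OF conn(1) sub(1) avoid[OF sub(1,3)]] side[OF conn(2) sub(2) avoid[OF sub(2,4)]]
      meets[of "inside J"] meets[of "outside J"] jordan by blast
  have arcU: "bdry x \<in> closure (w ` U)" if "x1 < x" "x < x2" for x
  proof (rule half_disc_limit[OF sub(1)])
    have "cos h < cos (x - m)" using that h cos_monotone_0_pi[of "\<bar>x - m\<bar>" h] by auto
    then show "cis x \<in> closure U" unfolding U_def by (intro radial_closure) (simp add: inn)
  qed (auto simp: closure_subset)
  have arcV: "bdry x \<in> closure (w ` V)" if "x2 < x" "x < x1 + 2 * pi" for x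
  proof (rule half_disc_limit[OF sub(2)])
    have "cos (x - m) < cos h"
    proof (cases "x - m \<le> pi")
      case True then show ?thesis using that h cos_monotone_0_pi[of h "x - m"] by auto
    next
      case False
      then have "cos (2 * pi - (x - m)) < cos h" using that h cos_monotone_0_pi[of h "2 * pi - (x - m)"] by auto
      then show ?thesis by (simp add: cos_diff)
    qed
    then show "cis x \<in> closure V" unfolding V_def by (intro radial_closure) (simp add: inn)
  qed (auto simp: closure_subset)
  have clo: "closure (inside J) \<subseteq> inside J \<union> J" "closure (outside J) \<subseteq> outside J \<union> J"
    using jordan closure_Un_frontier by blast+
  have rest: "range bdry - {P} \<subseteq> inside J \<or> range bdry - {P} \<subseteq> outside J"
  proof -
    have "(range bdry - {P}) \<inter> J = {}" using J Pnot seg_ball by blast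
    then show ?thesis
      using connectedD[OF \<gamma>[folded P_def], of "inside J" "outside J"] jordan by blast
  qed
  \<comment> \<open>The side of \<open>J\<close> that does not contain the rest of the boundary curve is the image of a half
    disc whose boundary arc is mapped to \<open>P\<close>.\<close>
  have const: "bdry x = P" if "bdry x \<in> closure X" "closure X \<subseteq> X \<union> J" "X \<inter> (range bdry - {P}) = {}" for x X
  proof -
    have "bdry x \<in> X \<union> J" using that by blast
    moreover have "bdry x \<notin> w ` seg" using Pnot seg_ball by blast
    ultimately show ?thesis using that J by blast
  qed
  have "(\<forall>x. x1 < x \<and> x < x2 \<longrightarrow> bdry x = P) \<or> (\<forall>x. x2 < x \<and> x < x1 + 2 * pi \<longrightarrow> bdry x = P)"
  proof -
    have U_const: ?thesis if "w ` U \<subseteq> X" "closure X \<subseteq> X \<union> J" "X \<inter> (range bdry - {P}) = {}" for X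
      using const[OF _ that(2,3)] arcU closure_mono[OF that(1)] by blast
    have V_const: ?thesis if "w ` V \<subseteq> X" "closure X \<subseteq> X \<union> J" "X \<inter> (range bdry - {P}) = {}" for X
      using const[OF _ that(2,3)] arcV closure_mono[OF that(1)] by blast
    consider "w ` U \<subseteq> inside J" "inside J \<inter> (range bdry - {P}) = {}"
      | "w ` U \<subseteq> outside J" "outside J \<inter> (range bdry - {P}) = {}"
      | "w ` V \<subseteq> inside J" "inside J \<inter> (range bdry - {P}) = {}"
      | "w ` V \<subseteq> outside J" "outside J \<inter> (range bdry - {P}) = {}"
      using UV rest jordan(7) by blast
    then show ?thesis
      by cases (rule U_const V_const, assumption, rule clo, assumption)+
  qed
  moreover have "bdry (x1 + 2 * pi) = P" "bdry x2 = P" "bdry x1 = P"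
    using eq bdry_periodic[of x1] by (auto simp: P_def)
  ultimately show ?thesis
    unfolding P_def by (metis atLeastAtMost_iff order_le_less)
qed

end

text \<open>A mapping of the disc that extends to the boundary, together with an arc length parameter of the
boundary curve of its image.\<close>

locale parametrized_boundary = disc_homeo w + arc_param g l
  for w :: "complex \<Rightarrow> complex" and g l +
  fixes B :: real
  assumes boundary_curve: "range bdry = range g"
    and curve_length: "curve_length (range g) = ereal l"
    and trisects: "trisects (range g) (w 1) (w (cis (2 * pi / 3))) (w (cis (- (2 * pi / 3))))"
    and chord_arc: "chord_arc B (range g)"
begin

lemma connected_minus_point: "connected (range g - {g s})"
proof -
  have "range g - {g s} = g ` {s<..<s + l}"
  proof (intro equalityI subsetI)
    fix z assume "z \<in> range g - {g s}"
    then obtain t where t: "z = g t" "g t \<noteq> g s" by auto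
    define r where "r = (t - s) - of_int \<lfloor>(t - s) / l\<rfloor> * l"
    have r: "0 \<le> r" "r < l" using residue[of "t - s"] by (auto simp: r_def)
    have gr: "g (s + r) = g t" using periodic_int[of t "- \<lfloor>(t - s) / l\<rfloor>"] by (simp add: r_def)
    then have "r \<noteq> 0" using t by auto
    then show "z \<in> g ` {s<..<s + l}" using r gr t by (intro image_eqI[of _ _ "s + r"]) auto
  next
    fix z assume "z \<in> g ` {s<..<s + l}"
    then obtain t where t: "s < t" "t < s + l" "z = g t" by auto
    have "g t \<noteq> g s"
    proof
      assume "g t = g s"
      then obtain n :: int where n: "t = s + of_int n * l" using g_eq_iff by blast
      then have "0 * l < of_int n * l" "of_int n * l < 1 * l" using t by auto
      then have "0 < (of_int n :: real)" "(of_int n :: real) < 1"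
        using l_pos by (simp_all only: mult_less_cancel_right_pos)
      then show False by simp
    qed
    then show "z \<in> range g - {g s}" using t by auto
  qed
  then show ?thesis by (simp add: connected_continuous_image[OF cont_g])
qed

text \<open>The images of the points \<open>cis (2 * pi * k / 3)\<close> run cyclically through the three points of the
trisection.\<close>

lemma thirds:
  fixes k :: int
  assumes "bdry (2 * pi * of_int k / 3) = g s" "bdry (2 * pi * of_int (k + 1) / 3) = g t"
  shows "l / 3 \<le> \<bar>s - t\<bar>"
proof -
  define j where "j = k div 3"
  have per: "bdry (x + 2 * pi * of_int j) = bdry x" for x and j :: int
    by (simp add: bdry_def cis_mult[symmetric] cis_multiple_2pi)
  have m: "cis (4 * pi / 3) = cis (- (2 * pi / 3))"
  proof -
    have "cis (4 * pi / 3) = cis (- (2 * pi / 3) + 2 * pi)" by (rule arg_cong[of _ _ cis]) simp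
    then show ?thesis by (simp only: cis_mult[symmetric]) simp
  qed
  note apart = trisects_apart[OF trisects curve_length]
  consider "k = 3 * j" | "k = 3 * j + 1" | "k = 3 * j + 2"
    using mult_div_mod_eq[of 3 k] pos_mod_bound[of 3 k] pos_mod_sign[of 3 k] unfolding j_def by linarith
  then show ?thesis
  proof cases
    case 1
    have "bdry (2 * pi * of_int k / 3) = w 1" "bdry (2 * pi * of_int (k + 1) / 3) = w (cis (2 * pi / 3))"
      using per[of 0 j] per[of "2 * pi / 3" j] 1 by (simp_all add: bdry_def field_simps)
    then show ?thesis using apart(1)[of s t] assms by simp
  next
    case 2
    have "bdry (2 * pi * of_int k / 3) = w (cis (2 * pi / 3))" "bdry (2 * pi * of_int (k + 1) / 3) = w (cis (- (2 * pi / 3)))"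
      using per[of "2 * pi / 3" j] per[of "4 * pi / 3" j] 2 m by (simp_all add: bdry_def field_simps)
    then show ?thesis using apart(2)[of s t] assms by simp
  next
    case 3
    have "bdry (2 * pi * of_int k / 3) = w (cis (- (2 * pi / 3)))"
      using per[of "4 * pi / 3" j] 3 m by (simp add: bdry_def field_simps)
    moreover have "2 * pi * of_int (k + 1) / 3 = 0 + 2 * pi * of_int (j + 1)"
      using 3 by (simp add: field_simps)
    then have "bdry (2 * pi * of_int (k + 1) / 3) = w 1"
      using per[of 0 "j + 1"] by (simp only: bdry_def cis_zero)
    ultimately show ?thesis using apart(3)[of s t] assms by simp
  qed
qed

text \<open>An arc over less than a third of the circle omits two of the three normalization points, hence leaves
at least a third of the curve uncovered. The smaller one of the two arcs between its end points is
therefore at least half as long as its image. The function \<open>s\<close> is \<open>\<sigma>\<close> or its negative, so that it is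
increasing for either orientation.\<close>

lemma boundary_parameter:
  obtains \<sigma> s :: "real \<Rightarrow> real" where "continuous_on UNIV \<sigma>" "\<And>x. bdry x = g (\<sigma> x)" "mono s"
    "\<And>x y. \<bar>s x - s y\<bar> = \<bar>\<sigma> x - \<sigma> y\<bar>"
    "\<And>\<phi> \<eta>. 0 \<le> \<eta> \<Longrightarrow> \<eta> < pi / 3 \<Longrightarrow>
        s (\<phi> + \<eta>) - s (\<phi> - \<eta>) \<le> 2 * B * cmod (bdry (\<phi> + \<eta>) - bdry (\<phi> - \<eta>))"
proof -
  obtain \<sigma> where \<sigma>: "continuous_on UNIV \<sigma>" and lift: "\<And>x. bdry x = g (\<sigma> x)"
  proof (rule lift[of UNIV bdry])
    show "bdry ` UNIV \<subseteq> range g" using boundary_curve by simp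
  qed (auto simp: cont_bdry convex_imp_contractible intro: that)
  have c: "continuous_on {a..b} \<sigma>" for a b using \<sigma> by (rule continuous_on_subset) auto
  \<comment> \<open>The increment over one turn takes values in the multiples of \<open>l\<close>, so it is constant.\<close>
  define f where "f x = \<sigma> (x + 2 * pi) - \<sigma> x" for x
  have f_int: "\<exists>n::int. f x = of_int n * l" for x
  proof -
    have "g (\<sigma> (x + 2 * pi)) = g (\<sigma> x)" using bdry_periodic[of x] lift by simp
    then obtain n :: int where "\<sigma> (x + 2 * pi) = \<sigma> x + of_int n * l" using g_eq_iff by blast
    then show ?thesis by (auto simp: f_def)
  qed
  have gf: "g (f x) = g 0" for x
    using f_int[of x] periodic_int[of 0] by auto
  have cf: "continuous_on {a..b} f" for a b
    unfolding f_def by (intro continuous_intros continuous_on_compose2[OF \<sigma>]) auto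
  have f_const: "f x = f 0" for x
  proof (cases "0 \<le> x")
    case True then show ?thesis using lift_constant[OF cf, of 0 x x] gf by auto
  next
    case False then show ?thesis using lift_constant[OF cf, of x 0 0] gf by auto
  qed
  obtain d :: int where d: "f 0 = of_int d * l" using f_int by blast
  have shift: "\<sigma> (x + 2 * pi) = \<sigma> x + of_int d * l" for x
    using f_const[of x] d by (simp add: f_def)
  have fibre: "(\<forall>z\<in>{x..y}. \<sigma> z = \<sigma> x) \<or> (\<forall>z\<in>{y..x + 2 * pi}. \<sigma> z = \<sigma> y)"
    if xy: "x < y" "y < x + 2 * pi" and n: "\<exists>n::int. \<sigma> y = \<sigma> x + of_int n * l" for x y
  proof -
    have "connected (range bdry - {bdry x})"
      unfolding boundary_curve lift by (rule connected_minus_point)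
    moreover have "bdry x = bdry y" using n lift periodic_int by auto
    ultimately have "(\<forall>z\<in>{x..y}. bdry z = bdry x) \<or> (\<forall>z\<in>{y..x + 2 * pi}. bdry z = bdry y)"
      using boundary_fibre xy by blast
    then show ?thesis
    proof
      assume "\<forall>z\<in>{x..y}. bdry z = bdry x"
      then show ?thesis using lift_constant[OF c, of x y] lift by metis
    next
      assume "\<forall>z\<in>{y..x + 2 * pi}. bdry z = bdry y"
      then show ?thesis using lift_constant[OF c, of y "x + 2 * pi"] lift by metis
    qed
  qed
  have "\<sigma> 0 \<noteq> \<sigma> (2 * pi / 3)"
    using thirds[of 0 "\<sigma> 0" "\<sigma> (2 * pi / 3)"] lift l_pos by auto
  then have "(d = 1 \<and> mono \<sigma>) \<or> (d = -1 \<and> antimono \<sigma>)"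
    by (intro monotone_lift[OF \<sigma> _ l_pos shift fibre]) auto
  then have "\<exists>s. mono s \<and> (\<forall>x. s (x + 2 * pi) = s x + l) \<and> (s = \<sigma> \<or> s = (\<lambda>x. - \<sigma> x))"
  proof
    assume "d = 1 \<and> mono \<sigma>"
    then show ?thesis using shift by (intro exI[of _ \<sigma>]) auto
  next
    assume "d = - 1 \<and> antimono \<sigma>"
    then show ?thesis using shift by (intro exI[of _ "\<lambda>x. - \<sigma> x"]) (auto simp: monotone_def mono_def)
  qed
  then obtain s where s: "mono s" "\<And>x. s (x + 2 * pi) = s x + l" and s\<sigma>: "s = \<sigma> \<or> s = (\<lambda>x. - \<sigma> x)" by blast
  have abs: "\<bar>s x - s y\<bar> = \<bar>\<sigma> x - \<sigma> y\<bar>" for x y using s\<sigma> by auto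
  have "s (\<phi> + \<eta>) - s (\<phi> - \<eta>) \<le> 2 * B * cmod (bdry (\<phi> + \<eta>) - bdry (\<phi> - \<eta>))"
    if \<eta>: "0 \<le> \<eta>" "\<eta> < pi / 3" for \<phi> \<eta>
  proof -
    define a b where "a = \<phi> - \<eta>" and "b = \<phi> + \<eta>"
    define \<delta> where "\<delta> = s b - s a"
    have \<delta>0: "0 \<le> \<delta>" using monoD[OF s(1), of a b] \<eta> by (simp add: \<delta>_def a_def b_def)
    \<comment> \<open>The complementary arc contains two consecutive points of the trisection.\<close>
    define k where "k = \<lceil>3 * b / (2 * pi)\<rceil>"
    define t1 t2 where "t1 = 2 * pi * of_int k / 3" and "t2 = 2 * pi * of_int (k + 1) / 3"
    have k: "3 * b / (2 * pi) \<le> of_int k" "of_int k < 3 * b / (2 * pi) + 1" unfolding k_def by linarith+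
    have t: "b \<le> t1" "t1 < b + 2 * pi / 3" "t2 = t1 + 2 * pi / 3"
      using k by (auto simp: t1_def t2_def field_simps)
    have "l / 3 \<le> \<bar>\<sigma> t1 - \<sigma> t2\<bar>"
      unfolding t1_def t2_def by (intro thirds[of k] lift)
    then have "l / 3 \<le> s t2 - s t1" using abs[of t1 t2] monoD[OF s(1), of t1 t2] t by simp
    also have "\<dots> \<le> s (a + 2 * pi) - s b"
    proof -
      have "t2 \<le> a + 2 * pi" using t \<eta> by (simp add: a_def b_def)
      then show ?thesis using monoD[OF s(1), of b t1] monoD[OF s(1), of t2 "a + 2 * pi"] t by linarith
    qed
    finally have far: "l / 3 \<le> l - \<delta>" using s(2)[of a] by (simp add: \<delta>_def)
    have "\<exists>n::int. \<bar>\<delta> + of_int n * l\<bar> \<le> B * cmod (bdry b - bdry a)"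
    proof -
      obtain n :: int where n: "\<bar>\<sigma> b - \<sigma> a + of_int n * l\<bar> \<le> B * cmod (bdry b - bdry a)"
        using chord_arc_lift[OF chord_arc, of "\<sigma> b" "\<sigma> a"] lift by auto
      from s\<sigma> show ?thesis
      proof
        assume "s = \<sigma>" then show ?thesis using n by (auto simp: \<delta>_def)
      next
        assume "s = (\<lambda>x. - \<sigma> x)"
        then have "\<bar>\<delta> + of_int (- n) * l\<bar> = \<bar>\<sigma> b - \<sigma> a + of_int n * l\<bar>"
          using abs_minus_cancel[of "\<sigma> b - \<sigma> a + of_int n * l"] by (simp add: \<delta>_def algebra_simps)
        then show ?thesis using n by metis
      qed
    qed
    then obtain n :: int where n: "\<bar>\<delta> + of_int n * l\<bar> \<le> B * cmod (bdry b - bdry a)" by blast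
    have "\<delta> / 2 \<le> \<bar>\<delta> + of_int n * l\<bar>"
    proof (cases "0 \<le> n")
      case True
      then have "0 \<le> of_int n * l" using l_pos by simp
      then show ?thesis using \<delta>0 by simp
    next
      case False
      then have "of_int n * l \<le> of_int (- 1) * l" using l_pos by (intro mult_right_mono) (auto simp only: of_int_le_iff)
      then have "of_int n * l \<le> - l" by simp
      then show ?thesis using far \<delta>0 by linarith
    qed
    then show ?thesis using n by (simp add: \<delta>_def a_def b_def)
  qed
  then show thesis using that \<sigma> lift s(1) abs by blast
qed

end

section \<open>Length and area: the boundary map is Hoelder continuous\<close>

lemma cos_le_cos_iff_abs:
  assumes "\<bar>x\<bar> \<le> pi" "0 \<le> y" "y \<le> pi"
  shows "cos y \<le> cos x \<longleftrightarrow> \<bar>x\<bar> \<le> y" "cos y < cos x \<longleftrightarrow> \<bar>x\<bar> < y"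
  using cos_mono_le_eq[of y "\<bar>x\<bar>"] cos_mono_less_eq[of y "\<bar>x\<bar>"] assms by auto

lemma norm_one_minus: "(cmod (1 - of_real r * cis t))\<^sup>2 = 1 - 2 * r * cos t + r\<^sup>2"
  unfolding cmod_power2 by (simp add: power2_eq_square algebra_simps) 
    (metis (no_types) distrib_left mult.right_neutral sin_cos_squared_add3)

text \<open>Here \<open>p\<close> and the complex conjugate of \<open>q\<close> are the two complex partial derivatives of \<open>w\<close>. Both
\<open>p\<close> and \<open>q\<close> are holomorphic because \<open>w\<close> is harmonic.\<close>

locale disc_map = disc_homeo +
  fixes p q :: "complex \<Rightarrow> complex" and K :: real
  assumes deriv: "\<And>z. z \<in> ball 0 1 \<Longrightarrow> (w has_derivative (\<lambda>h. p z * h + cnj (q z * h))) (at z)"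
    and hol_p: "p holomorphic_on ball 0 1" and hol_q: "q holomorphic_on ball 0 1"
    and K_ge_1: "1 \<le> K"
    and dilatation: "\<And>z. z \<in> ball 0 1 \<Longrightarrow> cmod (p z) + cmod (q z) \<le> K * \<bar>cmod (p z) - cmod (q z)\<bar>"
begin

text \<open>Logarithmic polar coordinates centred at the boundary point \<open>cis \<phi>\<close>. Vertical segments parametrize the
circular crosscuts about this point, and the cap of radius \<open>exp v\<close> becomes the part of the domain to
the left of \<open>v\<close>.\<close>

definition chart :: "real \<Rightarrow> complex \<Rightarrow> complex" where
  "chart \<phi> \<zeta> = cis \<phi> * (1 - exp \<zeta>)"

text \<open>The bound for the imaginary part makes \<open>exp\<close> injective; it holds automatically for one of the
logarithms of every point that occurs.\<close>

definition chart_dom :: "real \<Rightarrow> complex set" where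
  "chart_dom \<phi> = {\<zeta>. \<bar>Im \<zeta>\<bar> < pi / 2 \<and> chart \<phi> \<zeta> \<in> ball 0 1}"

text \<open>The modulus of the Jacobian determinant of \<open>w \<circ> chart \<phi>\<close>.\<close>

definition jac :: "real \<Rightarrow> complex \<Rightarrow> real" where
  "jac \<phi> \<zeta> = \<bar>(cmod (p (chart \<phi> \<zeta>) * (- cis \<phi> * exp \<zeta>)))\<^sup>2 - (cmod (q (chart \<phi> \<zeta>) * (- cis \<phi> * exp \<zeta>)))\<^sup>2\<bar>"

definition cap :: "real \<Rightarrow> real \<Rightarrow> complex set" where
  "cap \<phi> v = ball 0 1 \<inter> ball (cis \<phi>) (exp v)"

text \<open>The integral of the Jacobian over a crosscut, the derivative of the area of the image of a cap. It may
be infinite for single crosscuts.\<close>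

definition slice :: "real \<Rightarrow> real \<Rightarrow> ennreal" where
  "slice \<phi> u = (\<integral>\<^sup>+y. ennreal (jac \<phi> (Complex u y)) * indicator (chart_dom \<phi>) (Complex u y) \<partial>lborel)"

text \<open>Half the angle under which the crosscut of radius \<open>exp u\<close> is seen from its centre.\<close>

definition aperture :: "real \<Rightarrow> real" where "aperture u = arccos (exp u / 2)"

lemma aperture:
  assumes "u < 0"
  shows "pi / 3 < aperture u" "aperture u < pi / 2" "cos (aperture u) = exp u / 2"
proof -
  have e: "0 < exp u / 2" "exp u / 2 < 1 / 2" using assms by auto
  then have b: "- 1 \<le> exp u / 2" "exp u / 2 \<le> 1" by linarith+
  show c: "cos (aperture u) = exp u / 2" unfolding aperture_def using b by (rule cos_arccos)
  have r: "0 \<le> aperture u" "aperture u \<le> pi"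
    unfolding aperture_def using b by (auto intro: arccos_lbound arccos_ubound)
  show "pi / 3 < aperture u"
    using cos_mono_less_eq[of "aperture u" "pi/3"] r c e by (simp add: cos_60)
  show "aperture u < pi / 2"
    using cos_mono_less_eq[of "pi/2" "aperture u"] r c e by (simp add: cos_60)
qed

lemma norm_chart: "(cmod (chart \<phi> (Complex u t)))\<^sup>2 = 1 - 2 * exp u * cos t + (exp u)\<^sup>2"
proof -
  have "exp (Complex u t) = of_real (exp u) * cis t"
    by (simp add: exp_eq_polar)
  then show ?thesis
    using norm_one_minus[of "exp u" t] by (simp add: chart_def norm_mult)
qed

lemma chart_in:
  assumes "\<bar>t\<bar> \<le> pi" "u < 0"
  shows "chart \<phi> (Complex u t) \<in> ball 0 1 \<longleftrightarrow> \<bar>t\<bar> < aperture u"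
    "chart \<phi> (Complex u t) \<in> cball 0 1 \<longleftrightarrow> \<bar>t\<bar> \<le> aperture u"
proof -
  have ap: "0 \<le> aperture u" "aperture u \<le> pi" using aperture[OF assms(2)] pi_gt_zero by linarith+
  have "chart \<phi> (Complex u t) \<in> ball 0 1 \<longleftrightarrow> (cmod (chart \<phi> (Complex u t)))\<^sup>2 < 1"
    by (simp add: power_less_one_iff abs_square_less_1)
  also have "\<dots> \<longleftrightarrow> exp u * exp u < exp u * (2 * cos t)"
    unfolding norm_chart by (simp add: power2_eq_square)
  also have "\<dots> \<longleftrightarrow> cos (aperture u) < cos t"
    using aperture(3)[OF assms(2)] by simp linarith
  finally show "chart \<phi> (Complex u t) \<in> ball 0 1 \<longleftrightarrow> \<bar>t\<bar> < aperture u"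
    using cos_le_cos_iff_abs[OF assms(1) ap] by simp
  have "chart \<phi> (Complex u t) \<in> cball 0 1 \<longleftrightarrow> (cmod (chart \<phi> (Complex u t)))\<^sup>2 \<le> 1"
    by (simp add: abs_square_le_1)
  also have "\<dots> \<longleftrightarrow> exp u * exp u \<le> exp u * (2 * cos t)"
    unfolding norm_chart by (simp add: power2_eq_square)
  also have "\<dots> \<longleftrightarrow> cos (aperture u) \<le> cos t"
    using aperture(3)[OF assms(2)] by simp linarith
  finally show "chart \<phi> (Complex u t) \<in> cball 0 1 \<longleftrightarrow> \<bar>t\<bar> \<le> aperture u"
    using cos_le_cos_iff_abs[OF assms(1) ap] by simp
qed

lemma chart_dom_iff:
  assumes "u < 0"
  shows "Complex u t \<in> chart_dom \<phi> \<longleftrightarrow> \<bar>t\<bar> < aperture u"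
proof (cases "\<bar>t\<bar> \<le> pi")
  case True
  then show ?thesis using chart_in[OF True assms] aperture[OF assms] by (auto simp: chart_dom_def)
next
  case False
  then show ?thesis using aperture[OF assms] by (auto simp: chart_dom_def)
qed

lemma chart_deriv: "(chart \<phi> has_field_derivative (- cis \<phi> * exp \<zeta>)) (at \<zeta>)"
  unfolding chart_def by (auto intro!: derivative_eq_intros)

lemma open_chart_dom: "open (chart_dom \<phi>)"
proof -
  have "open {\<zeta>. \<bar>Im \<zeta>\<bar> < pi / 2}" "open {\<zeta>. cmod (chart \<phi> \<zeta>) < 1}"
    by (intro open_Collect_less continuous_intros continuous_at_imp_continuous_on ballI DERIV_isCont[OF chart_deriv])+
  moreover have "chart_dom \<phi> = {\<zeta>. \<bar>Im \<zeta>\<bar> < pi / 2} \<inter> {\<zeta>. cmod (chart \<phi> \<zeta>) < 1}"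
    by (auto simp: chart_dom_def)
  ultimately show ?thesis by auto
qed

lemma inj_chart: "inj_on (chart \<phi>) (chart_dom \<phi>)"
proof (rule inj_onI)
  fix x y assume xy: "x \<in> chart_dom \<phi>" "y \<in> chart_dom \<phi>" and "chart \<phi> x = chart \<phi> y"
  then have "exp x = exp y" by (auto simp: chart_def)
  moreover have "\<bar>Im x - Im y\<bar> < 2 * pi" using xy by (auto simp: chart_dom_def)
  ultimately show "x = y" by (rule exp_complex_eqI[rotated])
qed

lemma chart_map_deriv:
  assumes "\<zeta> \<in> chart_dom \<phi>"
  shows "((w \<circ> chart \<phi>) has_derivative (\<lambda>h. (p (chart \<phi> \<zeta>) * (- cis \<phi> * exp \<zeta>)) * h
     + cnj ((q (chart \<phi> \<zeta>) * (- cis \<phi> * exp \<zeta>)) * h))) (at \<zeta>)"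
proof -
  have "(chart \<phi> has_derivative (\<lambda>h. (- cis \<phi> * exp \<zeta>) * h)) (at \<zeta>)"
    using chart_deriv[of \<phi> \<zeta>] unfolding has_field_derivative_def .
  from has_derivative_compose[OF this deriv] assms show ?thesis
    by (simp add: chart_dom_def o_def mult.assoc)
qed

lemma cont_chart: "continuous_on S (chart \<phi>)"
  by (intro continuous_at_imp_continuous_on ballI DERIV_isCont[OF chart_deriv])

lemma cont_pq_chart:
  "continuous_on (chart_dom \<phi>) (\<lambda>\<zeta>. p (chart \<phi> \<zeta>) * (- cis \<phi> * exp \<zeta>))"
  "continuous_on (chart_dom \<phi>) (\<lambda>\<zeta>. q (chart \<phi> \<zeta>) * (- cis \<phi> * exp \<zeta>))"
  by (intro continuous_intros continuous_on_compose2[OF holomorphic_on_imp_continuous_on[OF hol_p] cont_chart]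
      continuous_on_compose2[OF holomorphic_on_imp_continuous_on[OF hol_q] cont_chart];
      force simp: chart_dom_def)+

lemma cont_jac: "continuous_on (chart_dom \<phi>) (jac \<phi>)"
  unfolding jac_def by (intro continuous_intros cont_pq_chart)

lemma jac_nonneg: "0 \<le> jac \<phi> \<zeta>" by (simp add: jac_def)

lemma chart_image:
  assumes "v \<le> 0"
  shows "chart \<phi> ` (chart_dom \<phi> \<inter> {\<zeta>. Re \<zeta> < v}) = cap \<phi> v - {cis \<phi>}"
proof (intro equalityI subsetI)
  fix z assume "z \<in> chart \<phi> ` (chart_dom \<phi> \<inter> {\<zeta>. Re \<zeta> < v})"
  then obtain \<zeta> where z: "\<zeta> \<in> chart_dom \<phi>" "Re \<zeta> < v" "z = chart \<phi> \<zeta>" by auto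
  have "dist (cis \<phi>) z = cmod (cis \<phi> * exp \<zeta>)"
    by (simp add: z dist_norm chart_def algebra_simps)
  also have "\<dots> = exp (Re \<zeta>)" by (simp add: norm_mult)
  finally show "z \<in> cap \<phi> v - {cis \<phi>}" using z by (auto simp: cap_def chart_dom_def)
next
  fix z assume z: "z \<in> cap \<phi> v - {cis \<phi>}"
  define \<zeta> where "\<zeta> = Ln (1 - z / cis \<phi>)"
  have ne: "1 - z / cis \<phi> \<noteq> 0" using z by auto
  then have ez: "exp \<zeta> = 1 - z / cis \<phi>" by (simp add: \<zeta>_def)
  then have c: "chart \<phi> \<zeta> = z" by (simp add: chart_def)
  have "cmod (1 - z / cis \<phi>) = cmod ((1 - z / cis \<phi>) * cis \<phi>)" by (simp add: norm_mult)
  also have "\<dots> = dist (cis \<phi>) z" by (simp add: dist_norm algebra_simps)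
  finally have "exp (Re \<zeta>) < exp v" using z ez by (metis IntD2 DiffD1 cap_def mem_ball norm_exp_eq_Re)
  then have u: "Re \<zeta> < v" by simp
  have im: "\<bar>Im \<zeta>\<bar> \<le> pi" using mpi_less_Im_Ln[OF ne] Im_Ln_le_pi[OF ne] by (auto simp: \<zeta>_def)
  have "chart \<phi> (Complex (Re \<zeta>) (Im \<zeta>)) \<in> ball 0 1" using z c by (auto simp: cap_def)
  then have "\<bar>Im \<zeta>\<bar> < aperture (Re \<zeta>)" using chart_in(1)[OF im, of "Re \<zeta>" \<phi>] u assms by auto
  then have "\<zeta> \<in> chart_dom \<phi>" using chart_dom_iff[of "Re \<zeta>" "Im \<zeta>" \<phi>] u assms by auto
  then show "z \<in> chart \<phi> ` (chart_dom \<phi> \<inter> {\<zeta>. Re \<zeta> < v})" using u c by auto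
qed

lemma cis_notin_cap: "cap \<phi> v - {cis \<phi>} = cap \<phi> v" by (auto simp: cap_def)

lemma jac_measurable [measurable]:
  "(\<lambda>\<zeta>. ennreal (jac \<phi> \<zeta>) * indicator (chart_dom \<phi>) \<zeta>) \<in> borel_measurable borel"
proof -
  have "(\<lambda>\<zeta>. ennreal (indicator (chart_dom \<phi>) \<zeta> *\<^sub>R jac \<phi> \<zeta>)) \<in> borel_measurable borel"
    using borel_measurable_continuous_on_indicator[OF _ cont_jac] open_chart_dom by auto
  also have "(\<lambda>\<zeta>. ennreal (indicator (chart_dom \<phi>) \<zeta> *\<^sub>R jac \<phi> \<zeta>))
      = (\<lambda>\<zeta>. ennreal (jac \<phi> \<zeta>) * indicator (chart_dom \<phi>) \<zeta>)"
    by (auto simp: indicator_def)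
  finally show ?thesis .
qed

lemma finite_image:
  assumes X: "X \<subseteq> ball 0 1"
  shows "emeasure lborel (w ` X) < \<infinity>"
proof -
  have "compact (w ` cball 0 1)" using cont by (intro compact_continuous_image) auto
  then have "bounded (w ` X)"
    using X by (meson bounded_subset compact_imp_bounded image_mono ball_subset_cball order_trans)
  then show ?thesis by (rule emeasure_bounded_finite)
qed

definition cap_area :: "real \<Rightarrow> real \<Rightarrow> real" where
  "cap_area \<phi> v = measure lborel (w ` cap \<phi> v)"

text \<open>In the chart, the part of the larger cap to the right of \<open>v1\<close> is disjoint from the smaller cap. Change
of variables and Fubini compute the area of its image.\<close>

lemma cap_area_increment:
  assumes "v1 \<le> v2" "v2 \<le> 0"
  shows "ennreal (cap_area \<phi> v1) + (\<integral>\<^sup>+u\<in>{v1<..<v2}. slice \<phi> u \<partial>lborel) \<le> ennreal (cap_area \<phi> v2)"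
proof -
  define S where "S = chart_dom \<phi> \<inter> {\<zeta>. Re \<zeta> < v2} \<inter> {\<zeta>. v1 < Re \<zeta>}"
  have oS: "open S" unfolding S_def
    by (intro open_Int open_chart_dom open_halfspace_Re_lt open_halfspace_Re_gt)
  have Sd: "S \<subseteq> chart_dom \<phi>" by (auto simp: S_def)
  have sub: "chart \<phi> ` chart_dom \<phi> \<subseteq> ball 0 1" by (auto simp: chart_dom_def)
  have inj': "inj_on (w \<circ> chart \<phi>) (chart_dom \<phi>)"
    using inj_chart sub by (intro comp_inj_on inj_on_subset[OF inj])
  have img: "w ` chart \<phi> ` S \<subseteq> w ` cap \<phi> v2" 
    using chart_image[OF assms(2), of \<phi>] by (auto simp: S_def)
  have fin: "emeasure lborel ((w \<circ> chart \<phi>) ` S) < \<infinity>"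
    unfolding image_comp[symmetric] using sub Sd by (intro finite_image) auto
  have cap: "cap \<phi> v \<subseteq> ball 0 1" "open (cap \<phi> v)" for v by (auto simp: cap_def)
  have em: "emeasure lborel (w ` cap \<phi> v) = ennreal (cap_area \<phi> v)" for v
    using finite_image[OF cap(1)] by (simp add: cap_area_def emeasure_eq_ennreal_measure less_top)
  have "(\<integral>\<^sup>+u\<in>{v1<..<v2}. slice \<phi> u \<partial>lborel)
      = (\<integral>\<^sup>+u. \<integral>\<^sup>+y. ennreal (jac \<phi> (Complex u y)) * indicator (chart_dom \<phi>) (Complex u y)
           * indicator {\<zeta>. v1 < Re \<zeta> \<and> Re \<zeta> < v2} (Complex u y) \<partial>lborel \<partial>lborel)"
    unfolding slice_def by (intro nn_integral_cong) (auto simp: indicator_def)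
  also have "\<dots> = (\<integral>\<^sup>+\<zeta>. ennreal (jac \<phi> \<zeta>) * indicator (chart_dom \<phi>) \<zeta>
           * indicator {\<zeta>. v1 < Re \<zeta> \<and> Re \<zeta> < v2} \<zeta> \<partial>lborel)"
  proof (rule nn_integral_complex_iterated[symmetric])
    have [measurable]: "{\<zeta>. v1 < Re \<zeta> \<and> Re \<zeta> < v2} \<in> sets borel"
      by (intro borel_open open_Collect_conj open_halfspace_Re_lt open_halfspace_Re_gt)
    show "(\<lambda>\<zeta>. ennreal (jac \<phi> \<zeta>) * indicator (chart_dom \<phi>) \<zeta>
           * indicator {\<zeta>. v1 < Re \<zeta> \<and> Re \<zeta> < v2} \<zeta>) \<in> borel_measurable borel"
      by measurable
  qed
  also have "\<dots> = (\<integral>\<^sup>+\<zeta>\<in>S. ennreal (jac \<phi> \<zeta>) \<partial>lborel)"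
    by (intro nn_integral_cong) (auto simp: indicator_def S_def)
  also have "\<dots> = emeasure lborel ((w \<circ> chart \<phi>) ` S)"
    unfolding jac_def using Sd
    by (intro area_of_image oS inj_on_subset[OF inj'] chart_map_deriv fin
          continuous_on_subset[OF cont_pq_chart(1)] continuous_on_subset[OF cont_pq_chart(2)]) auto
  finally have eq: "(\<integral>\<^sup>+u\<in>{v1<..<v2}. slice \<phi> u \<partial>lborel) = emeasure lborel (w ` chart \<phi> ` S)"
    by (simp add: image_comp)
  have disj: "w ` cap \<phi> v1 \<inter> w ` chart \<phi> ` S = {}"
  proof -
    have "w ` cap \<phi> v1 = (w \<circ> chart \<phi>) ` (chart_dom \<phi> \<inter> {\<zeta>. Re \<zeta> < v1})"
      using chart_image[of v1 \<phi>] assms by (simp only: image_comp[symmetric] cis_notin_cap)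
    moreover have "w ` chart \<phi> ` S = (w \<circ> chart \<phi>) ` S" by (simp add: image_comp)
    moreover have "(chart_dom \<phi> \<inter> {\<zeta>. Re \<zeta> < v1}) \<inter> S = {}" by (auto simp: S_def)
    ultimately show ?thesis
      using inj_on_image_Int[OF inj', of "chart_dom \<phi> \<inter> {\<zeta>. Re \<zeta> < v1}" S] Sd by auto
  qed
  have capm: "cap \<phi> v1 \<subseteq> cap \<phi> v2"
  proof -
    have "exp v1 \<le> exp v2" using assms by simp
    then show ?thesis unfolding cap_def by (intro Int_mono subset_ball) auto
  qed
  have o: "open (w ` chart \<phi> ` S)"
    using Sd sub oS inj_on_subset[OF inj_chart Sd]
    by (intro open_image invariance_of_domain cont_chart) auto
  have "emeasure lborel (w ` cap \<phi> v1) + emeasure lborel (w ` chart \<phi> ` S)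
      = emeasure lborel (w ` cap \<phi> v1 \<union> w ` chart \<phi> ` S)"
    using o open_image[OF cap] disj by (intro plus_emeasure) auto
  also have "\<dots> \<le> emeasure lborel (w ` cap \<phi> v2)"
    using open_image[OF cap] capm img by (intro emeasure_mono) auto
  finally show ?thesis by (simp add: em eq)
qed

text \<open>On the crosscut the derivative of \<open>w\<close> is at most \<open>sqrt (K * jac)\<close>, which is at most
\<open>(\<epsilon> + K * jac / \<epsilon>) / 2\<close>. The integral of this majorant serves as length function, and the choice of
\<open>\<epsilon>\<close> in \<open>optimal_epsilon\<close> then has the effect of the Cauchy-Schwarz inequality.\<close>

lemma crosscut_length:
  assumes u: "u < 0" and fin: "slice \<phi> u < \<infinity>" and \<epsilon>: "0 < \<epsilon>"
  obtains N where
    "\<And>s t. - aperture u \<le> s \<Longrightarrow> s \<le> t \<Longrightarrow> t \<le> aperture u \<Longrightarrow>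
       cmod (w (chart \<phi> (Complex u t)) - w (chart \<phi> (Complex u s))) \<le> N t - N s"
    "N (aperture u) - N (- aperture u) \<le> (pi * \<epsilon> + K * enn2real (slice \<phi> u) / \<epsilon>) / 2"
proof -
  define a where "a = aperture u"
  have a: "0 < a" "a < pi / 2" using aperture[OF u] pi_gt_zero unfolding a_def by linarith+
  \<comment> \<open>The Jacobian may be unbounded near the ends of the crosscut; extended by 0 it is integrable over the closed interval.\<close>
  define g where "g t = jac \<phi> (Complex u t) * indicator (chart_dom \<phi>) (Complex u t)" for t
  have g: "ennreal (g t) = ennreal (jac \<phi> (Complex u t)) * indicator (chart_dom \<phi>) (Complex u t)" for t
    by (auto simp: g_def indicator_def)
  have g_eq: "g t = jac \<phi> (Complex u t)" if "\<bar>t\<bar> < a" for t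
    using that chart_dom_iff[OF u] by (simp add: g_def a_def)
  have Cm: "Complex u \<in> borel_measurable borel"
    unfolding Complex_eq by (intro borel_measurable_continuous_onI continuous_intros)
  have "(\<lambda>t. ennreal (g t)) \<in> borel_measurable borel"
    unfolding g using measurable_compose[OF Cm jac_measurable[of \<phi>]] by simp
  then have "(\<lambda>t. enn2real (ennreal (g t))) \<in> borel_measurable borel" by measurable
  moreover have g0: "0 \<le> g t" for t by (auto simp: g_def jac_nonneg)
  ultimately have gm: "g \<in> borel_measurable borel" by simp
  have gi: "integrable lborel g"
    using fin gm g0 by (intro integrableI_nonneg) (auto simp: slice_def g[symmetric])
  define G where "G = enn2real (slice \<phi> u)"
  have "slice \<phi> u = ennreal (integral\<^sup>L lborel g)"
    unfolding slice_def g[symmetric] using gi g0 by (intro nn_integral_eq_integral) auto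
  then have G: "G = integral\<^sup>L lborel g"
    unfolding G_def using g0 by (simp add: integral_nonneg_AE)
  have hi: "(g has_integral G) UNIV"
    using has_integral_integral_lborel[OF gi] G by simp
  have gint: "g integrable_on {x..y}" for x y
    using hi by (intro integrable_on_subinterval[OF has_integral_integrable[OF hi]]) auto
  define n where "n t = (\<epsilon> + K * g t / \<epsilon>) / 2" for t
  have nhas: "(n has_integral (\<epsilon> * (y - x) + K * integral {x..y} g / \<epsilon>) / 2) {x..y}" if "x \<le> y" for x y
    unfolding n_def using that
      has_integral_divide[OF has_integral_add[OF has_integral_const_real[of \<epsilon> x y]
        has_integral_divide[OF has_integral_mult_right[OF integrable_integral[OF gint[of x y]], of K], of \<epsilon>]], of 2]
    by (simp add: mult.commute)
  then have nint: "n integrable_on {x..y}" for x y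
    by (cases "x \<le> y") (auto simp: integrable_on_def)
  define N where "N t = integral {-a..t} n" for t
  show thesis
  proof
    fix s t assume st: "- aperture u \<le> s" "s \<le> t" "t \<le> aperture u"
    show "cmod (w (chart \<phi> (Complex u t)) - w (chart \<phi> (Complex u s))) \<le> N t - N s"
    proof (cases "s = t")
      case False
      show ?thesis
      proof (rule differentiable_bound_general[where f="\<lambda>t. w (chart \<phi> (Complex u t))" and \<phi>=N and \<phi>'=n])
        show "s < t" using False st by simp
        have "chart \<phi> (Complex u x) \<in> cball 0 1" if "x \<in> {s..t}" for x
          using chart_in(2)[of x u \<phi>] st that u a by (auto simp: a_def)
        then show "continuous_on {s..t} (\<lambda>t. w (chart \<phi> (Complex u t)))"
          by (intro continuous_on_compose2[OF cont] continuous_on_compose2[OF cont_chart[of UNIV]])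
             (auto simp: Complex_eq intro!: continuous_intros)
        have "continuous_on {-a..a} N"
          unfolding N_def by (rule indefinite_integral_continuous_1[OF nint])
        then show "continuous_on {s..t} N"
          by (rule continuous_on_subset) (use st in \<open>auto simp: a_def\<close>)
        fix x assume x: "s < x" "x < t"
        then have xa: "\<bar>x\<bar> < a" using st by (auto simp: a_def)
        define \<zeta> where "\<zeta> = Complex u x"
        have dom: "\<zeta> \<in> chart_dom \<phi>" using xa chart_dom_iff[OF u] by (auto simp: \<zeta>_def a_def)
        define P where "P = p (chart \<phi> \<zeta>) * (- cis \<phi> * exp \<zeta>)"
        define Q where "Q = q (chart \<phi> \<zeta>) * (- cis \<phi> * exp \<zeta>)"
        have "(Complex u has_vector_derivative \<i>) (at x)"
          unfolding Complex_eq by (auto intro!: derivative_eq_intros)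
        then have "(Complex u has_derivative (\<lambda>h. h *\<^sub>R \<i>)) (at x)"
          by (simp add: has_vector_derivative_def)
        from has_derivative_compose[OF this chart_map_deriv[OF dom[unfolded \<zeta>_def]], folded \<zeta>_def]
        show "((\<lambda>t. w (chart \<phi> (Complex u t))) has_vector_derivative (P * \<i> + cnj (Q * \<i>))) (at x)"
          unfolding has_vector_derivative_def P_def Q_def o_def
          by (rule has_derivative_eq_rhs) (simp add: fun_eq_iff scaleR_conv_of_real algebra_simps)
        have "continuous (at x) n"
        proof -
          have "isCont (\<lambda>t. jac \<phi> (Complex u t)) x"
          proof -
            have "isCont (jac \<phi>) (Complex u x)"
              using cont_jac open_chart_dom dom unfolding \<zeta>_def by (simp add: continuous_on_eq_continuous_at)
            moreover have "isCont (Complex u) x"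
              unfolding Complex_eq by (intro continuous_intros)
            ultimately show ?thesis by (simp add: isCont_o2)
          qed
          moreover have "eventually (\<lambda>t. g t = jac \<phi> (Complex u t)) (nhds x)"
          proof (rule eventually_mono)
            show "eventually (\<lambda>t. t \<in> {-a<..<a}) (nhds x)"
              using xa by (intro eventually_nhds_in_open) auto
          qed (auto intro!: g_eq)
          ultimately have "isCont g x" by (simp add: isCont_cong)
          then show ?thesis unfolding n_def by (intro continuous_intros) (use \<epsilon> in auto)
        qed
        then have "(N has_vector_derivative n x) (at x within {-a..a} - {})"
          unfolding N_def
          by (intro integral_has_vector_derivative_continuous_at nint) 
             (use xa in \<open>auto intro: continuous_at_imp_continuous_at_within\<close>)
        then show "(N has_vector_derivative n x) (at x)"
          using xa by (simp add: at_within_Icc_at)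
        have qc: "cmod P + cmod Q \<le> K * \<bar>cmod P - cmod Q\<bar>"
        proof -
          have "cmod (p (chart \<phi> \<zeta>)) + cmod (q (chart \<phi> \<zeta>)) \<le> K * \<bar>cmod (p (chart \<phi> \<zeta>)) - cmod (q (chart \<phi> \<zeta>))\<bar>"
            using dilatation dom by (auto simp: chart_dom_def)
          then have "(cmod (p (chart \<phi> \<zeta>)) + cmod (q (chart \<phi> \<zeta>))) * exp u
              \<le> (K * \<bar>cmod (p (chart \<phi> \<zeta>)) - cmod (q (chart \<phi> \<zeta>))\<bar>) * exp u"
            by (rule mult_right_mono) simp
          also have "\<dots> = K * \<bar>(cmod (p (chart \<phi> \<zeta>)) - cmod (q (chart \<phi> \<zeta>))) * exp u\<bar>"
            by (simp add: abs_mult)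
          finally show ?thesis
            by (simp add: P_def Q_def norm_mult \<zeta>_def algebra_simps)
        qed
        have J: "(cmod P + cmod Q)\<^sup>2 \<le> K * g x"
        proof -
          have "(cmod P + cmod Q)\<^sup>2 \<le> (cmod P + cmod Q) * (K * \<bar>cmod P - cmod Q\<bar>)"
            unfolding power2_eq_square by (intro mult_left_mono qc) auto
          also have "\<dots> = K * \<bar>(cmod P + cmod Q) * (cmod P - cmod Q)\<bar>"
            by (simp add: abs_mult)
          also have "(cmod P + cmod Q) * (cmod P - cmod Q) = (cmod P)\<^sup>2 - (cmod Q)\<^sup>2"
            by (simp add: power2_eq_square algebra_simps)
          also have "\<bar>\<dots>\<bar> = g x"
            unfolding g_eq[OF xa] jac_def P_def Q_def \<zeta>_def ..
          finally show ?thesis .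
        qed
        have "cmod (P * \<i> + cnj (Q * \<i>)) \<le> cmod P + cmod Q"
          by (rule order_trans[OF norm_triangle_ineq]) (simp add: norm_mult)
        also have "\<dots> \<le> n x"
        proof -
          define r where "r = cmod P + cmod Q"
          have "2 * r * \<epsilon> \<le> \<epsilon>\<^sup>2 + r\<^sup>2" using sum_squares_bound[of \<epsilon> r] by (simp add: ac_simps)
          also have "\<dots> \<le> \<epsilon>\<^sup>2 + K * g x" using J by (simp add: r_def)
          finally have "r \<le> n x" using \<epsilon> by (simp add: n_def field_simps power2_eq_square)
          then show ?thesis by (simp add: r_def)
        qed
        finally show "cmod (P * \<i> + cnj (Q * \<i>)) \<le> n x" .
      qed
    qed simp
  next
    have "N a - N (- a) = integral {-a..a} n" by (simp add: N_def)
    also have "\<dots> = (\<epsilon> * (2 * a) + K * integral {-a..a} g / \<epsilon>) / 2"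
      using integral_unique[OF nhas[of "-a" a]] a by simp
    also have "\<dots> \<le> (\<epsilon> * pi + K * G / \<epsilon>) / 2"
    proof -
      have "integral {-a..a} g \<le> integral UNIV g"
        using hi gint g0 by (intro integral_subset_le) auto
      then have "integral {-a..a} g \<le> G" using hi by (simp add: integral_unique)
      then show ?thesis using a \<epsilon> K_ge_1 by (intro divide_right_mono add_mono mult_left_mono) auto
    qed
    finally show "N (aperture u) - N (- aperture u) \<le> (pi * \<epsilon> + K * enn2real (slice \<phi> u) / \<epsilon>) / 2"
      by (simp add: a_def G_def ac_simps)
  qed
qed

end

text \<open>The infimum over \<open>\<epsilon>\<close> of \<open>((pi * \<epsilon> + k * G / \<epsilon>) / 2)\<^sup>2\<close> is \<open>pi * k * G\<close>. It is not attained for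
\<open>G = 0\<close>, so \<open>G\<close> is first enlarged.\<close>

lemma optimal_epsilon:
  fixes X c k G :: real
  assumes "\<And>\<epsilon>. 0 < \<epsilon> \<Longrightarrow> X \<le> c * ((pi * \<epsilon> + k * G / \<epsilon>) / 2)\<^sup>2" "0 \<le> c" "0 < k" "0 \<le> G"
  shows "X \<le> c * (pi * k * G)"
proof (rule field_le_epsilon)
  fix e :: real assume e: "0 < e"
  define \<delta> where "\<delta> = e / (c * pi * k + 1)"
  have pos: "0 < c * pi * k + 1" using assms by (simp add: add_nonneg_pos)
  then have \<delta>: "0 < \<delta>" "c * pi * k * \<delta> \<le> e"
    using e assms by (auto simp: \<delta>_def field_simps)
  define G' where "G' = G + \<delta>"
  have G': "0 < G'" "G \<le> G'" using assms \<delta> by (auto simp: G'_def)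
  define \<epsilon> where "\<epsilon> = sqrt (k * G' / pi)"
  have \<epsilon>: "0 < \<epsilon>" "\<epsilon>\<^sup>2 = k * G' / pi" using G' assms by (auto simp: \<epsilon>_def)
  have "X \<le> c * ((pi * \<epsilon> + k * G / \<epsilon>) / 2)\<^sup>2" using assms(1)[OF \<epsilon>(1)] .
  also have "\<dots> \<le> c * ((pi * \<epsilon> + k * G' / \<epsilon>) / 2)\<^sup>2"
    using assms G' \<epsilon> by (intro mult_left_mono power_mono divide_right_mono add_left_mono) auto
  also have "k * G' / \<epsilon> = pi * \<epsilon>"
    using \<epsilon> by (simp add: field_simps power2_eq_square)
  also have "((pi * \<epsilon> + pi * \<epsilon>) / 2)\<^sup>2 = pi * k * G'"
    using \<epsilon> by (simp add: power_mult_distrib power2_eq_square field_simps)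
  also have "c * (pi * k * G') \<le> c * (pi * k * G) + e"
    using \<delta> by (simp add: G'_def algebra_simps)
  finally show "X \<le> c * (pi * k * G) + e" .
qed

text \<open>The function \<open>s\<close> measures length along the boundary curve.\<close>

locale length_disc_map = disc_map +
  fixes s :: "real \<Rightarrow> real" and B :: real
  assumes B_nonneg: "0 \<le> B" and s_mono: "mono s"
    and bdry_s: "\<And>x y. cmod (bdry x - bdry y) \<le> \<bar>s x - s y\<bar>"
    and s_chord: "\<And>\<phi> \<eta>. 0 \<le> \<eta> \<Longrightarrow> \<eta> < pi / 3 \<Longrightarrow>
        s (\<phi> + \<eta>) - s (\<phi> - \<eta>) \<le> 2 * B * cmod (bdry (\<phi> + \<eta>) - bdry (\<phi> - \<eta>))"
begin

text \<open>Half the angle under which the arc of the unit circle cut off by the crosscut of radius \<open>exp u\<close> is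
seen from the origin.\<close>

definition half_angle :: "real \<Rightarrow> real" where "half_angle u = pi - 2 * aperture u"

lemma half_angle:
  assumes "u < 0"
  shows "0 < half_angle u" "half_angle u < pi / 3" "exp u \<le> half_angle u"
    "cos (half_angle u) = 1 - (exp u)\<^sup>2 / 2"
    "chart \<phi> (Complex u (aperture u)) = cis (\<phi> - half_angle u)"
    "chart \<phi> (Complex u (- aperture u)) = cis (\<phi> + half_angle u)"
proof -
  note ap = aperture[OF assms]
  show h: "0 < half_angle u" "half_angle u < pi / 3" using ap by (auto simp: half_angle_def)
  have "exp u = 2 * cos (pi / 2 - half_angle u / 2)" using ap(3) by (simp add: half_angle_def field_simps)
  also have "cos (pi / 2 - half_angle u / 2) = sin (half_angle u / 2)" by (simp add: cos_diff)
  also have "\<dots> \<le> half_angle u / 2" using h by (intro sin_x_le_x) auto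
  finally show "exp u \<le> half_angle u" by simp
  have e: "exp u = 2 * cos (aperture u)" using ap by simp
  have "cos (half_angle u) = - cos (2 * aperture u)" by (simp add: half_angle_def cos_diff)
  also have "\<dots> = 1 - (exp u)\<^sup>2 / 2"
    unfolding cos_double_cos e by (simp add: power2_eq_square)
  finally show "cos (half_angle u) = 1 - (exp u)\<^sup>2 / 2" .
  have *: "1 - exp (Complex u (aperture u)) = cis (- half_angle u)"
    "1 - exp (Complex u (- aperture u)) = cis (half_angle u)"
    by (simp_all add: complex_eq_iff Re_exp Im_exp e half_angle_def cos_diff sin_diff cos_double_cos sin_double)
       (simp_all add: power2_eq_square)
  show "chart \<phi> (Complex u (aperture u)) = cis (\<phi> - half_angle u)"
    "chart \<phi> (Complex u (- aperture u)) = cis (\<phi> + half_angle u)"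
    unfolding chart_def * by (simp_all add: cis_mult)
qed

lemma cap_boundary:
  assumes u: "u < 0" and \<zeta>: "\<zeta> \<in> cball 0 1 \<inter> cball (cis \<phi>) (exp u)" "\<zeta> \<notin> cap \<phi> u"
  shows "\<zeta> \<in> (\<lambda>t. chart \<phi> (Complex u t)) ` {- aperture u..aperture u} \<union>
     (\<lambda>x. cis (2 * \<phi> - x)) ` {\<phi> - half_angle u..\<phi> + half_angle u}"
proof -
  define \<xi> where "\<xi> = \<zeta> / cis \<phi>"
  have z: "\<zeta> = cis \<phi> * \<xi>" by (simp add: \<xi>_def)
  have n: "cmod \<zeta> = cmod \<xi>" by (simp add: z norm_mult)
  have "cis \<phi> - \<zeta> = cis \<phi> * (1 - \<xi>)" by (simp add: z algebra_simps)
  then have d: "dist (cis \<phi>) \<zeta> = cmod (1 - \<xi>)" by (simp add: dist_norm norm_mult)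
  have "cmod \<zeta> = 1 \<or> dist (cis \<phi>) \<zeta> = exp u" using \<zeta> by (auto simp: cap_def)
  then show ?thesis
  proof
    assume 1: "cmod \<zeta> = 1"
    define x where "x = Arg \<xi>"
    have "cis (Arg \<xi>) = sgn \<xi>" using 1 n by (intro cis_Arg) auto
    then have xi: "\<xi> = cis x" using 1 n by (simp add: x_def sgn_eq)
    have x: "\<bar>x\<bar> \<le> pi" using mpi_less_Arg[of \<xi>] Arg_le_pi[of \<xi>] by (simp add: x_def)
    have "(cmod (1 - \<xi>))\<^sup>2 = 2 - 2 * cos x"
      using norm_one_minus[of 1 x] by (simp add: xi)
    moreover have "(cmod (1 - \<xi>))\<^sup>2 \<le> (exp u)\<^sup>2"
      using \<zeta> d by (intro power_mono) auto
    ultimately have "cos (half_angle u) \<le> cos x" using half_angle[OF u] by simp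
    then have "\<bar>x\<bar> \<le> half_angle u"
      using cos_le_cos_iff_abs(1)[OF x, of "half_angle u"] half_angle[OF u] pi_gt_zero by (auto simp del: pi_gt_zero)
    moreover have "\<zeta> = cis (2 * \<phi> - (\<phi> - x))" by (simp add: z xi cis_mult)
    ultimately show ?thesis by (intro UnI2 image_eqI[of _ _ "\<phi> - x"]) auto
  next
    assume 2: "dist (cis \<phi>) \<zeta> = exp u"
    then have m: "cmod (1 - \<xi>) = exp u" using d by simp
    then have ne: "1 - \<xi> \<noteq> 0" by auto
    define t where "t = Im (Ln (1 - \<xi>))"
    have "Complex u t = Ln (1 - \<xi>)" using Re_Ln[OF ne] m by (simp add: complex_eq_iff t_def)
    then have c: "chart \<phi> (Complex u t) = \<zeta>" using ne by (simp add: chart_def z)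
    have "\<bar>t\<bar> \<le> pi" using mpi_less_Im_Ln[OF ne] Im_Ln_le_pi[OF ne] by (auto simp: t_def)
    then have "\<bar>t\<bar> \<le> aperture u" using chart_in(2)[of t u \<phi>] u c \<zeta> by auto
    then show ?thesis using c by (intro UnI1 image_eqI[of _ _ t]) auto
  qed
qed

text \<open>The image of the cap is bounded by the images of the crosscut and of the arc that it cuts off. By
the chord-arc estimate the second one is at most \<open>2 * B\<close> times as long as the first one.\<close>

lemma image_boundary_arc:
  assumes u: "u < 0" and fin: "slice \<phi> u < \<infinity>" and \<epsilon>: "0 < \<epsilon>"
  defines "E \<equiv> (pi * \<epsilon> + K * enn2real (slice \<phi> u) / \<epsilon>) / 2"
  shows "cmod (bdry (\<phi> + half_angle u) - bdry (\<phi> - half_angle u)) \<le> E"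
    "s (\<phi> + half_angle u) - s (\<phi> - half_angle u) \<le> 2 * B * E"
    "cap_area \<phi> u \<le> ((1 + 2 * B) * E)\<^sup>2 / 8"
proof -
  obtain N where N: "\<And>s t. - aperture u \<le> s \<Longrightarrow> s \<le> t \<Longrightarrow> t \<le> aperture u \<Longrightarrow>
       cmod (w (chart \<phi> (Complex u t)) - w (chart \<phi> (Complex u s))) \<le> N t - N s"
    and E: "N (aperture u) - N (- aperture u) \<le> E"
    using crosscut_length[OF u fin \<epsilon>] unfolding E_def by blast
  have ap: "0 < aperture u" using aperture[OF u] pi_gt_zero by linarith
  note h = half_angle[OF u]
  show 1: "cmod (bdry (\<phi> + half_angle u) - bdry (\<phi> - half_angle u)) \<le> E"
    using N[of "- aperture u" "aperture u"] ap E h(5,6)[of \<phi>] 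
    by (simp add: bdry_def norm_minus_commute)
  show 2: "s (\<phi> + half_angle u) - s (\<phi> - half_angle u) \<le> 2 * B * E"
  proof -
    have "s (\<phi> + half_angle u) - s (\<phi> - half_angle u) \<le> 2 * B * cmod (bdry (\<phi> + half_angle u) - bdry (\<phi> - half_angle u))"
      using h by (intro s_chord) auto
    also have "\<dots> \<le> 2 * B * E" using 1 B_nonneg by (intro mult_left_mono) auto
    finally show ?thesis .
  qed
  define C where "C = cball 0 1 \<inter> cball (cis \<phi>) (exp u)"
  have "cis \<phi> \<in> C" by (simp add: C_def)
  have cC: "compact (w ` C)" unfolding C_def
    by (intro compact_continuous_image continuous_on_subset[OF cont]) (auto intro: compact_Int_closed)
  have ocap: "open (w ` cap \<phi> u)" by (rule open_image) (auto simp: cap_def)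
  have "measure lborel (w ` cap \<phi> u) \<le> ((1 + 2 * B) * E)\<^sup>2 / 8"
  proof (rule area_le_bounding_box)
    show "w ` cap \<phi> u \<subseteq> w ` C" by (auto simp: cap_def C_def)
    show "compact (w ` C)" by (rule cC)
    show "w ` C \<noteq> {}" using \<open>cis \<phi> \<in> C\<close> by auto
    show "w ` cap \<phi> u \<in> sets borel" using ocap by auto
    fix z1 z2 z3 z4
    assume z: "\<forall>z\<in>w ` C. Re z \<le> Re z1" "\<forall>z\<in>w ` C. Re z2 \<le> Re z" "\<forall>z\<in>w ` C. Im z \<le> Im z3"
      "\<forall>z\<in>w ` C. Im z4 \<le> Im z" and zC: "{z1, z2, z3, z4} \<subseteq> w ` C"
    have sub: "w ` cap \<phi> u \<subseteq> w ` C" by (auto simp: cap_def C_def)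
    \<comment> \<open>The image of the open cap is open, so a coordinate cannot be extremal there.\<close>
    have ext: "z0 \<notin> w ` cap \<phi> u" if z0: "\<forall>z\<in>w ` C. a \<bullet> z \<le> a \<bullet> z0" "a \<noteq> 0" for a z0 :: complex
    proof
      assume "z0 \<in> w ` cap \<phi> u"
      then obtain e where e: "0 < e" "cball z0 e \<subseteq> w ` cap \<phi> u"
        using ocap open_contains_cball by metis
      define z where "z = z0 + (e / norm a) *\<^sub>R a"
      have "z \<in> cball z0 e" using e z0 by (simp add: z_def dist_norm)
      then have "z \<in> w ` C" using e sub by blast
      then have "a \<bullet> z \<le> a \<bullet> z0" using z0 by blast
      moreover have "a \<bullet> z = a \<bullet> z0 + e * norm a"
        using z0 by (simp add: z_def inner_add_right dot_square_norm power2_eq_square)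
      ultimately show False using mult_pos_pos[OF e(1), of "norm a"] z0 by simp
    qed
    have notin: "{z1, z2, z3, z4} \<inter> w ` cap \<phi> u = {}"
      using z ext[of 1 z1] ext[of "-1" z2] ext[of "\<i>" z3] ext[of "-\<i>" z4] by simp
    have bd: "z \<in> (\<lambda>t. w (chart \<phi> (Complex u t))) ` {- aperture u..aperture u} \<union>
       (\<lambda>x. bdry (2 * \<phi> - x)) ` {\<phi> - half_angle u..\<phi> + half_angle u}" if "z \<in> {z1, z2, z3, z4}" for z
    proof -
      have "z \<in> w ` C" using that zC by blast
      moreover have "z \<notin> w ` cap \<phi> u" using that notin by blast
      ultimately
      obtain \<zeta> where "\<zeta> \<in> C" "z = w \<zeta>" "\<zeta> \<notin> cap \<phi> u" by auto
      then show ?thesis using cap_boundary[OF u, of \<zeta> \<phi>] by (auto simp: C_def bdry_def)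
    qed
    \<comment> \<open>The boundary arc is traversed in the direction of the crosscut.\<close>
    define M where "M x = - s (2 * \<phi> - x)" for x
    have "4 * ((Re z1 - Re z2)\<^sup>2 + (Im z3 - Im z4)\<^sup>2)
      \<le> (N (aperture u) - N (- aperture u) + (M (\<phi> + half_angle u) - M (\<phi> - half_angle u)))\<^sup>2"
    proof (rule two_arcs_bounding_box[where c="\<lambda>t. w (chart \<phi> (Complex u t))" and e="\<lambda>x. bdry (2 * \<phi> - x)"
          and N=N and M=M and a="- aperture u" and b="aperture u" and a'="\<phi> - half_angle u" and b'="\<phi> + half_angle u"])
      show "w (chart \<phi> (Complex u (- aperture u))) = bdry (2 * \<phi> - (\<phi> - half_angle u))"
        "w (chart \<phi> (Complex u (aperture u))) = bdry (2 * \<phi> - (\<phi> + half_angle u))"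
        by (simp_all add: h(5,6) bdry_def)
      show "cmod (bdry (2 * \<phi> - t) - bdry (2 * \<phi> - r)) \<le> M t - M r" if "r \<le> t" for r t
        using bdry_s[of "2 * \<phi> - t" "2 * \<phi> - r"] monoD[OF s_mono, of "2 * \<phi> - t" "2 * \<phi> - r"] that
        by (simp add: M_def)
      show "{z1, z2, z3, z4} \<subseteq> (\<lambda>t. w (chart \<phi> (Complex u t))) ` {- aperture u..aperture u} \<union>
       (\<lambda>x. bdry (2 * \<phi> - x)) ` {\<phi> - half_angle u..\<phi> + half_angle u}" using bd by blast
    qed (use N ap h in auto)
    also have "\<dots> \<le> ((1 + 2 * B) * E)\<^sup>2"
    proof (rule power_mono)
      show "N (aperture u) - N (- aperture u) + (M (\<phi> + half_angle u) - M (\<phi> - half_angle u)) \<le> (1 + 2 * B) * E"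
        using E 2 by (simp add: M_def algebra_simps)
      show "0 \<le> N (aperture u) - N (- aperture u) + (M (\<phi> + half_angle u) - M (\<phi> - half_angle u))"
        using order_trans[OF norm_ge_zero N[of "- aperture u" "aperture u"]] ap h
          monoD[OF s_mono, of "\<phi> - half_angle u" "\<phi> + half_angle u"] by (simp add: M_def)
    qed
    finally show "4 * ((Re z1 - Re z2)\<^sup>2 + (Im z3 - Im z4)\<^sup>2) \<le> ((1 + 2 * B) * E)\<^sup>2" .
  qed
  then show "cap_area \<phi> u \<le> ((1 + 2 * B) * E)\<^sup>2 / 8" by (simp add: cap_area_def)
qed

text \<open>The area of the image of the cap of radius \<open>\<rho>\<close> decays at least like \<open>\<rho> powr (1 / \<kappa>)\<close>.\<close>

definition \<kappa> :: real where "\<kappa> = (1 + 2 * B)\<^sup>2 * pi * K / 8"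

lemma \<kappa>_pos: "0 < \<kappa>" using B_nonneg K_ge_1 by (simp add: \<kappa>_def)

lemma cap_area_le_slice:
  assumes u: "u < 0"
  shows "ennreal (cap_area \<phi> u / \<kappa>) \<le> slice \<phi> u"
proof (cases "slice \<phi> u < \<infinity>")
  case True
  have "cap_area \<phi> u \<le> (1 + 2 * B)\<^sup>2 / 8 * (pi * K * enn2real (slice \<phi> u))"
  proof (rule optimal_epsilon)
    show "cap_area \<phi> u \<le> (1 + 2 * B)\<^sup>2 / 8 * ((pi * \<epsilon> + K * enn2real (slice \<phi> u) / \<epsilon>) / 2)\<^sup>2" if "0 < \<epsilon>" for \<epsilon>
      using image_boundary_arc(3)[OF u True that] unfolding power_mult_distrib[of "1 + 2 * B"] by simp
  qed (use K_ge_1 in auto)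
  then have "cap_area \<phi> u / \<kappa> \<le> enn2real (slice \<phi> u)"
    using \<kappa>_pos by (simp add: \<kappa>_def field_simps)
  then show ?thesis using True by (metis ennreal_enn2real_if ennreal_leI infinity_ennreal_def less_irrefl)
qed (auto simp: less_top[symmetric])

lemma cap_area_mono: "v1 \<le> v2 \<Longrightarrow> v2 \<le> 0 \<Longrightarrow> cap_area \<phi> v1 \<le> cap_area \<phi> v2"
proof -
  assume v: "v1 \<le> v2" "v2 \<le> 0"
  have "ennreal (cap_area \<phi> v1) \<le> ennreal (cap_area \<phi> v2)"
    using order_trans[OF add_increasing2[OF zero_le order_refl] cap_area_increment[OF v]] .
  then show ?thesis by (simp add: cap_area_def)
qed

lemma cap_area_nonneg: "0 \<le> cap_area \<phi> v" by (simp add: cap_area_def)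

lemma cap_area_step:
  assumes "v1 \<le> v2" "v2 \<le> 0"
  shows "cap_area \<phi> v1 * (1 + (v2 - v1) / \<kappa>) \<le> cap_area \<phi> v2"
proof -
  have "ennreal (cap_area \<phi> v1 / \<kappa>) * ennreal (v2 - v1) = (\<integral>\<^sup>+u\<in>{v1<..<v2}. ennreal (cap_area \<phi> v1 / \<kappa>) \<partial>lborel)"
    using assms by (subst nn_integral_cmult_indicator) auto
  also have "\<dots> \<le> (\<integral>\<^sup>+u\<in>{v1<..<v2}. slice \<phi> u \<partial>lborel)"
  proof (intro nn_integral_mono)
    fix u
    have "ennreal (cap_area \<phi> v1 / \<kappa>) \<le> slice \<phi> u" if "v1 < u" "u < v2"
      using that assms cap_area_mono[of v1 u \<phi>] cap_area_le_slice[of u \<phi>] \<kappa>_pos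
      by (auto elim!: order_trans[rotated] intro!: ennreal_leI divide_right_mono)
    then show "ennreal (cap_area \<phi> v1 / \<kappa>) * indicator {v1<..<v2} u \<le> slice \<phi> u * indicator {v1<..<v2} u"
      by (auto simp: indicator_def)
  qed
  finally have "ennreal (cap_area \<phi> v1) + ennreal (cap_area \<phi> v1 / \<kappa>) * ennreal (v2 - v1) \<le> ennreal (cap_area \<phi> v2)"
    using cap_area_increment[OF assms, of \<phi>] by (meson add_left_mono order_trans)
  then have "ennreal (cap_area \<phi> v1 + cap_area \<phi> v1 / \<kappa> * (v2 - v1)) \<le> ennreal (cap_area \<phi> v2)"
    using assms \<kappa>_pos cap_area_nonneg[of \<phi> v1] by (simp add: ennreal_plus ennreal_mult[symmetric])
  then show ?thesis using cap_area_nonneg by (simp add: algebra_simps)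
qed

text \<open>Iterating \<open>cap_area_step\<close> over \<open>n\<close> steps of equal length gives a bound that tends to an exponential
function as \<open>n\<close> grows.\<close>

lemma cap_area_decay:
  assumes "v \<le> 0"
  shows "cap_area \<phi> v \<le> cap_area \<phi> 0 * exp (v / \<kappa>)"
proof -
  have pow: "cap_area \<phi> v * (1 + (- v / \<kappa>) / real n) ^ n \<le> cap_area \<phi> 0" if n: "0 < n" for n
  proof -
    have "cap_area \<phi> v * (1 + (- v / \<kappa>) / real n) ^ k \<le> cap_area \<phi> (v + real k * (- v / real n))" if "k \<le> n" for k
      using that
    proof (induction k)
      case (Suc k)
      define d where "d = - v / real n"
      define x where "x = v + real k * d"
      have d: "0 \<le> d" using assms by (simp add: d_def divide_nonpos_nonneg)
      have eq: "v + real (Suc k) * d = x + d" by (simp add: x_def algebra_simps)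
      have "real (Suc k) * d \<le> real n * d" using Suc.prems d by (intro mult_right_mono) auto
      also have "\<dots> = - v" using n by (simp add: d_def)
      finally have le0: "x + d \<le> 0" using eq by simp
      have "cap_area \<phi> v * (1 + (- v / \<kappa>) / real n) ^ Suc k
          = cap_area \<phi> v * (1 + (- v / \<kappa>) / real n) ^ k * (1 + d / \<kappa>)"
        by (simp add: d_def ac_simps)
      also have "\<dots> \<le> cap_area \<phi> x * (1 + d / \<kappa>)"
        using Suc d \<kappa>_pos by (intro mult_right_mono add_nonneg_nonneg divide_nonneg_pos) (simp_all add: x_def d_def)
      also have "\<dots> \<le> cap_area \<phi> (x + d)"
        using cap_area_step[of x "x + d" \<phi>] d le0 by simp
      also have "x + d = v + real (Suc k) * (- v / real n)"
        using eq by (simp add: d_def)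
      finally show ?case .
    qed simp
    from this[of n] show ?thesis using n by simp
  qed
  have "cap_area \<phi> v * exp (- v / \<kappa>) \<le> cap_area \<phi> 0"
  proof (rule tendsto_upperbound)
    show "(\<lambda>n. cap_area \<phi> v * (1 + (- v / \<kappa>) / real n) ^ n) \<longlonglongrightarrow> cap_area \<phi> v * exp (- v / \<kappa>)"
      by (intro tendsto_intros tendsto_exp_limit_sequentially)
    show "eventually (\<lambda>n. cap_area \<phi> v * (1 + (- v / \<kappa>) / real n) ^ n \<le> cap_area \<phi> 0) sequentially"
      using pow by (intro eventually_sequentiallyI[of 1]) auto
  qed auto
  then show ?thesis by (simp add: exp_minus field_simps)
qed

lemma cap_area_pos: "0 < cap_area \<phi> v"
proof -
  have o: "open (w ` cap \<phi> v)" by (rule open_image) (auto simp: cap_def)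
  define r where "r = 1 - min 1 (exp v) / 2"
  have r: "0 < r" "r < 1" "1 - r < exp v"
  proof -
    have "0 < min 1 (exp v)" "min 1 (exp v) \<le> 1" "min 1 (exp v) \<le> exp v" by auto
    then show "0 < r" "r < 1" "1 - r < exp v" unfolding r_def by linarith+
  qed
  have "of_real r * cis \<phi> \<in> cap \<phi> v"
  proof -
    have "cis \<phi> - of_real r * cis \<phi> = of_real (1 - r) * cis \<phi>" by (simp add: algebra_simps)
    then have "dist (cis \<phi>) (of_real r * cis \<phi>) = 1 - r" using r by (simp only: dist_norm norm_mult norm_of_real norm_cis) simp
    then show ?thesis using r by (simp add: cap_def norm_mult)
  qed
  then have ne: "w ` cap \<phi> v \<noteq> {}" by auto
  have "emeasure lborel (w ` cap \<phi> v) \<noteq> 0"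
    using o ne open_not_negligible[OF o ne] by (auto simp: negligible_iff_emeasure0)
  moreover have "emeasure lborel (w ` cap \<phi> v) < \<infinity>" by (rule finite_image) (auto simp: cap_def)
  ultimately show ?thesis
    using o by (simp add: cap_area_def measure_def enn2real_positive_iff zero_less_iff_neq_zero)
qed

text \<open>Among the crosscuts of radius between \<open>h / 2\<close> and \<open>h\<close> about the midpoint of the arc, one has a slice
of at most \<open>cap_area / ln 2\<close>, because the logarithms of these radii fill an interval of length \<open>ln 2\<close>. It cuts off an
arc that contains both points. Their images lie on the closed curve formed by the images of the
crosscut and of this arc, so they are at most half its length apart.\<close>

lemma bdry_holder:
  assumes h: "0 < h" "h \<le> 1" and x: "x2 = x1 + h"
  shows "(cmod (bdry x1 - bdry x2))\<^sup>2 \<le> ((1 + 2 * B) / 2)\<^sup>2 * (pi * K * (cap_area ((x1 + x2) / 2) 0 * h powr (1 / \<kappa>) / ln 2))"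
proof -
  define \<phi> where "\<phi> = (x1 + x2) / 2"
  define v where "v = ln h"
  have v: "v \<le> 0" using h by (simp add: v_def)
  have decay: "cap_area \<phi> v \<le> cap_area \<phi> 0 * h powr (1 / \<kappa>)"
    using cap_area_decay[OF v, of \<phi>] h by (simp add: powr_def v_def)
  have "\<exists>u. v - ln 2 < u \<and> u < v \<and> slice \<phi> u \<le> ennreal (cap_area \<phi> v / ln 2)"
  proof (rule ccontr)
    assume no: "\<not> ?thesis"
    have "ennreal (cap_area \<phi> v) = ennreal (cap_area \<phi> v / ln 2) * ennreal (ln 2)"
      using cap_area_nonneg[of \<phi> v] by (simp add: ennreal_mult[symmetric])
    also have "\<dots> = (\<integral>\<^sup>+u\<in>{v - ln 2<..<v}. ennreal (cap_area \<phi> v / ln 2) \<partial>lborel)"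
      by (subst nn_integral_cmult_indicator) auto
    also have "\<dots> \<le> (\<integral>\<^sup>+u\<in>{v - ln 2<..<v}. slice \<phi> u \<partial>lborel)"
      using no by (intro nn_integral_mono) (auto simp: indicator_def intro: less_imp_le)
    finally have "ennreal (cap_area \<phi> (v - ln 2)) + ennreal (cap_area \<phi> v) \<le> ennreal (cap_area \<phi> v)"
      using cap_area_increment[of "v - ln 2" v \<phi>] v by (smt (verit, best) add_left_mono ln_ge_zero order_trans)
    then have "ennreal (cap_area \<phi> (v - ln 2) + cap_area \<phi> v) \<le> ennreal (cap_area \<phi> v)"
      using cap_area_nonneg by (simp add: ennreal_plus)
    then show False
      using cap_area_nonneg[of \<phi> v] cap_area_pos[of \<phi> "v - ln 2"] by simp
  qed
  then obtain u where u: "v - ln 2 < u" "u < v" "slice \<phi> u \<le> ennreal (cap_area \<phi> v / ln 2)" by auto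
  have u0: "u < 0" using u v by simp
  have fin: "slice \<phi> u < \<infinity>" using u(3) by (rule order_le_less_trans) simp
  have G: "enn2real (slice \<phi> u) \<le> cap_area \<phi> v / ln 2"
    using u(3) cap_area_nonneg[of \<phi> v] by (intro enn2real_leI) auto
  have "h / 2 = exp (v - ln 2)" using h by (simp add: v_def exp_diff)
  also have "\<dots> \<le> exp u" using u by simp
  finally have hh: "h / 2 \<le> half_angle u" using half_angle(3)[OF u0] by simp
  have x12: "\<phi> - half_angle u \<le> x1" "x1 \<le> x2" "x2 \<le> \<phi> + half_angle u"
    using hh x h by (auto simp: \<phi>_def field_simps)
  have "(cmod (bdry x1 - bdry x2))\<^sup>2 \<le> ((1 + 2 * B) / 2)\<^sup>2 * (pi * K * enn2real (slice \<phi> u))"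
  proof (rule optimal_epsilon)
    fix \<epsilon> :: real assume \<epsilon>: "0 < \<epsilon>"
    define E where "E = (pi * \<epsilon> + K * enn2real (slice \<phi> u) / \<epsilon>) / 2"
    note ib = image_boundary_arc[OF u0 fin \<epsilon>, folded E_def]
    have "cmod (bdry x1 - bdry x2) \<le> cmod (bdry x1 - bdry (\<phi> - half_angle u))
        + cmod (bdry (\<phi> + half_angle u) - bdry (\<phi> - half_angle u)) + cmod (bdry (\<phi> + half_angle u) - bdry x2)"
      by norm
    also have "\<dots> \<le> (s x1 - s (\<phi> - half_angle u)) + E + (s (\<phi> + half_angle u) - s x2)"
      using bdry_s[of x1 "\<phi> - half_angle u"] bdry_s[of "\<phi> + half_angle u" x2] ib(1) x12
        monoD[OF s_mono x12(1)] monoD[OF s_mono x12(3)] by auto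
    finally have 1: "cmod (bdry x1 - bdry x2) \<le> (s x1 - s (\<phi> - half_angle u)) + E + (s (\<phi> + half_angle u) - s x2)" .
    have 2: "cmod (bdry x1 - bdry x2) \<le> s x2 - s x1"
      using bdry_s[of x1 x2] monoD[OF s_mono x12(2)] by auto
    have "cmod (bdry x1 - bdry x2) \<le> (1 + 2 * B) / 2 * E"
      using 1 2 ib(2) by (simp add: algebra_simps)
    then show "(cmod (bdry x1 - bdry x2))\<^sup>2 \<le> ((1 + 2 * B) / 2)\<^sup>2 * ((pi * \<epsilon> + K * enn2real (slice \<phi> u) / \<epsilon>) / 2)\<^sup>2"
      unfolding power_mult_distrib[symmetric] E_def[symmetric] by (intro power_mono) auto
  qed (use K_ge_1 in auto)
  also have "\<dots> \<le> ((1 + 2 * B) / 2)\<^sup>2 * (pi * K * (cap_area \<phi> 0 * h powr (1 / \<kappa>) / ln 2))"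
    using K_ge_1 by (intro mult_left_mono order_trans[OF G] divide_right_mono decay) auto
  finally show ?thesis by (simp add: \<phi>_def)
qed

end

section \<open>The Poisson integral and its derivatives\<close>

text \<open>The complex derivative of \<open>herglotz F\<close>. For boundary values \<open>F\<close> it is the derivative of the Poisson
integral with respect to \<open>z\<close>.\<close>

definition kernel_transform :: "(real \<Rightarrow> complex) \<Rightarrow> complex \<Rightarrow> complex" where
  "kernel_transform F z = 1 / (2 * pi) * integral {0..2*pi} (\<lambda>x. cis x / (cis x - z)\<^sup>2 * F x)"

text \<open>Half the usual Herglotz integral, so that the Poisson integral of a complex function \<open>F\<close> is the sum of
\<open>herglotz F\<close> and the conjugate of \<open>herglotz\<close> of the conjugate of \<open>F\<close>.\<close>

definition herglotz :: "(real \<Rightarrow> complex) \<Rightarrow> complex \<Rightarrow> complex" where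
  "herglotz F z = 1 / (4 * pi) * integral {0..2*pi} (\<lambda>x. (cis x + z) / (cis x - z) * F x)"

lemma cis_minus_nonzero: "cmod z < 1 \<Longrightarrow> cis x - z \<noteq> 0"
  by (metis eq_iff_diff_eq_0 less_irrefl norm_cis)

lemma poisson_kernel_eq:
  assumes z: "cmod z < 1"
  shows "poisson_kernel (cmod z) (x - Arg z) = Re ((cis x + z) / (cis x - z)) / (2 * pi)"
proof -
  define r \<alpha> where "r = cmod z" and "\<alpha> = Arg z"
  have z': "z = of_real r * cis \<alpha>" using rcis_cmod_Arg[of z] by (simp add: r_def \<alpha>_def rcis_def)
  have sq: "sin x * sin x = 1 - cos x * cos x" "sin \<alpha> * sin \<alpha> = 1 - cos \<alpha> * cos \<alpha>"
    using sin_squared_eq[of x] sin_squared_eq[of \<alpha>] by (simp_all add: power2_eq_square)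
  have d: "(cmod (cis x - z))\<^sup>2 = 1 - 2 * r * cos (x - \<alpha>) + r\<^sup>2"
    unfolding z' cmod_power2 cos_diff by (simp add: power2_eq_square algebra_simps sq)
  have n: "Re ((cis x + z) * cnj (cis x - z)) = 1 - r\<^sup>2"
  proof -
    have "Re ((cis x + z) * cnj (cis x - z)) = (cmod (cis x))\<^sup>2 - (cmod z)\<^sup>2"
      unfolding cmod_power2 by (simp add: power2_eq_square algebra_simps)
    then show ?thesis by (simp add: r_def)
  qed
  have "(cis x + z) / (cis x - z) = (cis x + z) * cnj (cis x - z) / of_real ((cmod (cis x - z))\<^sup>2)"
    by (subst complex_div_cnj) simp
  then have "Re ((cis x + z) / (cis x - z)) = (1 - r\<^sup>2) / (1 - 2 * r * cos (x - \<alpha>) + r\<^sup>2)"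
    by (simp only: Re_divide_of_real n d)
  then show ?thesis by (simp add: poisson_kernel_def r_def \<alpha>_def field_simps)
qed

lemma herglotz_integrable:
  assumes F: "continuous_on {0..2*pi} F" and z: "cmod z < 1"
  shows "(\<lambda>x. (cis x + z) / (cis x - z) * F x) integrable_on {0..2*pi}"
  using cis_minus_nonzero[OF z] by (intro integrable_continuous_real continuous_intros F) auto

lemma kernel_integrable:
  assumes F: "continuous_on {0..2*pi} F" and z: "cmod z < 1"
  shows "(\<lambda>x. cis x / (cis x - z)\<^sup>2 * F x) integrable_on {0..2*pi}"
  using cis_minus_nonzero[OF z] by (intro integrable_continuous_real continuous_intros F) auto

lemma herglotz_deriv:
  assumes F: "continuous_on {0..2*pi} F" and z: "z \<in> ball 0 1"
  shows "(herglotz F has_field_derivative kernel_transform F z) (at z)"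
proof -
  have ne: "cis x - z \<noteq> 0" if "z \<in> ball 0 1" for z x using that by (intro cis_minus_nonzero) auto
  have "((\<lambda>z. integral (cbox 0 (2*pi)) (\<lambda>x. (cis x + z) / (cis x - z) * F x)) has_field_derivative
      integral (cbox 0 (2*pi)) (\<lambda>x. 2 * cis x / (cis x - z)\<^sup>2 * F x)) (at z within ball 0 1)"
  proof (rule leibniz_rule_field_derivative)
    fix z :: complex and x :: real assume "z \<in> ball 0 1" "x \<in> cbox 0 (2*pi)"
    then show "((\<lambda>z. (cis x + z) / (cis x - z) * F x) has_field_derivative 2 * cis x / (cis x - z)\<^sup>2 * F x) (at z within ball 0 1)"
      using ne[of z x] by (auto intro!: derivative_eq_intros simp: power2_eq_square field_simps)
  next
    fix z :: complex assume "z \<in> ball 0 1"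
    then show "(\<lambda>x. (cis x + z) / (cis x - z) * F x) integrable_on cbox 0 (2*pi)"
      using herglotz_integrable[OF F, of z] by simp
  next
    show "continuous_on (ball 0 1 \<times> cbox 0 (2*pi)) (\<lambda>(z, x). 2 * cis x / (cis x - z)\<^sup>2 * F x)"
      unfolding case_prod_unfold using ne
      by (intro continuous_intros continuous_on_compose2[OF F]) auto
  qed (use z in auto)
  then have "((\<lambda>z. 1 / (4 * pi) * integral {0..2*pi} (\<lambda>x. (cis x + z) / (cis x - z) * F x)) has_field_derivative
      1 / (4 * pi) * integral {0..2*pi} (\<lambda>x. 2 * (cis x / (cis x - z)\<^sup>2 * F x))) (at z within ball 0 1)"
    by (intro DERIV_cmult) (simp add: mult.assoc)
  then have "(herglotz F has_field_derivative kernel_transform F z) (at z within ball 0 1)"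
    unfolding herglotz_def[abs_def] kernel_transform_def integral_mult_right by simp
  then show ?thesis using z at_within_open[OF z] by simp
qed

lemma kernel_transform_holomorphic:
  assumes F: "continuous_on {0..2*pi} F"
  shows "kernel_transform F holomorphic_on ball 0 1"
proof -
  have "herglotz F holomorphic_on ball 0 1"
    using herglotz_deriv[OF F] by (auto intro!: holomorphic_onI simp: field_differentiable_def intro: field_differentiable_at_within)
      (meson DERIV_subset field_differentiable_def subset_UNIV)
  then have "deriv (herglotz F) holomorphic_on ball 0 1" by (rule holomorphic_deriv) auto
  then show ?thesis
    by (rule holomorphic_transform) (use herglotz_deriv[OF F] in \<open>auto intro: DERIV_imp_deriv\<close>)
qed

lemma poisson_integral_split:
  assumes F: "continuous_on {0..2*pi} F" and z: "cmod z < 1"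
  shows "integral {0..2*pi} (\<lambda>x. poisson_kernel (cmod z) (x - Arg z) *\<^sub>R F x) =
    herglotz F z + cnj (herglotz (\<lambda>x. cnj (F x)) z)"
proof -
  define k where "k x = (cis x + z) / (cis x - z)" for x
  have i1: "((\<lambda>x. k x * F x) has_integral integral {0..2*pi} (\<lambda>x. k x * F x)) {0..2*pi}"
    unfolding k_def by (intro integrable_integral herglotz_integrable F z)
  have "((\<lambda>x. k x * cnj (F x)) has_integral integral {0..2*pi} (\<lambda>x. k x * cnj (F x))) {0..2*pi}"
    unfolding k_def by (intro integrable_integral herglotz_integrable continuous_intros F z)
  then have i2: "((\<lambda>x. cnj (k x * cnj (F x))) has_integral cnj (integral {0..2*pi} (\<lambda>x. k x * cnj (F x)))) {0..2*pi}"
    using has_integral_cnj[of "\<lambda>x. k x * cnj (F x)"] by (simp only: o_def)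
  have eq: "poisson_kernel (cmod z) (x - Arg z) *\<^sub>R F x = 1 / (4 * pi) * (k x * F x + cnj (k x * cnj (F x)))" for x
    unfolding poisson_kernel_eq[OF z] k_def[symmetric] by (simp add: complex_eq_iff field_simps)
  have "((\<lambda>x. poisson_kernel (cmod z) (x - Arg z) *\<^sub>R F x) has_integral
     1 / (4 * pi) * (integral {0..2*pi} (\<lambda>x. k x * F x) + cnj (integral {0..2*pi} (\<lambda>x. k x * cnj (F x))))) {0..2*pi}"
    unfolding eq by (intro has_integral_mult_right has_integral_add i1 i2)
  then show ?thesis
    by (simp add: integral_unique herglotz_def k_def[symmetric] distrib_left)
qed

lemma poisson_integral_has_derivative:
  assumes F: "continuous_on {0..2*pi} F" and z: "z \<in> ball 0 1"
    and w: "\<And>z. z \<in> ball 0 1 \<Longrightarrow> w z = integral {0..2*pi} (\<lambda>x. poisson_kernel (cmod z) (x - Arg z) *\<^sub>R F x)"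
  shows "(w has_derivative (\<lambda>h. kernel_transform F z * h + cnj (kernel_transform (\<lambda>x. cnj (F x)) z * h))) (at z)"
proof -
  have F': "continuous_on {0..2*pi} (\<lambda>x. cnj (F x))" by (intro continuous_intros F)
  have "((\<lambda>z. herglotz F z + cnj (herglotz (\<lambda>x. cnj (F x)) z)) has_derivative
     (\<lambda>h. kernel_transform F z * h + cnj (kernel_transform (\<lambda>x. cnj (F x)) z * h))) (at z)"
    using herglotz_deriv[OF F z] herglotz_deriv[OF F' z] unfolding has_field_derivative_def
    by (intro has_derivative_add bounded_linear.has_derivative[OF bounded_linear_cnj]) auto
  then show ?thesis
    by (rule has_derivative_transform_within_open[OF _ open_ball z])
       (use z in \<open>auto simp: w poisson_integral_split[OF F]\<close>)
qed

text \<open>The integrand is the derivative of the periodic function \<open>\<i> / (cis x - z)\<close>.\<close>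

lemma kernel_integral_zero:
  assumes z: "cmod z < 1"
  shows "integral {0..2*pi} (\<lambda>x. cis x / (cis x - z)\<^sup>2) = 0"
proof -
  have "((\<lambda>x. cis x / (cis x - z)\<^sup>2) has_integral \<i> / (cis (2 * pi) - z) - \<i> / (cis 0 - z)) {0..2*pi}"
  proof (rule fundamental_theorem_of_calculus)
    fix x :: real
    have "((\<lambda>\<zeta>. \<i> / (exp (\<i> * \<zeta>) - z)) has_field_derivative cis x / (cis x - z)\<^sup>2) (at (of_real x))"
      using cis_minus_nonzero[OF z, of x]
      by (auto intro!: derivative_eq_intros simp: cis_conv_exp power2_eq_square field_simps)
    then have "((\<lambda>x. \<i> / (exp (\<i> * of_real x) - z)) has_vector_derivative cis x / (cis x - z)\<^sup>2) (at x within {0..2*pi})"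
      by (rule has_vector_derivative_real_field[THEN has_vector_derivative_at_within])
    then show "((\<lambda>x. \<i> / (cis x - z)) has_vector_derivative cis x / (cis x - z)\<^sup>2) (at x within {0..2*pi})"
      by (simp add: cis_conv_exp)
  qed simp
  then show ?thesis by (simp add: integral_unique)
qed

text \<open>For a unit vector \<open>N\<close> the combination \<open>cnj N * p + N * q\<close> is the complex derivative of the holomorphic
function whose real part is the component of the mapping in direction \<open>N\<close>; its modulus is at least
\<open>\<bar>\<bar>p\<bar> - \<bar>q\<bar>\<bar>\<close>. The constant \<open>c\<close> can be subtracted because the kernel has mean zero.\<close>

lemma kernel_transform_normal:
  assumes F: "continuous_on {0..2*pi} F" and z: "cmod z < 1" and N: "cmod N = 1"
  shows "\<bar>cmod (kernel_transform F z) - cmod (kernel_transform (\<lambda>x. cnj (F x)) z)\<bar>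
    \<le> 1 / pi * integral {0..2*pi} (\<lambda>x. \<bar>(F x - c) \<bullet> N\<bar> / (cmod (cis x - z))\<^sup>2)"
proof -
  define k where "k x = cis x / (cis x - z)\<^sup>2" for x
  define u where "u x = (F x - c) \<bullet> N" for x
  have F': "continuous_on {0..2*pi} (\<lambda>x. cnj (F x))" by (intro continuous_intros F)
  have i1: "((\<lambda>x. k x * F x) has_integral integral {0..2*pi} (\<lambda>x. k x * F x)) {0..2*pi}"
    unfolding k_def by (intro integrable_integral kernel_integrable F z)
  have i2: "((\<lambda>x. k x * cnj (F x)) has_integral integral {0..2*pi} (\<lambda>x. k x * cnj (F x))) {0..2*pi}"
    unfolding k_def by (intro integrable_integral kernel_integrable F' z)
  have i3: "(k has_integral 0) {0..2*pi}"
  proof -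
    have "k integrable_on {0..2*pi}"
      unfolding k_def using kernel_integrable[of "\<lambda>_. 1" z] z by (simp add: continuous_on_const)
    then have "(k has_integral integral {0..2*pi} k) {0..2*pi}" by (rule integrable_integral)
    moreover have "integral {0..2*pi} k = 0" unfolding k_def by (rule kernel_integral_zero[OF z])
    ultimately show ?thesis by simp
  qed
  have eq: "2 * (k x * of_real (u x)) = cnj N * (k x * F x) + N * (k x * cnj (F x)) - k x * (2 * of_real (c \<bullet> N))" for x
  proof -
    have "2 * of_real (u x) = cnj N * F x + N * cnj (F x) - (2 * of_real (c \<bullet> N) :: complex)"
      by (simp add: u_def complex_eq_iff inner_complex_def algebra_simps)
    then have "k x * (2 * of_real (u x)) = k x * (cnj N * F x + N * cnj (F x) - 2 * of_real (c \<bullet> N))" by simp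
    then show ?thesis by (simp add: algebra_simps)
  qed
  have hi: "((\<lambda>x. 2 * (k x * of_real (u x))) has_integral
      (cnj N * integral {0..2*pi} (\<lambda>x. k x * F x) + N * integral {0..2*pi} (\<lambda>x. k x * cnj (F x)) - 0 * (2 * of_real (c \<bullet> N)))) {0..2*pi}"
    unfolding eq by (intro has_integral_diff has_integral_add has_integral_mult_right has_integral_mult_left i1 i2 i3)
  have "cnj N * kernel_transform F z + N * kernel_transform (\<lambda>x. cnj (F x)) z
     = 1 / (2 * pi) * integral {0..2*pi} (\<lambda>x. 2 * (k x * of_real (u x)))"
    using integral_unique[OF hi] by (simp add: kernel_transform_def k_def algebra_simps)
  also have "\<dots> = 1 / pi * integral {0..2*pi} (\<lambda>x. k x * of_real (u x))"
    by (simp only: integral_mult_right) simp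
  finally have T: "cnj N * kernel_transform F z + N * kernel_transform (\<lambda>x. cnj (F x)) z
     = 1 / pi * integral {0..2*pi} (\<lambda>x. k x * of_real (u x))" .
  have "\<bar>cmod (kernel_transform F z) - cmod (kernel_transform (\<lambda>x. cnj (F x)) z)\<bar>
     \<le> cmod (cnj N * kernel_transform F z + N * kernel_transform (\<lambda>x. cnj (F x)) z)"
    using norm_triangle_ineq3[of "cnj N * kernel_transform F z" "- (N * kernel_transform (\<lambda>x. cnj (F x)) z)"] N
    by (simp add: norm_mult)
  also have "\<dots> = 1 / pi * cmod (integral {0..2*pi} (\<lambda>x. k x * of_real (u x)))"
    unfolding T by (simp add: norm_mult norm_divide)
  also have "cmod (integral {0..2*pi} (\<lambda>x. k x * of_real (u x))) \<le> integral {0..2*pi} (\<lambda>x. \<bar>u x\<bar> / (cmod (cis x - z))\<^sup>2)"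
  proof (rule integral_norm_bound_integral)
    have cu: "continuous_on {0..2*pi} u" unfolding u_def by (intro continuous_intros F)
    show "(\<lambda>x. k x * of_real (u x)) integrable_on {0..2*pi}"
      unfolding k_def using z by (intro kernel_integrable continuous_intros cu) auto
    show "(\<lambda>x. \<bar>u x\<bar> / (cmod (cis x - z))\<^sup>2) integrable_on {0..2*pi}"
      using cis_minus_nonzero[OF z] by (intro integrable_continuous_real continuous_intros cu) auto
    show "cmod (k x * of_real (u x)) \<le> \<bar>u x\<bar> / (cmod (cis x - z))\<^sup>2" for x
      by (simp add: k_def norm_mult norm_divide norm_power)
  qed
  finally show ?thesis by (simp add: u_def mult_left_mono divide_right_mono)
qed

lemma integral_periodic_shift:
  fixes h :: "real \<Rightarrow> real"
  assumes h: "continuous_on UNIV h" and per: "\<And>x. h (x + T) = h x" and a: "0 \<le> a" "a \<le> T"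
  shows "integral {0..T} h = integral {a..a + T} h"
proof -
  have i: "h integrable_on {x..y}" for x y
    using h by (intro integrable_continuous_real) (auto intro: continuous_on_subset)
  have "integral {T..a + T} h = integral {0..a} (\<lambda>x. h (x + T))"
    using integral_shift_Icc_real[of 0 a h T] by (simp add: o_def add.commute)
  then have eq: "integral {T..a + T} h = integral {0..a} h" by (simp add: per)
  have "integral {0..T} h = integral {0..a} h + integral {a..T} h"
    using a i by (simp add: Henstock_Kurzweil_Integration.integral_combine)
  moreover have "integral {a..a + T} h = integral {a..T} h + integral {T..a + T} h"
    using a i by (simp add: Henstock_Kurzweil_Integration.integral_combine)
  ultimately show ?thesis using eq by simp
qed

lemma kernel_transform_normal_centred:
  assumes F: "continuous_on UNIV F" and per: "\<And>x. F (x + 2 * pi) = F x" and r: "0 \<le> r" "r < 1"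
    and \<phi>: "pi \<le> \<phi>" "\<phi> \<le> 3 * pi" and N: "cmod N = 1"
  defines "z \<equiv> of_real r * cis \<phi>"
  shows "\<bar>cmod (kernel_transform F z) - cmod (kernel_transform (\<lambda>x. cnj (F x)) z)\<bar>
    \<le> 1 / pi * integral {-pi..pi} (\<lambda>x. \<bar>(F (\<phi> + x) - c) \<bullet> N\<bar> / (cmod (cis x - of_real r))\<^sup>2)"
proof -
  define h where "h x = \<bar>(F x - c) \<bullet> N\<bar> / (cmod (cis x - z))\<^sup>2" for x
  have z: "cmod z < 1" using r by (simp add: z_def norm_mult)
  have ch: "continuous_on UNIV h"
    unfolding h_def using cis_minus_nonzero[OF z] by (intro continuous_intros F) auto
  have ph: "h (x + 2 * pi) = h x" for x by (simp add: h_def per cis_mult[symmetric])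
  have F2: "continuous_on {0..2*pi} F" using F by (rule continuous_on_subset) auto
  have "integral {0..2*pi} h = integral {\<phi> - pi..\<phi> - pi + 2 * pi} h"
    using \<phi> by (intro integral_periodic_shift ch ph) auto
  also have "\<dots> = integral {-pi..pi} (\<lambda>x. h (\<phi> + x))"
    using integral_shift_Icc_real[of "-pi" pi h \<phi>] by (simp add: o_def algebra_simps)
  also have "(\<lambda>x. h (\<phi> + x)) = (\<lambda>x. \<bar>(F (\<phi> + x) - c) \<bullet> N\<bar> / (cmod (cis x - of_real r))\<^sup>2)"
  proof
    fix x
    have "cis (\<phi> + x) - z = cis \<phi> * (cis x - of_real r)" by (simp add: z_def cis_mult[symmetric] algebra_simps)
    then have "cmod (cis (\<phi> + x) - z) = cmod (cis x - of_real r)" by (simp add: norm_mult)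
    then show "h (\<phi> + x) = \<bar>(F (\<phi> + x) - c) \<bullet> N\<bar> / (cmod (cis x - of_real r))\<^sup>2" by (simp add: h_def)
  qed
  finally show ?thesis
    using kernel_transform_normal[OF F2 z N, of c] by (simp add: h_def)
qed

text \<open>The inequality holds almost everywhere, and both sides are continuous.\<close>

lemma quasiconformal_dilatation:
  assumes qc: "quasiconformal K (ball 0 1) \<Omega> w"
    and der: "\<And>z. z \<in> ball 0 1 \<Longrightarrow> (w has_derivative (\<lambda>h. p z * h + cnj (q z * h))) (at z)"
    and cont: "continuous_on (ball 0 1) p" "continuous_on (ball 0 1) q" and z: "z \<in> ball 0 1"
  shows "cmod (p z) + cmod (q z) \<le> K * \<bar>cmod (p z) - cmod (q z)\<bar>"
proof (rule ccontr)
  assume no: "\<not> ?thesis"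
  define U where "U = {z \<in> ball 0 1. K * \<bar>cmod (p z) - cmod (q z)\<bar> < cmod (p z) + cmod (q z)}"
  have pq: "d_z w z = p z" "d_zbar w z = cnj (q z)" if z: "z \<in> ball 0 1" for z
  proof -
    have *: "vector_derivative (\<lambda>t. w (z + e * of_real t)) (at 0) = p z * e + cnj (q z * e)" for e
    proof -
      have "((\<lambda>t::real. z + e * of_real t) has_derivative (\<lambda>h. e * of_real h)) (at 0)"
        by (auto intro!: derivative_eq_intros)
      moreover have "(w has_derivative (\<lambda>h. p z * h + cnj (q z * h))) (at (z + e * of_real 0))"
        using der[OF z] by simp
      ultimately have "((\<lambda>t. w (z + e * of_real t)) has_derivative (\<lambda>h. p z * (e * of_real h) + cnj (q z * (e * of_real h)))) (at 0)"
        by (rule has_derivative_compose)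
      then have "((\<lambda>t. w (z + e * of_real t)) has_vector_derivative (p z * e + cnj (q z * e))) (at 0)"
        unfolding has_vector_derivative_def
        by (rule has_derivative_eq_rhs) (simp add: fun_eq_iff scaleR_conv_of_real algebra_simps)
      then show ?thesis by (rule vector_derivative_at)
    qed
    have dx: "dx w z = p z + cnj (q z)" using *[of 1] by (simp add: dx_def)
    have dy: "dy w z = \<i> * p z - \<i> * cnj (q z)" using *[of \<i>] by (simp add: dy_def algebra_simps)
    show "d_z w z = p z" "d_zbar w z = cnj (q z)"
      unfolding d_z_def d_zbar_def dx dy by (simp_all add: field_simps)
  qed
  have "open U"
  proof -
    have c: "continuous_on (ball 0 1) (\<lambda>z. cmod (p z) + cmod (q z) - K * \<bar>cmod (p z) - cmod (q z)\<bar>)"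
      by (intro continuous_intros cont)
    have "U = ball 0 1 \<inter> (\<lambda>z. cmod (p z) + cmod (q z) - K * \<bar>cmod (p z) - cmod (q z)\<bar>) -` {0<..}"
      by (auto simp: U_def)
    then show ?thesis using continuous_open_preimage[OF c open_ball open_greaterThan] by simp
  qed
  moreover have "z \<in> U" using no z by (auto simp: U_def)
  ultimately have "\<not> negligible U" using open_not_negligible by blast
  moreover have "negligible U"
  proof -
    have "AE z in lebesgue. z \<in> ball 0 1 \<longrightarrow>
        cmod (d_z w z) + cmod (d_zbar w z) \<le> K * \<bar>cmod (d_z w z) - cmod (d_zbar w z)\<bar>"
      using qc by (simp add: quasiconformal_def)
    then have "AE z in lebesgue. z \<notin> U"
      by (rule eventually_mono) (auto simp: U_def pq)
    then show ?thesis
      using \<open>open U\<close> by (simp add: negligible_iff_null_sets AE_iff_null_sets[symmetric] lborelD borel_open sets_completionI_sets)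
  qed
  ultimately show False by simp
qed

section \<open>From Hoelder to Lipschitz\<close>

lemma sin_lower: "0 \<le> x \<Longrightarrow> x - x ^ 3 / 6 \<le> sin (x::real)"
proof -
  assume x: "0 \<le> x"
  have "sin 0 - (0 - 0 ^ 3 / 6) \<le> sin x - (x - x ^ 3 / 6)"
  proof (rule DERIV_nonneg_imp_nondecreasing[OF x])
    fix y :: real assume "0 \<le> y" "y \<le> x"
    have "1 - cos y = 2 * (sin (y / 2))\<^sup>2" using cos_double_sin[of "y / 2"] by simp
    also have "\<dots> \<le> 2 * (y / 2)\<^sup>2"
      using power_mono[OF abs_sin_x_le_abs_x[of "y / 2"], of 2] by (simp del: abs_divide)
    finally have "0 \<le> cos y - (1 - y\<^sup>2 / 2)" by (simp add: power2_eq_square)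
    moreover have "((\<lambda>x. sin x - (x - x ^ 3 / 6)) has_real_derivative cos y - (1 - y\<^sup>2 / 2)) (at y)"
      by (auto intro!: derivative_eq_intros simp: power2_eq_square)
    ultimately show "\<exists>D. ((\<lambda>x. sin x - (x - x ^ 3 / 6)) has_real_derivative D) (at y) \<and> 0 \<le> D" by blast
  qed
  then show ?thesis by simp
qed

lemma norm_cis_minus_real: "(cmod (cis x - of_real r))\<^sup>2 = (1 - r)\<^sup>2 + 4 * r * (sin (x / 2))\<^sup>2"
proof -
  have c: "cos x = 1 - 2 * (sin (x / 2))\<^sup>2" using cos_double_sin[of "x / 2"] by simp
  have "cis x - of_real r = cis x * (1 - of_real r * cis (- x))" by (simp add: algebra_simps cis_mult)
  then have "cmod (cis x - of_real r) = cmod (1 - of_real r * cis (- x))" by (simp add: norm_mult)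
  then have n: "(cmod (cis x - of_real r))\<^sup>2 = 1 - 2 * r * cos x + r\<^sup>2"
    using norm_one_minus[of r "- x"] by simp
  show ?thesis unfolding n c by (simp add: power2_eq_square algebra_simps)
qed

lemma norm_cis_minus_real_ge:
  assumes r: "1 / 2 \<le> r" and x: "\<bar>x\<bar> \<le> pi"
  shows "(1 - r)\<^sup>2 \<le> (cmod (cis x - of_real r))\<^sup>2" "x\<^sup>2 / 8 \<le> (cmod (cis x - of_real r))\<^sup>2"
proof -
  show "(1 - r)\<^sup>2 \<le> (cmod (cis x - of_real r))\<^sup>2" using r by (simp add: norm_cis_minus_real)
  define u where "u = \<bar>x\<bar> / 2"
  have u: "0 \<le> u" "u \<le> 1.6" using x pi_less_4 pi_approx by (auto simp: u_def)
  have "u / 2 \<le> u * (1 - u\<^sup>2 / 6)"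
  proof -
    have "u\<^sup>2 \<le> 1.6\<^sup>2" using u by (intro power_mono) auto
    then have "1 / 2 \<le> 1 - u\<^sup>2 / 6" by (simp add: power2_eq_square)
    then show ?thesis using mult_left_mono[of "1/2" "1 - u\<^sup>2 / 6" u] u by simp
  qed
  also have "\<dots> \<le> sin u" using sin_lower[OF u(1)] by (simp add: power3_eq_cube power2_eq_square algebra_simps)
  finally have "(u / 2)\<^sup>2 \<le> (sin u)\<^sup>2" using u by (intro power_mono) auto
  moreover have "(sin (x / 2))\<^sup>2 = (sin u)\<^sup>2" by (cases "0 \<le> x") (auto simp: u_def)
  ultimately have "x\<^sup>2 / 16 \<le> (sin (x / 2))\<^sup>2" by (simp add: u_def power_divide)
  then have "2 * (x\<^sup>2 / 16) \<le> 4 * r * (sin (x / 2))\<^sup>2" using r by (intro mult_mono) auto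
  then show "x\<^sup>2 / 8 \<le> (cmod (cis x - of_real r))\<^sup>2" by (simp add: norm_cis_minus_real add_increasing)
qed

lemma has_integral_abs_powr:
  fixes a :: real
  assumes a: "-1 < a"
  shows "((\<lambda>x. \<bar>x\<bar> powr a) has_integral 2 * (pi powr (a + 1) / (a + 1))) {-pi..pi}"
proof -
  have 1: "((\<lambda>x. \<bar>x\<bar> powr a) has_integral pi powr (a + 1) / (a + 1)) {0..pi}"
    using has_integral_powr_from_0[OF a, of pi] by (rule has_integral_eq[rotated]) auto
  then have "((\<lambda>x. \<bar>x\<bar> powr a) has_integral pi powr (a + 1) / (a + 1)) {-pi..0}"
    using has_integral_reflect_real[of "\<lambda>x. \<bar>x\<bar> powr a" _ pi 0] by simp
  from has_integral_combine[OF _ _ this 1] show ?thesis by simp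
qed

text \<open>All that the gradient estimates need to know about the boundary curve: its points at distance \<open>d\<close>
along the curve deviate from the tangent by \<open>C * d powr (1 + \<mu>)\<close>, and \<open>d\<close> is bounded by the chord and
by the Lipschitz constants of the boundary map.\<close>

locale flat_boundary_map = disc_map w "kernel_transform (disc_homeo.bdry w)" "kernel_transform (\<lambda>x. cnj (disc_homeo.bdry w x))" K
  for w :: "complex \<Rightarrow> complex" and K +
  fixes C B \<mu> :: real
  assumes C_nonneg: "0 \<le> C" and B_pos: "0 < B" and \<mu>_pos: "0 < \<mu>"
    and flat: "\<And>y. \<exists>N. cmod N = 1 \<and> (\<forall>x. \<exists>d\<ge>0. \<bar>(bdry x - bdry y) \<bullet> N\<bar> \<le> C * d powr (1 + \<mu>) \<and>
        d \<le> B * cmod (bdry x - bdry y) \<and>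
        (\<forall>M. (\<forall>x y. cmod (bdry x - bdry y) \<le> M * \<bar>x - y\<bar>) \<longrightarrow> d \<le> M * \<bar>x - y\<bar>))"
begin

abbreviation "p \<equiv> kernel_transform bdry"
abbreviation "q \<equiv> kernel_transform (\<lambda>x. cnj (bdry x))"

text \<open>The operator norm of the derivative of \<open>w\<close>.\<close>

definition stretch :: "complex \<Rightarrow> real" where "stretch z = cmod (p z) + cmod (q z)"

lemma stretch_bound:
  assumes e: "\<And>y x d. \<bar>x\<bar> \<le> pi \<Longrightarrow> 0 \<le> d \<Longrightarrow> d \<le> B * cmod (bdry (y + x) - bdry y) \<Longrightarrow>
       (\<forall>M. (\<forall>x y. cmod (bdry x - bdry y) \<le> M * \<bar>x - y\<bar>) \<longrightarrow> d \<le> M * \<bar>x\<bar>) \<Longrightarrow>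
       C * d powr (1 + \<mu>) / (cmod (cis x - of_real r))\<^sup>2 \<le> e x"
    and I: "(e has_integral I) {-pi..pi}" and r: "0 \<le> r" "r < 1" and z: "cmod z = r"
  shows "stretch z \<le> K / pi * I"
proof -
  \<comment> \<open>With this choice of the argument, the period \<open>{\<phi> - pi..\<phi> + pi}\<close> starts in \<open>{0..2 * pi}\<close>.\<close>
  define \<phi> where "\<phi> = Arg z + 2 * pi"
  have \<phi>: "pi \<le> \<phi>" "\<phi> \<le> 3 * pi" using mpi_less_Arg[of z] Arg_le_pi[of z] by (auto simp: \<phi>_def)
  have "cis \<phi> = cis (Arg z)" by (simp add: \<phi>_def cis_mult[symmetric])
  then have zeq: "z = of_real r * cis \<phi>" using rcis_cmod_Arg[of z] z by (simp add: rcis_def)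
  obtain N where N: "cmod N = 1" and d: "\<And>x. \<exists>d\<ge>0. \<bar>(bdry x - bdry \<phi>) \<bullet> N\<bar> \<le> C * d powr (1 + \<mu>) \<and>
        d \<le> B * cmod (bdry x - bdry \<phi>) \<and>
        (\<forall>M. (\<forall>x y. cmod (bdry x - bdry y) \<le> M * \<bar>x - y\<bar>) \<longrightarrow> d \<le> M * \<bar>x - \<phi>\<bar>)"
    using flat[of \<phi>] by blast
  have zb: "z \<in> ball 0 1" using z r by simp
  have "stretch z \<le> K * \<bar>cmod (p z) - cmod (q z)\<bar>"
    unfolding stretch_def by (rule dilatation[OF zb])
  also have "\<bar>cmod (p z) - cmod (q z)\<bar>
     \<le> 1 / pi * integral {-pi..pi} (\<lambda>x. \<bar>(bdry (\<phi> + x) - bdry \<phi>) \<bullet> N\<bar> / (cmod (cis x - of_real r))\<^sup>2)"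
    unfolding zeq by (intro kernel_transform_normal_centred cont_bdry bdry_periodic r \<phi> N)
  also have "integral {-pi..pi} (\<lambda>x. \<bar>(bdry (\<phi> + x) - bdry \<phi>) \<bullet> N\<bar> / (cmod (cis x - of_real r))\<^sup>2) \<le> I"
  proof (rule has_integral_le[OF integrable_integral I])
    have "cis x - of_real r \<noteq> 0" for x using cis_minus_nonzero[of "of_real r" x] r by simp
    then show "(\<lambda>x. \<bar>(bdry (\<phi> + x) - bdry \<phi>) \<bullet> N\<bar> / (cmod (cis x - of_real r))\<^sup>2) integrable_on {-pi..pi}"
      by (intro integrable_continuous_real continuous_intros continuous_on_compose2[OF cont_bdry[of UNIV]]) auto
    fix x assume x: "x \<in> {-pi..pi}"
    obtain d where d: "0 \<le> d" "\<bar>(bdry (\<phi> + x) - bdry \<phi>) \<bullet> N\<bar> \<le> C * d powr (1 + \<mu>)"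
        "d \<le> B * cmod (bdry (\<phi> + x) - bdry \<phi>)"
        "\<forall>M. (\<forall>x y. cmod (bdry x - bdry y) \<le> M * \<bar>x - y\<bar>) \<longrightarrow> d \<le> M * \<bar>x\<bar>"
      using d[of "\<phi> + x"] by auto
    have "\<bar>(bdry (\<phi> + x) - bdry \<phi>) \<bullet> N\<bar> / (cmod (cis x - of_real r))\<^sup>2
        \<le> C * d powr (1 + \<mu>) / (cmod (cis x - of_real r))\<^sup>2"
      using d(2) by (intro divide_right_mono) auto
    also have "\<dots> \<le> e x" using e[of x d \<phi>] d x by auto
    finally show "\<bar>(bdry (\<phi> + x) - bdry \<phi>) \<bullet> N\<bar> / (cmod (cis x - of_real r))\<^sup>2 \<le> e x" .
  qed
  finally show ?thesis using K_ge_1 by (simp add: mult_left_mono divide_right_mono)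
qed

lemma curve_deriv:
  assumes "c t \<in> ball 0 1" and c: "(c has_vector_derivative c') (at t)"
  shows "\<exists>D. ((\<lambda>t. w (c t)) has_vector_derivative D) (at t) \<and> cmod D \<le> stretch (c t) * cmod c'"
proof -
  have "((\<lambda>t. w (c t)) has_derivative (\<lambda>h. p (c t) * (h *\<^sub>R c') + cnj (q (c t) * (h *\<^sub>R c')))) (at t)"
    using has_derivative_compose[OF c[unfolded has_vector_derivative_def] deriv[OF assms(1)]] .
  then have "((\<lambda>t. w (c t)) has_vector_derivative (p (c t) * c' + cnj (q (c t) * c'))) (at t)"
    unfolding has_vector_derivative_def
    by (rule has_derivative_eq_rhs) (simp add: fun_eq_iff scaleR_conv_of_real algebra_simps)
  moreover have "cmod (p (c t) * c' + cnj (q (c t) * c')) \<le> stretch (c t) * cmod c'"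
    by (rule order_trans[OF norm_triangle_ineq]) (simp add: norm_mult stretch_def distrib_right)
  ultimately show ?thesis by blast
qed

lemma circle_lipschitz:
  assumes r: "0 \<le> r" "r < 1" and Q: "\<And>z. cmod z = r \<Longrightarrow> stretch z * r \<le> Q"
  shows "cmod (w (of_real r * cis x) - w (of_real r * cis y)) \<le> Q * \<bar>x - y\<bar>"
proof -
  have *: "cmod (w (of_real r * cis y) - w (of_real r * cis x)) \<le> Q * (y - x)" if "x < y" for x y
  proof -
    have d: "\<exists>D. ((\<lambda>t. w (of_real r * cis t)) has_vector_derivative D) (at t) \<and> cmod D \<le> Q" for t
    proof -
      have "((\<lambda>t. of_real r * cis t) has_vector_derivative (of_real r * (\<i> * cis t))) (at t)"
        unfolding cis_conv_exp
        by (auto intro!: derivative_eq_intros has_vector_derivative_real_field)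
      from curve_deriv[OF _ this] r obtain D where
        "((\<lambda>t. w (of_real r * cis t)) has_vector_derivative D) (at t)"
        "cmod D \<le> stretch (of_real r * cis t) * cmod (of_real r * (\<i> * cis t))"
        by (auto simp: norm_mult)
      then show ?thesis using Q[of "of_real r * cis t"] r by (intro exI[of _ D]) (auto simp: norm_mult)
    qed
    then obtain D where D: "\<And>t. ((\<lambda>t. w (of_real r * cis t)) has_vector_derivative D t) (at t)" "\<And>t. cmod (D t) \<le> Q"
      by metis
    have "cmod (w (of_real r * cis y) - w (of_real r * cis x)) \<le> Q * y - Q * x"
    proof (rule differentiable_bound_general[where f="\<lambda>t. w (of_real r * cis t)" and f'=D and \<phi>'="\<lambda>_. Q" and \<phi>="\<lambda>t. Q * t"])
      show "continuous_on {x..y} (\<lambda>t. w (of_real r * cis t))"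
        using D(1) by (meson continuous_at_imp_continuous_on has_vector_derivative_continuous)
      show "((*) Q has_vector_derivative Q) (at t)" for t
        unfolding has_real_derivative_iff_has_vector_derivative[symmetric] by (auto intro!: derivative_eq_intros)
    qed (use D that in \<open>auto intro!: continuous_intros\<close>)
    then show ?thesis by (simp add: algebra_simps)
  qed
  show ?thesis using *[of x y] *[of y x] by (cases x y rule: linorder_cases) (auto simp: norm_minus_commute)
qed

lemma radial_limit: "((\<lambda>r. w (of_real r * cis x)) \<longlongrightarrow> bdry x) (at_left 1)"
proof -
  have "continuous_on {0..1::real} (\<lambda>t. w (of_real t * cis x))"
    by (intro continuous_on_compose2[OF cont] continuous_intros) (auto simp: norm_mult)
  then have "((\<lambda>t. w (of_real t * cis x)) \<longlongrightarrow> w (of_real 1 * cis x)) (at 1 within {0..1})"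
    unfolding continuous_on_def by (rule bspec) simp
  then show ?thesis by (simp add: at_within_Icc_at_left bdry_def)
qed

lemma bdry_lipschitz:
  assumes Q: "\<And>z. 1 / 2 \<le> cmod z \<Longrightarrow> cmod z < 1 \<Longrightarrow> stretch z * cmod z \<le> Q"
  shows "cmod (bdry x - bdry y) \<le> Q * \<bar>x - y\<bar>"
proof (rule tendsto_upperbound)
  show "((\<lambda>r. cmod (w (of_real r * cis x) - w (of_real r * cis y))) \<longlongrightarrow> cmod (bdry x - bdry y)) (at_left 1)"
    by (intro tendsto_intros radial_limit)
  have "eventually (\<lambda>r::real. 1 / 2 \<le> r \<and> r < 1) (at_left 1)"
    by (auto simp: eventually_at_left_field intro: exI[of _ "1 / 2"])
  then show "eventually (\<lambda>r. cmod (w (of_real r * cis x) - w (of_real r * cis y)) \<le> Q * \<bar>x - y\<bar>) (at_left 1)"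
    by eventually_elim (rule circle_lipschitz, use Q in auto)
qed simp

lemma radial_increment:
  assumes h: "0 < h" "h \<le> 1 / 2" and \<tau>: "0 \<le> \<tau>" "\<tau> < 1"
    and A: "\<And>z. 1 / 2 \<le> cmod z \<Longrightarrow> cmod z < 1 \<Longrightarrow> stretch z \<le> A * (1 - cmod z) powr (- \<tau>)"
  shows "cmod (bdry x - w (of_real (1 - h) * cis x)) \<le> A / (1 - \<tau>) * h powr (1 - \<tau>)"
proof -
  have d: "\<exists>D. ((\<lambda>t. w (of_real t * cis x)) has_vector_derivative D) (at t) \<and> cmod D \<le> A * (1 - t) powr (- \<tau>)"
    if t: "1 - h < t" "t < 1" for t
  proof -
    have n: "cmod (of_real t * cis x) = t" using t h by (simp add: norm_mult)
    have "((\<lambda>t. of_real t * cis x) has_vector_derivative (1 * cis x)) (at t)"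
      by (intro has_vector_derivative_mult_left has_vector_derivative_of_real) (auto intro!: derivative_eq_intros)
    from curve_deriv[OF _ this] n t obtain D where
      "((\<lambda>t. w (of_real t * cis x)) has_vector_derivative D) (at t)" "cmod D \<le> stretch (of_real t * cis x)"
      by auto
    then show ?thesis using A[of "of_real t * cis x"] n t h by (intro exI[of _ D]) auto
  qed
  then obtain D where D: "\<And>t. 1 - h < t \<Longrightarrow> t < 1 \<Longrightarrow> ((\<lambda>t. w (of_real t * cis x)) has_vector_derivative D t) (at t)"
     "\<And>t. 1 - h < t \<Longrightarrow> t < 1 \<Longrightarrow> cmod (D t) \<le> A * (1 - t) powr (- \<tau>)" by metis
  have "cmod (w (of_real 1 * cis x) - w (of_real (1 - h) * cis x))
     \<le> - (A / (1 - \<tau>) * (1 - 1) powr (1 - \<tau>)) - - (A / (1 - \<tau>) * (1 - (1 - h)) powr (1 - \<tau>))"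
  proof (rule differentiable_bound_general[where f="\<lambda>t. w (of_real t * cis x)" and f'=D
        and \<phi>="\<lambda>t. - (A / (1 - \<tau>) * (1 - t) powr (1 - \<tau>))" and \<phi>'="\<lambda>t. A * (1 - t) powr (- \<tau>)"])
    show "continuous_on {1 - h..1} (\<lambda>t. w (of_real t * cis x))"
      using h by (intro continuous_on_compose2[OF cont] continuous_intros) (auto simp: norm_mult)
    show "continuous_on {1 - h..1} (\<lambda>t. - (A / (1 - \<tau>) * (1 - t) powr (1 - \<tau>)))"
      using \<tau> by (intro continuous_intros continuous_on_powr') auto
    show "((\<lambda>t. - (A / (1 - \<tau>) * (1 - t) powr (1 - \<tau>))) has_vector_derivative A * (1 - t) powr (- \<tau>)) (at t)"
      if "1 - h < t" "t < 1" for t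
      unfolding has_real_derivative_iff_has_vector_derivative[symmetric] using that \<tau>
      by (auto intro!: derivative_eq_intros)
  qed (use D h in auto)
  then show ?thesis using \<tau> by (simp add: bdry_def)
qed

lemma A_nonneg_of_bound:
  assumes A: "\<And>z. 1 / 2 \<le> cmod z \<Longrightarrow> cmod z < 1 \<Longrightarrow> stretch z \<le> A * (1 - cmod z) powr (- \<tau>)"
  shows "0 \<le> A"
proof -
  have "0 \<le> stretch (1/2)" by (simp add: stretch_def)
  also have "\<dots> \<le> A * (1 / 2) powr (- \<tau>)" using A[of "1/2"] by simp
  finally show ?thesis by (simp add: zero_le_mult_iff)
qed

text \<open>The argument of Hardy and Littlewood: two boundary points at distance \<open>h\<close> are joined by two radial
segments of length \<open>h\<close> and an arc of the circle of radius \<open>1 - h\<close>.\<close>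

lemma bdry_holder_of_stretch:
  assumes \<tau>: "0 \<le> \<tau>" "\<tau> < 1"
    and A: "\<And>z. 1 / 2 \<le> cmod z \<Longrightarrow> cmod z < 1 \<Longrightarrow> stretch z \<le> A * (1 - cmod z) powr (- \<tau>)"
  shows "\<exists>A'. \<forall>x y. cmod (bdry x - bdry y) \<le> A' * \<bar>x - y\<bar> powr (1 - \<tau>)"
proof -
  have A0: "0 \<le> A" by (rule A_nonneg_of_bound[OF A])
  have "bounded (w ` cball 0 1)" by (intro compact_imp_bounded compact_continuous_image cont) auto
  then obtain S where "0 < S" "\<forall>y\<in>w ` cball 0 1. cmod y \<le> S" unfolding bounded_pos by blast
  then have S: "\<And>z. z \<in> cball 0 1 \<Longrightarrow> cmod (w z) \<le> S" "0 < S" by blast+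
  \<comment> \<open>The summands come from the radial segments, from the arc, and from pairs of points at distance above 1/2.\<close>
  define A' where "A' = 2 * (A / (1 - \<tau>)) + A + 4 * S"
  have A'0: "0 \<le> 2 * (A / (1 - \<tau>)) + A" using A0 \<tau> by simp
  have "cmod (bdry x - bdry y) \<le> A' * \<bar>x - y\<bar> powr (1 - \<tau>)" for x y
  proof -
    consider "x = y" | "0 < \<bar>x - y\<bar>" "\<bar>x - y\<bar> \<le> 1 / 2" | "1 / 2 < \<bar>x - y\<bar>" by force
    then show ?thesis
    proof cases
      case 1 then show ?thesis by simp
    next
      case 2
      define h where "h = \<bar>x - y\<bar>"
      have h: "0 < h" "h \<le> 1 / 2" using 2 by (auto simp: h_def)
      have "cmod (bdry x - bdry y) \<le> cmod (bdry x - w (of_real (1 - h) * cis x))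
          + cmod (w (of_real (1 - h) * cis x) - w (of_real (1 - h) * cis y)) + cmod (bdry y - w (of_real (1 - h) * cis y))"
        by norm
      also have "cmod (w (of_real (1 - h) * cis x) - w (of_real (1 - h) * cis y)) \<le> A * h powr (- \<tau>) * \<bar>x - y\<bar>"
      proof (rule circle_lipschitz)
        fix z assume z: "cmod z = 1 - h"
        then have "stretch z \<le> A * h powr (- \<tau>)" using A[of z] h by simp
        then have "stretch z * (1 - h) \<le> A * h powr (- \<tau>) * 1"
          using h A0 by (intro mult_mono) (auto simp: stretch_def)
        then show "stretch z * (1 - h) \<le> A * h powr (- \<tau>)" by simp
      qed (use h in auto)
      also have "A * h powr (- \<tau>) * \<bar>x - y\<bar> = A * h powr (1 - \<tau>)"
        using h by (simp add: h_def[symmetric] powr_diff powr_minus field_simps)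
      finally have "cmod (bdry x - bdry y) \<le> A / (1 - \<tau>) * h powr (1 - \<tau>) + A * h powr (1 - \<tau>) + A / (1 - \<tau>) * h powr (1 - \<tau>)"
        using radial_increment[OF h \<tau> A, of x] radial_increment[OF h \<tau> A, of y] by linarith
      also have "\<dots> = (2 * (A / (1 - \<tau>)) + A) * h powr (1 - \<tau>)" by (simp add: algebra_simps)
      also have "\<dots> \<le> A' * h powr (1 - \<tau>)"
        using S by (intro mult_right_mono) (auto simp: A'_def)
      finally show ?thesis by (simp add: h_def)
    next
      case 3
      have "cmod (bdry x - bdry y) \<le> cmod (bdry x) + cmod (bdry y)" by (rule norm_triangle_ineq4)
      also have "\<dots> \<le> 2 * S" using S(1)[of "cis x"] S(1)[of "cis y"] by (simp add: bdry_def)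
      also have "\<dots> \<le> 4 * S * \<bar>x - y\<bar> powr (1 - \<tau>)"
      proof -
        have "1 / 2 = (1 / 2) powr (1::real)" by simp
        also have "\<dots> \<le> (1 / 2) powr (1 - \<tau>)" using \<tau> by (intro powr_mono') auto
        also have "\<dots> \<le> \<bar>x - y\<bar> powr (1 - \<tau>)" using 3 \<tau> by (intro powr_mono2) auto
        finally have "4 * S * (1 / 2) \<le> 4 * S * \<bar>x - y\<bar> powr (1 - \<tau>)" using S by (intro mult_left_mono) auto
        then show ?thesis by simp
      qed
      also have "\<dots> \<le> A' * \<bar>x - y\<bar> powr (1 - \<tau>)" using A'0 by (intro mult_right_mono) (auto simp: A'_def)
      finally show ?thesis .
    qed
  qed
  then show ?thesis by blast
qed

text \<open>Interpolating between the lower bounds \<open>(1 - r)\<^sup>2\<close> and \<open>x\<^sup>2 / 8\<close> for the square of the distance in the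
kernel leaves an integrable power of \<open>x\<close>.\<close>

lemma stretch_of_holder:
  assumes \<beta>: "0 < \<beta>" and A: "\<And>x y. cmod (bdry x - bdry y) \<le> A * \<bar>x - y\<bar> powr \<beta>"
    and \<tau>: "0 \<le> \<tau>" "\<tau> < 1" "1 < \<beta> * (1 + \<mu>) + \<tau>"
  shows "\<exists>A'. \<forall>z. 1 / 2 \<le> cmod z \<longrightarrow> cmod z < 1 \<longrightarrow> stretch z \<le> A' * (1 - cmod z) powr (- \<tau>)"
proof -
  have A0: "0 \<le> A" using order_trans[OF norm_ge_zero A[of 1 0]] by simp
  define s where "s = \<beta> * (1 + \<mu>)"
  define D where "D = C * (B * A) powr (1 + \<mu>) * 8 powr (1 - \<tau> / 2)"
  define I where "I = 2 * (pi powr (s - 2 + \<tau> + 1) / (s - 2 + \<tau> + 1))"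
  have D0: "0 \<le> D" using C_nonneg by (simp add: D_def)
  have "stretch z \<le> K / pi * (D * I) * (1 - cmod z) powr (- \<tau>)" if z: "1 / 2 \<le> cmod z" "cmod z < 1" for z
  proof -
    define r where "r = cmod z"
    have r: "1 / 2 \<le> r" "r < 1" using z by (auto simp: r_def)
    have "stretch z \<le> K / pi * (D * (1 - r) powr (- \<tau>) * I)"
    proof (rule stretch_bound)
      show "((\<lambda>x. D * (1 - r) powr (- \<tau>) * \<bar>x\<bar> powr (s - 2 + \<tau>)) has_integral D * (1 - r) powr (- \<tau>) * I) {-pi..pi}"
        unfolding I_def using \<tau> by (intro has_integral_mult_right has_integral_abs_powr) (auto simp: s_def)
      fix y x d assume x: "\<bar>x\<bar> \<le> pi" and d: "0 \<le> d" "d \<le> B * cmod (bdry (y + x) - bdry y)"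
      define m where "m = (cmod (cis x - of_real r))\<^sup>2"
      show "C * d powr (1 + \<mu>) / (cmod (cis x - of_real r))\<^sup>2 \<le> D * (1 - r) powr (- \<tau>) * \<bar>x\<bar> powr (s - 2 + \<tau>)"
        unfolding m_def[symmetric]
      proof (cases "x = 0")
        case True
        then have "d = 0" using d by simp
        then show "C * d powr (1 + \<mu>) / m \<le> D * (1 - r) powr (- \<tau>) * \<bar>x\<bar> powr (s - 2 + \<tau>)" using True by simp
      next
        case False
        have m: "(1 - r)\<^sup>2 \<le> m" "x\<^sup>2 / 8 \<le> m" "0 < m"
          using norm_cis_minus_real_ge[OF r(1) x] r unfolding m_def
          by (auto intro: less_le_trans[OF zero_less_power[of "1 - r" 2]])
        have "d \<le> B * A * \<bar>x\<bar> powr \<beta>"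
          using d(2) A[of "y + x" y] B_pos by (simp add: mult.assoc) (meson less_imp_le mult_left_mono order_trans)
        then have "d powr (1 + \<mu>) \<le> (B * A * \<bar>x\<bar> powr \<beta>) powr (1 + \<mu>)" using d \<mu>_pos by (intro powr_mono2) auto
        also have "\<dots> = (B * A) powr (1 + \<mu>) * \<bar>x\<bar> powr s"
          using B_pos A0 by (simp add: powr_mult powr_powr s_def)
        finally have num: "C * d powr (1 + \<mu>) \<le> C * ((B * A) powr (1 + \<mu>) * \<bar>x\<bar> powr s)"
          using C_nonneg by (rule mult_left_mono)
        have den: "(1 - r) powr \<tau> * (\<bar>x\<bar> powr (2 - \<tau>) / 8 powr (1 - \<tau> / 2)) \<le> m"
        proof -
          have "(1 - r) powr \<tau> = ((1 - r)\<^sup>2) powr (\<tau> / 2)"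
            using r by (simp add: powr_powr flip: powr_numeral)
          also have "\<dots> \<le> m powr (\<tau> / 2)" using m \<tau> by (intro powr_mono2) auto
          finally have 1: "(1 - r) powr \<tau> \<le> m powr (\<tau> / 2)" .
          have "\<bar>x\<bar> powr (2 - \<tau>) / 8 powr (1 - \<tau> / 2) = (x\<^sup>2 / 8) powr (1 - \<tau> / 2)"
          proof -
            have "x\<^sup>2 = \<bar>x\<bar> powr 2" by (simp add: powr_numeral)
            then have "(x\<^sup>2) powr (1 - \<tau> / 2) = (\<bar>x\<bar> powr 2) powr (1 - \<tau> / 2)" by (simp only:)
            also have "\<dots> = \<bar>x\<bar> powr (2 * (1 - \<tau> / 2))" by (rule powr_powr)
            also have "2 * (1 - \<tau> / 2) = 2 - \<tau>" by simp
            finally show ?thesis by (simp add: powr_divide)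
          qed
          also have "\<dots> \<le> m powr (1 - \<tau> / 2)" using m \<tau> by (intro powr_mono2) auto
          finally have 2: "\<bar>x\<bar> powr (2 - \<tau>) / 8 powr (1 - \<tau> / 2) \<le> m powr (1 - \<tau> / 2)" .
          have "(1 - r) powr \<tau> * (\<bar>x\<bar> powr (2 - \<tau>) / 8 powr (1 - \<tau> / 2)) \<le> m powr (\<tau> / 2) * m powr (1 - \<tau> / 2)"
            by (intro mult_mono 1 2) auto
          also have "\<dots> = m" using m by (simp flip: powr_add)
          finally show ?thesis .
        qed
        have denpos: "0 < (1 - r) powr \<tau> * (\<bar>x\<bar> powr (2 - \<tau>) / 8 powr (1 - \<tau> / 2))" using r False by simp
        have "C * d powr (1 + \<mu>) / m \<le> C * ((B * A) powr (1 + \<mu>) * \<bar>x\<bar> powr s) / ((1 - r) powr \<tau> * (\<bar>x\<bar> powr (2 - \<tau>) / 8 powr (1 - \<tau> / 2)))"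
          using num den denpos C_nonneg by (intro frac_le) auto
        also have "\<dots> = D * (1 - r) powr (- \<tau>) * (\<bar>x\<bar> powr s / \<bar>x\<bar> powr (2 - \<tau>))"
          using r by (simp add: D_def powr_minus field_simps)
        also have "\<bar>x\<bar> powr s / \<bar>x\<bar> powr (2 - \<tau>) = \<bar>x\<bar> powr (s - 2 + \<tau>)"
          using False by (simp flip: powr_diff) (simp add: algebra_simps)
        finally show "C * d powr (1 + \<mu>) / m \<le> D * (1 - r) powr (- \<tau>) * \<bar>x\<bar> powr (s - 2 + \<tau>)" .
      qed
    qed (use r in \<open>auto simp: r_def\<close>)
    then show ?thesis by (simp add: r_def mult_ac)
  qed
  then show ?thesis by blast
qed

text \<open>One step improves the exponent \<open>\<beta>\<close> to \<open>\<beta> * (1 + \<mu> / 2)\<close>. The limiting gain \<open>1 + \<mu>\<close> is not used up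
because the integral in \<open>stretch_of_holder\<close> would diverge logarithmically.\<close>

lemma bdry_lipschitz_of_holder:
  assumes \<beta>: "0 < \<beta>" and A: "\<And>x y. cmod (bdry x - bdry y) \<le> A * \<bar>x - y\<bar> powr \<beta>"
  shows "\<exists>M. \<forall>x y. cmod (bdry x - bdry y) \<le> M * \<bar>x - y\<bar>"
proof -
  have improve: "\<exists>A'. \<forall>x y. cmod (bdry x - bdry y) \<le> A' * \<bar>x - y\<bar> powr min 1 (\<beta> * (1 + \<mu> / 2))"
    if \<beta>: "0 < \<beta>" and A: "\<And>x y. cmod (bdry x - bdry y) \<le> A * \<bar>x - y\<bar> powr \<beta>" for \<beta> A
  proof -
    define \<tau> where "\<tau> = 1 - min 1 (\<beta> * (1 + \<mu> / 2))"
    have pos: "0 < \<beta> * (1 + \<mu> / 2)" "\<beta> * (1 + \<mu> / 2) < \<beta> * (1 + \<mu>)" using \<beta> \<mu>_pos by auto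
    then have \<tau>: "0 \<le> \<tau>" "\<tau> < 1" "1 < \<beta> * (1 + \<mu>) + \<tau>" by (auto simp: \<tau>_def min_def)
    obtain A' where "\<And>z. 1 / 2 \<le> cmod z \<Longrightarrow> cmod z < 1 \<Longrightarrow> stretch z \<le> A' * (1 - cmod z) powr (- \<tau>)"
      using stretch_of_holder[OF \<beta> A \<tau>] by blast
    from bdry_holder_of_stretch[OF \<tau>(1,2) this] show ?thesis by (simp add: \<tau>_def)
  qed
  have iter: "\<exists>A'. \<forall>x y. cmod (bdry x - bdry y) \<le> A' * \<bar>x - y\<bar> powr min 1 (\<beta> * (1 + \<mu> / 2) ^ Suc n)" for n
  proof (induction n)
    case 0 then show ?case using improve[OF \<beta> A] by simp
  next
    case (Suc n)
    define b where "b = \<beta> * (1 + \<mu> / 2) ^ Suc n"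
    have b: "0 < b" using \<beta> \<mu>_pos by (simp add: b_def)
    obtain A' where A': "\<And>x y. cmod (bdry x - bdry y) \<le> A' * \<bar>x - y\<bar> powr min 1 b"
      using Suc by (auto simp: b_def)
    have "min 1 (min 1 b * (1 + \<mu> / 2)) = min 1 (b * (1 + \<mu> / 2))"
    proof (cases "1 \<le> b")
      case True
      then have "1 * 1 \<le> b * (1 + \<mu> / 2)" using \<mu>_pos by (intro mult_mono) auto
      then show ?thesis using True \<mu>_pos by simp
    qed simp
    then show ?case using improve[OF _ A'] b by (simp add: b_def mult_ac)
  qed
  obtain n where n: "1 / \<beta> < (1 + \<mu> / 2) ^ n" using real_arch_pow[of "1 + \<mu> / 2" "1 / \<beta>"] \<mu>_pos by auto
  also have "\<dots> \<le> (1 + \<mu> / 2) ^ Suc n" using \<mu>_pos by (intro power_increasing) auto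
  finally have "1 \<le> \<beta> * (1 + \<mu> / 2) ^ Suc n" using \<beta> by (simp add: field_simps)
  then have m: "min 1 (\<beta> * (1 + \<mu> / 2) ^ Suc n) = 1" by simp
  show ?thesis using iter[of n] unfolding m by simp
qed

end

section \<open>The explicit Lipschitz constant\<close>

text \<open>The factor \<open>pi / 2\<close> is the loss in the Hoelder constant for distances above 2. Near 0 the left side is
1 and \<open>4 * (sin (x / 2))\<^sup>2\<close> is close to \<open>x\<^sup>2\<close>, so the coefficient of \<open>1 / x\<^sup>2\<close> is optimal, while
\<open>3 / 4\<close> absorbs everything else.\<close>

lemma kernel_constant:
  assumes x: "x \<noteq> 0" "\<bar>x\<bar> \<le> pi" and \<nu>: "0 \<le> \<nu>" "\<nu> \<le> 3 / 2"
  shows "(if \<bar>x\<bar> \<le> 2 then 1 else pi / 2) powr \<nu> \<le> 4 * (sin (x / 2))\<^sup>2 * (1 / x\<^sup>2 + 3 / 4)"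
proof -
  define v where "v = \<bar>x\<bar> / 2"
  have v: "0 < v" "v \<le> pi / 2" "x\<^sup>2 = 4 * v\<^sup>2" using x by (auto simp: v_def power_divide)
  have s: "(sin (x / 2))\<^sup>2 = (sin v)\<^sup>2" by (cases "0 \<le> x") (auto simp: v_def)
  show ?thesis
  proof (cases "\<bar>x\<bar> \<le> 2")
    case True
    then have v1: "v \<le> 1" by (simp add: v_def)
    have v2: "v\<^sup>2 \<le> 1" using v v1 by (simp add: power_le_one)
    have "v * (1 - v\<^sup>2 / 6) \<le> sin v"
      using sin_lower[of v] v by (simp add: power3_eq_cube power2_eq_square algebra_simps)
    then have "(v * (1 - v\<^sup>2 / 6))\<^sup>2 \<le> (sin v)\<^sup>2" using v v2 by (intro power_mono) auto
    moreover have "v\<^sup>2 * (1 - v\<^sup>2 / 3) \<le> (v * (1 - v\<^sup>2 / 6))\<^sup>2"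
      unfolding power_mult_distrib using v(1) by (intro mult_left_mono) (auto simp: power2_eq_square algebra_simps)
    ultimately have 1: "v\<^sup>2 * (1 - v\<^sup>2 / 3) \<le> (sin v)\<^sup>2" by linarith
    have "1 \<le> (1 - v\<^sup>2 / 3) * (1 + 3 * v\<^sup>2)"
    proof -
      have "v\<^sup>2 * v\<^sup>2 \<le> v\<^sup>2 * 1" using v2 by (intro mult_left_mono) auto
      moreover have "0 \<le> v\<^sup>2" by simp
      moreover have "(1 - v\<^sup>2 / 3) * (1 + 3 * v\<^sup>2) = 1 + 8 / 3 * v\<^sup>2 - v\<^sup>2 * v\<^sup>2" by (simp add: algebra_simps)
      ultimately show ?thesis by linarith
    qed
    then have "v\<^sup>2 * 1 \<le> v\<^sup>2 * ((1 - v\<^sup>2 / 3) * (1 + 3 * v\<^sup>2))" by (intro mult_left_mono) auto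
    also have "\<dots> = v\<^sup>2 * (1 - v\<^sup>2 / 3) * (1 + 3 * v\<^sup>2)" by simp
    also have "\<dots> \<le> (sin v)\<^sup>2 * (1 + 3 * v\<^sup>2)" using 1 by (intro mult_right_mono) auto
    finally have "1 \<le> (sin v)\<^sup>2 * (1 + 3 * v\<^sup>2) / v\<^sup>2" using v by (simp add: field_simps)
    also have "\<dots> = 4 * (sin v)\<^sup>2 * (1 / (4 * v\<^sup>2) + 3 / 4)" using v by (simp add: field_simps)
    finally show ?thesis using True by (simp add: s v(3))
  next
    case False
    then have v1: "1 \<le> v" by (simp add: v_def)
    have "5 / 6 \<le> sin (1::real)" using sin_lower[of 1] by simp
    also have "\<dots> \<le> sin v" using v1 v pi_gt3 by (subst sin_mono_le_eq) auto
    finally have "(5 / 6)\<^sup>2 \<le> (sin v)\<^sup>2" by (intro power_mono) auto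
    then have 25: "25 / 36 \<le> (sin v)\<^sup>2" by (simp add: power2_eq_square)
    have c: "1 \<le> pi / 2" "pi / 2 \<le> 1.58" using pi_approx by auto
    have "(pi / 2) powr \<nu> \<le> (pi / 2) powr (3 / 2)" using c \<nu> by (intro powr_mono) auto
    also have "\<dots> \<le> 2"
    proof -
      have "((pi / 2) powr (3 / 2))\<^sup>2 = (pi / 2) ^ 3"
      proof -
        have "((pi / 2) powr (3 / 2))\<^sup>2 = ((pi / 2) powr (3 / 2)) powr 2" by (simp add: powr_numeral)
        also have "\<dots> = (pi / 2) powr (3 / 2 * 2)" by (rule powr_powr)
        also have "\<dots> = (pi / 2) powr 3" by simp
        also have "\<dots> = (pi / 2) ^ 3" by (rule powr_numeral) simp
        finally show ?thesis .
      qed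
      also have "\<dots> \<le> 1.58 ^ 3" using c by (intro power_mono) auto
      also have "\<dots> \<le> 2\<^sup>2" by (simp add: power3_eq_cube)
      finally show ?thesis by (rule power2_le_imp_le) simp
    qed
    also have "\<dots> \<le> 4 * (25 / 36) * (3 / 4 :: real)" by simp
    also have "\<dots> \<le> 4 * (sin v)\<^sup>2 * (1 / x\<^sup>2 + 3 / 4)" using 25 by (intro mult_mono) auto
    finally show ?thesis using False by (simp add: s)
  qed
qed

context flat_boundary_map
begin

text \<open>With suitable unimodular \<open>a\<close> and \<open>b\<close> the stretch at a point is the modulus of the holomorphic function
\<open>a * p + b * q\<close>, to which the maximum principle applies.\<close>

lemma stretch_max:
  assumes Q: "\<And>z. 0 < cmod z \<Longrightarrow> cmod z < 1 \<Longrightarrow> stretch z * cmod z \<le> Q" and z: "z \<in> ball 0 1"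
  shows "stretch z \<le> Q"
proof -
  define a where "a = (if p z = 0 then 1 else cnj (p z) / of_real (cmod (p z)))"
  define b where "b = (if q z = 0 then 1 else cnj (q z) / of_real (cmod (q z)))"
  have ab: "cmod a = 1" "cmod b = 1" by (auto simp: a_def b_def norm_divide)
  have conj: "cnj u / of_real (cmod u) * u = of_real (cmod u)" if "u \<noteq> 0" for u :: complex
    using that complex_norm_square[of u] by (simp add: power2_eq_square field_simps)
  have fz: "a * p z + b * q z = of_real (stretch z)"
    using conj[of "p z"] conj[of "q z"] by (auto simp: a_def b_def stretch_def)
  have bound: "stretch z * \<rho> \<le> Q" if \<rho>: "cmod z < \<rho>" "\<rho> < 1" for \<rho>
  proof -
    have \<rho>0: "0 < \<rho>" using \<rho> norm_ge_zero[of z] by linarith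
    have "cmod (a * p z + b * q z) \<le> Q / \<rho>"
    proof (rule maximum_modulus_frontier[where S="ball 0 \<rho>" and f="\<lambda>z. a * p z + b * q z"])
      have hol: "(\<lambda>z. a * p z + b * q z) holomorphic_on ball 0 1" by (intro holomorphic_intros hol_p hol_q)
      show "(\<lambda>z. a * p z + b * q z) holomorphic_on interior (ball 0 \<rho>)"
        using hol by (rule holomorphic_on_subset) (use \<rho> in auto)
      show "continuous_on (closure (ball 0 \<rho>)) (\<lambda>z. a * p z + b * q z)"
        using holomorphic_on_imp_continuous_on[OF hol] by (rule continuous_on_subset) (use \<rho> \<rho>0 in auto)
      show "cmod (a * p \<zeta> + b * q \<zeta>) \<le> Q / \<rho>" if "\<zeta> \<in> frontier (ball 0 \<rho>)" for \<zeta>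
      proof -
        have n: "cmod \<zeta> = \<rho>" using that \<rho>0 by simp
        have "cmod (a * p \<zeta> + b * q \<zeta>) \<le> stretch \<zeta>"
          by (rule order_trans[OF norm_triangle_ineq]) (simp add: norm_mult ab stretch_def)
        also have "\<dots> \<le> Q / \<rho>" using Q[of \<zeta>] n \<rho> \<rho>0 by (simp add: field_simps)
        finally show ?thesis .
      qed
    qed (use \<rho> in auto)
    then have "stretch z \<le> Q / \<rho>" unfolding fz norm_of_real by (simp add: stretch_def)
    then show ?thesis using \<rho>0 by (simp add: field_simps)
  qed
  have "((\<lambda>\<rho>. stretch z * \<rho>) \<longlongrightarrow> stretch z * 1) (at_left 1)" by (intro tendsto_intros)
  moreover have "eventually (\<lambda>\<rho>. stretch z * \<rho> \<le> Q) (at_left 1)"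
    using z bound by (auto simp: eventually_at_left_field intro!: exI[of _ "cmod z"])
  ultimately have "stretch z * 1 \<le> Q" by (rule tendsto_upperbound) simp
  then show ?thesis by simp
qed

lemma map_lipschitz:
  assumes Q: "\<And>z. z \<in> ball 0 1 \<Longrightarrow> stretch z \<le> Q" and z: "z1 \<in> ball 0 1" "z2 \<in> ball 0 1"
  shows "cmod (w z1 - w z2) \<le> Q * cmod (z1 - z2)"
proof (rule differentiable_bound[of "ball 0 1" w "\<lambda>z h. p z * h + cnj (q z * h)"])
  fix z :: complex assume zb: "z \<in> ball 0 1"
  show "(w has_derivative (\<lambda>h. p z * h + cnj (q z * h))) (at z within ball 0 1)"
    using deriv[OF zb] by (rule has_derivative_at_withinI)
  show "onorm (\<lambda>h. p z * h + cnj (q z * h)) \<le> Q"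
  proof (rule onorm_le)
    fix h
    have "cmod (p z * h + cnj (q z * h)) \<le> stretch z * cmod h"
      by (rule order_trans[OF norm_triangle_ineq]) (simp add: norm_mult stretch_def distrib_right)
    also have "\<dots> \<le> Q * cmod h" using Q[OF zb] by (intro mult_right_mono) auto
    finally show "cmod (p z * h + cnj (q z * h)) \<le> Q * cmod h" .
  qed
qed (use z in auto)

end

text \<open>The bounds for \<open>\<alpha>\<close> and \<open>\<mu>\<close> make the exponent \<open>\<epsilon>\<close> so small that the far part of the kernel contributes
little compared with \<open>1 / \<epsilon>\<close>.\<close>

locale holder_boundary_map = flat_boundary_map +
  fixes \<alpha> H :: real
  assumes \<alpha>: "0 < \<alpha>" "\<alpha> \<le> 1 / 9" and \<mu>_le_1: "\<mu> \<le> 1" and H_pos: "0 < H"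
    and holder_near: "\<And>x y. \<bar>x - y\<bar> \<le> 2 \<Longrightarrow> cmod (bdry x - bdry y) \<le> H * \<bar>x - y\<bar> powr \<alpha>"
    and holder_far: "\<And>x y. \<bar>x - y\<bar> \<le> pi \<Longrightarrow> cmod (bdry x - bdry y) \<le> pi / 2 * H * \<bar>x - y\<bar> powr \<alpha>"
    and nonconstant: "\<exists>x y. bdry x \<noteq> bdry y"
begin

text \<open>In \<open>d powr (1 + \<mu>)\<close> the exponent is split as \<open>(1 - \<epsilon>) + \<nu>\<close>: the first part is estimated by the Lipschitz
constant and the second one by the Hoelder estimate. This choice makes \<open>x\<close> occur with the power
\<open>1 + \<epsilon>\<close>, which the kernel reduces to the integrable power \<open>\<epsilon> - 1\<close>.\<close>

definition "\<nu> = 2 * \<mu> / (2 - \<alpha>)"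
definition "\<epsilon> = \<mu> * \<alpha> / (2 - \<alpha>)"
definition "T = pi * K / 4 * C * (B * H) powr \<nu> * (pi powr \<epsilon> / \<epsilon>)"

lemma exponents: "0 < \<epsilon>" "\<epsilon> \<le> 1 / 17" "0 < \<nu>" "\<nu> \<le> 3 / 2" "1 + \<mu> = (1 - \<epsilon>) + \<nu>" "(1 - \<epsilon>) + \<alpha> * \<nu> = 1 + \<epsilon>"
proof -
  have d: "17 / 9 \<le> 2 - \<alpha>" using \<alpha> by simp
  show "0 < \<epsilon>" "0 < \<nu>" using \<alpha> \<mu>_pos by (auto simp: \<epsilon>_def \<nu>_def)
  have "\<mu> * \<alpha> \<le> 1 * (1 / 9)" using \<alpha> \<mu>_pos \<mu>_le_1 by (intro mult_mono) auto
  then show "\<epsilon> \<le> 1 / 17" unfolding \<epsilon>_def using d by (simp add: field_simps)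
  show "\<nu> \<le> 3 / 2" unfolding \<nu>_def using d \<mu>_le_1 by (simp add: field_simps)
  show "1 + \<mu> = (1 - \<epsilon>) + \<nu>" "(1 - \<epsilon>) + \<alpha> * \<nu> = 1 + \<epsilon>"
  proof -
    have "\<nu> - \<epsilon> = \<mu> * (2 - \<alpha>) / (2 - \<alpha>)"
      by (simp add: \<nu>_def \<epsilon>_def diff_divide_distrib[symmetric] algebra_simps)
    then have "\<nu> - \<epsilon> = \<mu>" using d by simp
    moreover have "\<alpha> * \<nu> = 2 * \<epsilon>" by (simp add: \<nu>_def \<epsilon>_def)
    ultimately show "1 + \<mu> = (1 - \<epsilon>) + \<nu>" "(1 - \<epsilon>) + \<alpha> * \<nu> = 1 + \<epsilon>" by linarith+
  qed
qed

text \<open>At the boundary the kernel is \<open>1 / (4 * (sin (x / 2))\<^sup>2)\<close>, which is close to \<open>1 / x\<^sup>2\<close> where it matters. The cruder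
bound \<open>pi\<^sup>2 / (4 * x\<^sup>2)\<close> would put \<open>pi * K / 2\<close> in place of \<open>pi * K / 4\<close> into \<open>T\<close>, and for \<open>K\<close> near 1 this
exceeds the factor \<open>pi / 2 * (K ^ 3 / (1 + K\<^sup>2))\<close> of the theorem.\<close>

lemma stretch_step:
  assumes M: "0 < M" "\<And>x y. cmod (bdry x - bdry y) \<le> M * \<bar>x - y\<bar>"
    and z: "0 < cmod z" "cmod z < 1"
  shows "stretch z * cmod z \<le> T * M powr (1 - \<epsilon>)"
proof -
  note ex = exponents
  define r where "r = cmod z"
  have r: "0 < r" "r < 1" using z by (auto simp: r_def)
  define D where "D = C * M powr (1 - \<epsilon>) * (B * H) powr \<nu>"
  have D0: "0 \<le> D" using C_nonneg by (simp add: D_def)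
  define I where "I = D / r * (2 * (pi powr ((\<epsilon> - 1) + 1) / ((\<epsilon> - 1) + 1)) + 3 / 4 * (2 * (pi powr ((1 + \<epsilon>) + 1) / ((1 + \<epsilon>) + 1))))"
  have "stretch z \<le> K / pi * I"
  proof (rule stretch_bound)
    show "((\<lambda>x. D / r * (\<bar>x\<bar> powr (\<epsilon> - 1) + 3 / 4 * \<bar>x\<bar> powr (1 + \<epsilon>))) has_integral I) {-pi..pi}"
      unfolding I_def using ex
      by (intro has_integral_mult_right has_integral_add has_integral_abs_powr) auto
    fix y x d
    assume x: "\<bar>x\<bar> \<le> pi" and d: "0 \<le> d" "d \<le> B * cmod (bdry (y + x) - bdry y)"
      "\<forall>M. (\<forall>x y. cmod (bdry x - bdry y) \<le> M * \<bar>x - y\<bar>) \<longrightarrow> d \<le> M * \<bar>x\<bar>"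
    show "C * d powr (1 + \<mu>) / (cmod (cis x - of_real r))\<^sup>2 \<le> D / r * (\<bar>x\<bar> powr (\<epsilon> - 1) + 3 / 4 * \<bar>x\<bar> powr (1 + \<epsilon>))"
    proof (cases "x = 0")
      case True
      then have "d = 0" using d by simp
      then show ?thesis using D0 r by (auto intro!: mult_nonneg_nonneg divide_nonneg_nonneg add_nonneg_nonneg)
    next
      case False
      define c :: real where "c = (if \<bar>x\<bar> \<le> 2 then 1 else pi / 2)"
      have c0: "0 < c" by (simp add: c_def)
      have d1: "d \<le> M * \<bar>x\<bar>" using d(3) M by blast
      have "cmod (bdry (y + x) - bdry y) \<le> c * H * \<bar>x\<bar> powr \<alpha>"
        using holder_near[of "y + x" y] holder_far[of "y + x" y] x by (auto simp: c_def)
      then have "B * cmod (bdry (y + x) - bdry y) \<le> B * (c * H * \<bar>x\<bar> powr \<alpha>)"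
        using B_pos by (intro mult_left_mono) auto
      then have d2: "d \<le> B * H * c * \<bar>x\<bar> powr \<alpha>" using d(2) by (simp add: mult_ac)
      have "d powr (1 + \<mu>) = d powr (1 - \<epsilon>) * d powr \<nu>" unfolding ex(5) by (rule powr_add)
      also have "\<dots> \<le> (M * \<bar>x\<bar>) powr (1 - \<epsilon>) * (B * H * c * \<bar>x\<bar> powr \<alpha>) powr \<nu>"
        using d1 d2 d(1) ex by (intro mult_mono powr_mono2) auto
      also have "\<dots> = M powr (1 - \<epsilon>) * (B * H) powr \<nu> * c powr \<nu> * (\<bar>x\<bar> powr (1 - \<epsilon>) * \<bar>x\<bar> powr (\<alpha> * \<nu>))"
        using M B_pos H_pos c0 by (simp add: powr_mult powr_powr)
      also have "\<bar>x\<bar> powr (1 - \<epsilon>) * \<bar>x\<bar> powr (\<alpha> * \<nu>) = \<bar>x\<bar> powr (1 + \<epsilon>)"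
        unfolding powr_add[symmetric] ex(6) ..
      finally have "C * d powr (1 + \<mu>) \<le> C * (M powr (1 - \<epsilon>) * (B * H) powr \<nu> * c powr \<nu> * \<bar>x\<bar> powr (1 + \<epsilon>))"
        using C_nonneg by (rule mult_left_mono)
      also have "\<dots> = D * \<bar>x\<bar> powr (1 + \<epsilon>) * c powr \<nu>" by (simp add: D_def)
      also have "\<dots> \<le> D * \<bar>x\<bar> powr (1 + \<epsilon>) * (4 * (sin (x / 2))\<^sup>2 * (1 / x\<^sup>2 + 3 / 4))"
        unfolding c_def using D0 False x ex by (intro mult_left_mono kernel_constant) auto
      finally have num: "C * d powr (1 + \<mu>) \<le> D * \<bar>x\<bar> powr (1 + \<epsilon>) * (1 / x\<^sup>2 + 3 / 4) * (4 * (sin (x / 2))\<^sup>2)"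
        by (simp add: mult_ac)
      define m where "m = (cmod (cis x - of_real r))\<^sup>2"
      have m: "4 * r * (sin (x / 2))\<^sup>2 \<le> m" "0 < m"
        using r by (auto simp: m_def norm_cis_minus_real add_pos_nonneg)
      have "C * d powr (1 + \<mu>) \<le> (D * \<bar>x\<bar> powr (1 + \<epsilon>) * (1 / x\<^sup>2 + 3 / 4) / r) * (4 * r * (sin (x / 2))\<^sup>2)"
        using num r by simp
      also have "\<dots> \<le> (D * \<bar>x\<bar> powr (1 + \<epsilon>) * (1 / x\<^sup>2 + 3 / 4) / r) * m"
        using m D0 r by (intro mult_left_mono) auto
      finally have "C * d powr (1 + \<mu>) / m \<le> D / r * (\<bar>x\<bar> powr (1 + \<epsilon>) * (1 / x\<^sup>2 + 3 / 4))"
        using m by (simp add: field_simps)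
      also have "\<bar>x\<bar> powr (1 + \<epsilon>) * (1 / x\<^sup>2 + 3 / 4) = \<bar>x\<bar> powr (\<epsilon> - 1) + 3 / 4 * \<bar>x\<bar> powr (1 + \<epsilon>)"
      proof -
        have "x\<^sup>2 = \<bar>x\<bar> powr 2" by (simp add: powr_numeral)
        then have "\<bar>x\<bar> powr (1 + \<epsilon>) * (1 / x\<^sup>2) = \<bar>x\<bar> powr (1 + \<epsilon>) / \<bar>x\<bar> powr 2" by simp
        also have "\<dots> = \<bar>x\<bar> powr (1 + \<epsilon> - 2)" by (rule powr_diff[symmetric])
        also have "1 + \<epsilon> - 2 = \<epsilon> - 1" by simp
        finally show ?thesis by (simp only: distrib_left mult.commute)
      qed
      finally show ?thesis by (simp add: m_def)
    qed
  qed (use r in \<open>auto simp: r_def\<close>)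
  also have "I \<le> D / r * (pi\<^sup>2 / 8 * (2 * (pi powr \<epsilon> / \<epsilon>)))"
  proof -
    have p: "9.8 \<le> pi\<^sup>2"
    proof -
      have "3.14 \<le> pi" using pi_approx by simp
      then have "3.14\<^sup>2 \<le> pi\<^sup>2" by (intro power_mono) auto
      then show ?thesis by (simp add: power2_eq_square)
    qed
    have "3 / 4 * (pi\<^sup>2 * \<epsilon>) \<le> 3 / 4 * (pi\<^sup>2 * (1 / 17))" using ex by (intro mult_left_mono) auto
    also have "\<dots> \<le> (pi\<^sup>2 / 8 - 1) * 2" using p by simp
    also have "\<dots> \<le> (pi\<^sup>2 / 8 - 1) * (2 + \<epsilon>)" using p ex by (intro mult_left_mono) auto
    finally have "3 / 4 * (pi\<^sup>2 / (2 + \<epsilon>)) \<le> (pi\<^sup>2 / 8 - 1) / \<epsilon>" using ex by (simp add: field_simps)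
    then have "2 * pi powr \<epsilon> * (1 / \<epsilon> + 3 / 4 * (pi\<^sup>2 / (2 + \<epsilon>))) \<le> 2 * pi powr \<epsilon> * (1 / \<epsilon> + (pi\<^sup>2 / 8 - 1) / \<epsilon>)"
      by (intro mult_left_mono add_left_mono) auto
    also have "1 / \<epsilon> + (pi\<^sup>2 / 8 - 1) / \<epsilon> = pi\<^sup>2 / 8 / \<epsilon>" by (simp add: add_divide_distrib[symmetric])
    also have "2 * pi powr \<epsilon> * (pi\<^sup>2 / 8 / \<epsilon>) = pi\<^sup>2 / 8 * (2 * (pi powr \<epsilon> / \<epsilon>))" by simp
    finally have "2 * pi powr \<epsilon> * (1 / \<epsilon> + 3 / 4 * (pi\<^sup>2 / (2 + \<epsilon>))) \<le> pi\<^sup>2 / 8 * (2 * (pi powr \<epsilon> / \<epsilon>))" .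
    moreover have "2 * (pi powr ((\<epsilon> - 1) + 1) / ((\<epsilon> - 1) + 1)) + 3 / 4 * (2 * (pi powr ((1 + \<epsilon>) + 1) / ((1 + \<epsilon>) + 1)))
       = 2 * pi powr \<epsilon> * (1 / \<epsilon> + 3 / 4 * (pi\<^sup>2 / (2 + \<epsilon>)))"
    proof -
      have "pi powr ((1 + \<epsilon>) + 1) = pi powr \<epsilon> * pi\<^sup>2"
        using powr_add[of pi \<epsilon> 2] by (simp add: powr_numeral add_ac)
      moreover have "(1 + \<epsilon>) + 1 = 2 + \<epsilon>" "(\<epsilon> - 1) + 1 = \<epsilon>" by simp_all
      moreover have "2 * (X / \<epsilon>) + 3 / 4 * (2 * (X * P / n)) = 2 * X * (1 / \<epsilon> + 3 / 4 * (P / n))" for X P n :: real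
        by (simp add: algebra_simps)
      ultimately show ?thesis by (simp only:)
    qed
    ultimately show ?thesis unfolding I_def using D0 r by (intro mult_left_mono) auto
  qed
  finally have "stretch z \<le> K / pi * (D / r * (pi\<^sup>2 / 8 * (2 * (pi powr \<epsilon> / \<epsilon>))))"
    using K_ge_1 by (simp add: mult_left_mono divide_right_mono)
  then have "stretch z * r \<le> K / pi * (D / r * (pi\<^sup>2 / 8 * (2 * (pi powr \<epsilon> / \<epsilon>)))) * r"
    using r by (intro mult_right_mono) auto
  also have "\<dots> = T * M powr (1 - \<epsilon>)" using r by (simp add: T_def D_def power2_eq_square)
  finally show ?thesis by (simp add: r_def)
qed

text \<open>The estimate \<open>stretch_step\<close> for the least Lipschitz constant \<open>M\<close> shows that \<open>T * M powr (1 - \<epsilon>)\<close> is a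
Lipschitz constant, too. The least constant exists and is positive, so it can be cancelled.\<close>

lemma explicit_lipschitz:
  shows "cmod (bdry x - bdry y) \<le> T powr (1 / \<epsilon>) * \<bar>x - y\<bar>"
    and "z1 \<in> ball 0 1 \<Longrightarrow> z2 \<in> ball 0 1 \<Longrightarrow> cmod (w z1 - w z2) \<le> T powr (1 / \<epsilon>) * cmod (z1 - z2)"
proof -
  note ex = exponents
  have T0: "0 \<le> T" using C_nonneg K_ge_1 ex by (simp add: T_def)
  define L where "L = {M. \<forall>x y. cmod (bdry x - bdry y) \<le> M * \<bar>x - y\<bar>}"
  have "\<exists>A. \<forall>x y. cmod (bdry x - bdry y) \<le> A * \<bar>x - y\<bar> powr \<alpha>"
  proof -
    have "bounded (w ` cball 0 1)" by (intro compact_imp_bounded compact_continuous_image cont) auto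
    then obtain S where S: "0 < S" "\<forall>y\<in>w ` cball 0 1. cmod y \<le> S" unfolding bounded_pos by blast
    have bS: "cmod (bdry x) \<le> S" for x using S(2) by (simp add: bdry_def)
    have "cmod (bdry x - bdry y) \<le> (H + 2 * S) * \<bar>x - y\<bar> powr \<alpha>" for x y
    proof (cases "\<bar>x - y\<bar> \<le> 2")
      case True
      have "cmod (bdry x - bdry y) \<le> H * \<bar>x - y\<bar> powr \<alpha>" by (rule holder_near[OF True])
      also have "\<dots> \<le> (H + 2 * S) * \<bar>x - y\<bar> powr \<alpha>" using S by (intro mult_right_mono) auto
      finally show ?thesis .
    next
      case False
      have "cmod (bdry x - bdry y) \<le> cmod (bdry x) + cmod (bdry y)" by (rule norm_triangle_ineq4)
      also have "\<dots> \<le> (H + 2 * S) * 1" using bS[of x] bS[of y] H_pos by simp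
      also have "\<dots> \<le> (H + 2 * S) * \<bar>x - y\<bar> powr \<alpha>"
        using False \<alpha> S H_pos by (intro mult_left_mono ge_one_powr_ge_zero) auto
      finally show ?thesis .
    qed
    then show ?thesis by blast
  qed
  then obtain M0 where "M0 \<in> L" using bdry_lipschitz_of_holder[OF \<alpha>(1)] unfolding L_def by blast
  then have ne: "L \<noteq> {}" by auto
  obtain x0 y0 where xy0: "bdry x0 \<noteq> bdry y0" using nonconstant by blast
  \<comment> \<open>A positive lower bound for all Lipschitz constants.\<close>
  define m where "m = cmod (bdry x0 - bdry y0) / \<bar>x0 - y0\<bar>"
  have xy1: "0 < \<bar>x0 - y0\<bar>" using xy0 by auto
  then have m: "0 < m" using xy0 by (simp add: m_def)
  have m_le: "m \<le> M" if "M \<in> L" for M using that xy1 by (auto simp: L_def m_def field_simps)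
  have bdd: "bdd_below L" using m_le by (rule bdd_belowI)
  define M where "M = Inf L"
  have "m \<le> M" unfolding M_def using ne m_le by (rule cInf_greatest)
  then have M0: "0 < M" using m by simp
  have M_lip: "cmod (bdry x - bdry y) \<le> M * \<bar>x - y\<bar>" for x y
  proof (cases "x = y")
    case False
    have "cmod (bdry x - bdry y) / \<bar>x - y\<bar> \<le> M"
      unfolding M_def using ne False by (intro cInf_greatest) (auto simp: L_def field_simps)
    then show ?thesis using False by (simp add: field_simps)
  qed simp
  define Q where "Q = T * M powr (1 - \<epsilon>)"
  have st: "stretch z * cmod z \<le> Q" if "0 < cmod z" "cmod z < 1" for z
    unfolding Q_def by (rule stretch_step[OF M0 M_lip that])
  have "stretch z * cmod z \<le> Q" if "1 / 2 \<le> cmod z" "cmod z < 1" for z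
    using that by (intro st) auto
  then have "Q \<in> L" unfolding L_def using bdry_lipschitz[of Q] by blast
  then have MQ: "M \<le> Q" unfolding M_def using bdd by (rule cInf_lower)
  have "M powr \<epsilon> \<le> T"
  proof -
    have "M powr \<epsilon> * M powr (1 - \<epsilon>) \<le> T * M powr (1 - \<epsilon>)"
      using MQ M0 by (simp add: Q_def flip: powr_add)
    then show ?thesis using M0 by (simp add: mult_le_cancel_right)
  qed
  then have "(M powr \<epsilon>) powr (1 / \<epsilon>) \<le> T powr (1 / \<epsilon>)" using ex by (intro powr_mono2) auto
  then have MT: "M \<le> T powr (1 / \<epsilon>)" using M0 ex by (simp add: powr_powr)
  have "0 < M powr \<epsilon>" using M0 by simp
  with \<open>M powr \<epsilon> \<le> T\<close> have Tpos: "0 < T" by linarith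
  have "M powr (1 - \<epsilon>) \<le> (T powr (1 / \<epsilon>)) powr (1 - \<epsilon>)" using MT M0 ex by (intro powr_mono2) auto
  then have "Q \<le> T powr 1 * (T powr (1 / \<epsilon>)) powr (1 - \<epsilon>)"
    unfolding Q_def using T0 Tpos by (simp add: mult_left_mono)
  also have "\<dots> = T powr (1 + 1 / \<epsilon> * (1 - \<epsilon>))" by (simp only: powr_powr powr_add)
  also have "1 + 1 / \<epsilon> * (1 - \<epsilon>) = 1 / \<epsilon>" using ex by (simp add: field_simps)
  finally have QT: "Q \<le> T powr (1 / \<epsilon>)" .
  show "cmod (bdry x - bdry y) \<le> T powr (1 / \<epsilon>) * \<bar>x - y\<bar>"
    using M_lip[of x y] MT by (meson abs_ge_zero mult_right_mono order_trans)
  show "cmod (w z1 - w z2) \<le> T powr (1 / \<epsilon>) * cmod (z1 - z2)" if "z1 \<in> ball 0 1" "z2 \<in> ball 0 1"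
    using map_lipschitz[of Q z1 z2] stretch_max[OF st] that QT
    by (meson mult_right_mono norm_ge_zero order_trans)
qed

end

context length_disc_map
begin

text \<open>By the triangle inequality through the midpoint.\<close>

lemma double_holder_range:
  assumes near: "\<And>x y. \<bar>x - y\<bar> \<le> a \<Longrightarrow> cmod (bdry x - bdry y) \<le> c * \<bar>x - y\<bar> powr \<alpha>"
    and \<alpha>: "0 < \<alpha>" and c: "0 \<le> c" and xy: "\<bar>x - y\<bar> \<le> 2 * a"
  shows "cmod (bdry x - bdry y) \<le> 2 * c * \<bar>x - y\<bar> powr \<alpha>"
proof -
  define m where "m = (x + y) / 2"
  have m: "x - m = (x - y) / 2" "m - y = (x - y) / 2" by (simp_all add: m_def field_simps)
  have d: "\<bar>x - m\<bar> = \<bar>x - y\<bar> / 2" "\<bar>m - y\<bar> = \<bar>x - y\<bar> / 2" unfolding m by simp_all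
  have "cmod (bdry x - bdry y) \<le> cmod (bdry x - bdry m) + cmod (bdry m - bdry y)"
    using norm_triangle_ineq[of "bdry x - bdry m" "bdry m - bdry y"] by simp
  also have "\<dots> \<le> c * \<bar>x - m\<bar> powr \<alpha> + c * \<bar>m - y\<bar> powr \<alpha>"
    using xy by (intro add_mono near) (auto simp: d)
  also have "\<dots> = 2 * (c * (\<bar>x - y\<bar> / 2) powr \<alpha>)" unfolding d by simp
  also have "\<dots> \<le> 2 * (c * \<bar>x - y\<bar> powr \<alpha>)" using c \<alpha> by (intro mult_left_mono powr_mono2) auto
  finally show ?thesis by simp
qed

text \<open>Up to distance 1 the constant is \<open>pi / 8 * H\<close>; doubling the range once and twice leads to the
distances 2 and 4.\<close>

lemma bdry_holder_explicit:
  assumes A: "\<And>\<phi>. cap_area \<phi> 0 \<le> A" and \<alpha>_def: "\<alpha> = 1 / (K * (1 + 2 * B)\<^sup>2)"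
  defines "H \<equiv> 4 * (1 + 2 * B) * sqrt (K * A / (pi * ln 2))"
  shows "\<bar>x - y\<bar> \<le> 2 \<Longrightarrow> cmod (bdry x - bdry y) \<le> H * \<bar>x - y\<bar> powr \<alpha>"
    and "\<bar>x - y\<bar> \<le> pi \<Longrightarrow> cmod (bdry x - bdry y) \<le> pi / 2 * H * \<bar>x - y\<bar> powr \<alpha>"
proof -
  have A0: "0 \<le> A" using order_trans[OF cap_area_nonneg A] .
  have \<alpha>: "0 < \<alpha>" using B_nonneg K_ge_1 by (simp add: \<alpha>_def)
  have H0: "0 \<le> H" using B_nonneg K_ge_1 A0 by (simp add: H_def)
  have \<kappa>: "2 * \<alpha> \<le> 1 / \<kappa>"
  proof -
    have "1 / \<kappa> = 8 / pi * \<alpha>" using B_nonneg K_ge_1 by (simp add: \<kappa>_def \<alpha>_def field_simps)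
    moreover have "2 * \<alpha> \<le> 8 / pi * \<alpha>" using \<alpha> pi_less_4 by (intro mult_right_mono) (auto simp: field_simps)
    ultimately show ?thesis by simp
  qed
  have step: "cmod (bdry x - bdry (x + h)) \<le> pi / 8 * H * h powr \<alpha>" if h: "0 < h" "h \<le> 1" for x h
  proof -
    have "(cmod (bdry x - bdry (x + h)))\<^sup>2 \<le> ((1 + 2 * B) / 2)\<^sup>2 * (pi * K * (cap_area ((x + (x + h)) / 2) 0 * h powr (1 / \<kappa>) / ln 2))"
      by (rule bdry_holder[OF h refl])
    also have "\<dots> \<le> ((1 + 2 * B) / 2)\<^sup>2 * (pi * K * (A * h powr (2 * \<alpha>) / ln 2))"
      using K_ge_1 A0 h \<kappa> A
      by (intro mult_left_mono divide_right_mono mult_mono powr_mono') auto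
    also have "\<dots> = (pi / 8 * H * h powr \<alpha>)\<^sup>2"
    proof -
      have "(h powr \<alpha>)\<^sup>2 = h powr (2 * \<alpha>)"
        by (simp add: power2_eq_square powr_add[symmetric])
      moreover have "(sqrt (K * A / (pi * ln 2)))\<^sup>2 = K * A / (pi * ln 2)"
        using K_ge_1 A0 by simp
      moreover have "(b / 2)\<^sup>2 * (pi * K * (A * P / t)) = (pi / 8)\<^sup>2 * ((4 * b)\<^sup>2 * (K * A / (pi * t))) * P"
        for b P t :: real
        by (simp add: power2_eq_square)
      ultimately show ?thesis
        unfolding H_def power_mult_distrib[of _ "h powr \<alpha>"] power_mult_distrib[of "pi / 8"]
          power_mult_distrib[of _ "sqrt (K * A / (pi * ln 2))"] by (simp only:)
    qed
    finally show ?thesis by (rule power2_le_imp_le) (use H0 in simp)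
  qed
  have 1: "cmod (bdry x - bdry y) \<le> pi / 8 * H * \<bar>x - y\<bar> powr \<alpha>" if "\<bar>x - y\<bar> \<le> 1" for x y
    using step[of "y - x" x] step[of "x - y" y] that
    by (cases x y rule: linorder_cases) (auto simp: norm_minus_commute)
  have 2: "cmod (bdry x - bdry y) \<le> 2 * (pi / 8 * H) * \<bar>x - y\<bar> powr \<alpha>" if "\<bar>x - y\<bar> \<le> 2" for x y
    using H0 that by (intro double_holder_range[of 1, OF 1 \<alpha>]) auto
  have 4: "cmod (bdry x - bdry y) \<le> 2 * (2 * (pi / 8 * H)) * \<bar>x - y\<bar> powr \<alpha>" if "\<bar>x - y\<bar> \<le> 2 * 2" for x y
    using H0 that by (intro double_holder_range[of 2, OF 2 \<alpha>]) auto
  show "\<bar>x - y\<bar> \<le> 2 \<Longrightarrow> cmod (bdry x - bdry y) \<le> H * \<bar>x - y\<bar> powr \<alpha>"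
  proof -
    assume "\<bar>x - y\<bar> \<le> 2"
    then have "cmod (bdry x - bdry y) \<le> 2 * (pi / 8 * H) * \<bar>x - y\<bar> powr \<alpha>" by (rule 2)
    also have "\<dots> \<le> H * \<bar>x - y\<bar> powr \<alpha>"
      using H0 pi_less_4 mult_left_mono[of pi 4 H] by (intro mult_right_mono) auto
    finally show ?thesis .
  qed
  show "\<bar>x - y\<bar> \<le> pi \<Longrightarrow> cmod (bdry x - bdry y) \<le> pi / 2 * H * \<bar>x - y\<bar> powr \<alpha>"
    using 4[of x y] pi_less_4 by (simp add: mult_ac)
qed

end

definition lipschitz_bound :: "real \<Rightarrow> complex set \<Rightarrow> real \<Rightarrow> real \<Rightarrow> real" where
  "lipschitz_bound K \<Omega> \<mu> B = (let \<alpha> = 1 / (K * (1 + 2 * B)\<^sup>2) in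
     4 * pi *
       (pi / 2 * (K ^ 3 / (1 + K\<^sup>2)) * curve_const \<mu> (frontier \<Omega>) * ((2 - \<alpha>) / (\<mu> * \<alpha>)))
         powr ((2 - \<alpha>) / (\<mu> * \<alpha>)) *
       (4 * B * (1 + 2 * B) * sqrt (K * measure lebesgue \<Omega> / (pi * ln 2))) powr (2 / \<alpha>))"

lemma curve_const_holder:
  assumes \<gamma>: "jordan_curve_C1_holder \<mu> \<gamma>" and \<mu>: "0 < \<mu>"
  defines "g' \<equiv> \<lambda>s. vector_derivative (arc_length_param \<gamma>) (at s)"
  shows "cmod (g' s - g' t) \<le> (1 + \<mu>) * curve_const \<mu> \<gamma> * \<bar>s - t\<bar> powr \<mu>"
proof (cases "s = t")
  case False
  define Q where "Q = (\<lambda>(s, t). cmod (g' s - g' t) / \<bar>s - t\<bar> powr \<mu>)"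
  define X where "X = {(s::real, t). s \<noteq> t}"
  obtain C where C: "\<And>s t. cmod (g' s - g' t) \<le> C * \<bar>s - t\<bar> powr \<mu>"
    using \<gamma> by (auto simp: jordan_curve_C1_holder_def g'_def)
  have "Q i \<le> C" if "i \<in> X" for i
    using that C by (auto simp: Q_def X_def field_simps)
  then have bdd: "bdd_above (Q ` X)" by (auto intro!: bdd_aboveI)
  have sup: "(1 + \<mu>) * curve_const \<mu> \<gamma> = Sup (Q ` X)"
    using \<mu> by (simp add: curve_const_def Q_def X_def g'_def case_prod_unfold)
  have "Q (s, t) \<le> Sup (Q ` X)" using False bdd by (intro cSup_upper) (auto simp: X_def)
  then show ?thesis using False unfolding sup by (simp add: Q_def field_simps)
qed simp

text \<open>The bound \<open>T powr (1 / \<epsilon>)\<close> for the data at hand is at most \<open>lipschitz_bound\<close>, because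
\<open>K / 2 \<le> K ^ 3 / (1 + K\<^sup>2)\<close>.\<close>

lemma lipschitz_by_bound:
  fixes w f :: "complex \<Rightarrow> complex"
  assumes \<Omega>: "jordan_domain \<Omega>" and \<mu>: "0 < \<mu>" "\<mu> \<le> 1" and \<gamma>: "jordan_curve_C1_holder \<mu> (frontier \<Omega>)"
    and B: "1 < B" and chord_arc: "chord_arc B (frontier \<Omega>)"
    and normalized: "normalized_quasiconformal K \<Omega> w"
    and f: "\<forall>\<zeta>\<in>sphere 0 1. f \<zeta> = w \<zeta>" and poisson: "\<forall>z\<in>ball 0 1. w z = poisson_integral f z"
  shows "cmod (w (cis x) - w (cis y)) \<le> lipschitz_bound K \<Omega> \<mu> B * \<bar>x - y\<bar>"
    and "z1 \<in> ball 0 1 \<Longrightarrow> z2 \<in> ball 0 1 \<Longrightarrow> cmod (w z1 - w z2) \<le> lipschitz_bound K \<Omega> \<mu> B * cmod (z1 - z2)"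
proof -
  define g where "g = arc_length_param (frontier \<Omega>)"
  define C where "C = curve_const \<mu> (frontier \<Omega>)"
  have qc: "quasiconformal K (ball 0 1) \<Omega> w" and cont_w: "continuous_on (cball 0 1) w"
    using normalized by (auto simp: normalized_quasiconformal_def)
  have K: "1 \<le> K" using qc by (simp add: quasiconformal_def)
  obtain v where "homeomorphism (ball 0 1) \<Omega> w v" using qc by (auto simp: quasiconformal_def)
  then have image: "w ` ball 0 1 = \<Omega>" and inj_w: "inj_on w (ball 0 1)"
    by (auto simp: homeomorphism_def intro: inj_on_inverseI[of _ v])
  have open_\<Omega>: "open \<Omega>" "\<Omega> \<noteq> {}" using \<Omega> by (auto simp: jordan_domain_def plane_domain_def)
  interpret disc_homeo w by unfold_locales (fact cont_w inj_w)+
  have param: "is_arc_length_param (frontier \<Omega>) g"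
    and diff: "\<And>s. g differentiable (at s)"
    using \<gamma> by (auto simp: jordan_curve_C1_holder_def g_def)
  obtain l where l: "0 < l" "curve_length (frontier \<Omega>) = ereal l" "\<And>s. g (s + l) = g s"
     "inj_on g {0..<l}" "range g = frontier \<Omega>" "\<And>a b. a \<le> b \<Longrightarrow> length_on g a b = ereal (b - a)"
    using param by (auto simp: is_arc_length_param_def)
  interpret smooth_arc_param g l \<mu> "(1 + \<mu>) * C"
    by unfold_locales (use l diff \<mu> curve_const_holder[OF \<gamma> \<mu>(1)] in \<open>auto simp: C_def g_def\<close>)
  interpret parametrized_boundary w g l B
    by unfold_locales (use frontier_image image l normalized chord_arc in \<open>auto simp: normalized_quasiconformal_def\<close>)
  obtain \<sigma> s where \<sigma>: "continuous_on UNIV \<sigma>" "\<And>x. bdry x = g (\<sigma> x)" and s: "mono s"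
    "\<And>x y. \<bar>s x - s y\<bar> = \<bar>\<sigma> x - \<sigma> y\<bar>"
    "\<And>\<phi> \<eta>. 0 \<le> \<eta> \<Longrightarrow> \<eta> < pi / 3 \<Longrightarrow>
        s (\<phi> + \<eta>) - s (\<phi> - \<eta>) \<le> 2 * B * cmod (bdry (\<phi> + \<eta>) - bdry (\<phi> - \<eta>))"
    using boundary_parameter by blast
  let ?p = "kernel_transform bdry" and ?q = "kernel_transform (\<lambda>x. cnj (bdry x))"
  have w_poisson: "w z = integral {0..2*pi} (\<lambda>x. poisson_kernel (cmod z) (x - Arg z) *\<^sub>R bdry x)"
    if "z \<in> ball 0 1" for z
    using poisson f that by (simp add: poisson_integral_def bdry_def)
  have der: "(w has_derivative (\<lambda>h. ?p z * h + cnj (?q z * h))) (at z)" if "z \<in> ball 0 1" for z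
    by (rule poisson_integral_has_derivative[OF cont_bdry that w_poisson])
  have hol: "?p holomorphic_on ball 0 1" "?q holomorphic_on ball 0 1"
    by (intro kernel_transform_holomorphic continuous_intros cont_bdry)+
  have dil: "cmod (?p z) + cmod (?q z) \<le> K * \<bar>cmod (?p z) - cmod (?q z)\<bar>" if "z \<in> ball 0 1" for z
    using quasiconformal_dilatation[OF qc der _ _ that] hol by (simp add: holomorphic_on_imp_continuous_on)
  interpret length_disc_map w ?p ?q K s B
  proof unfold_locales
    show "cmod (bdry x - bdry y) \<le> \<bar>s x - s y\<bar>" for x y
      unfolding s(2) \<sigma>(2) by (rule g_lipschitz)
  qed (use der hol K dil B s in auto)
  interpret flat_boundary_map w K C B \<mu>
  proof unfold_locales
    show "0 \<le> C" using H_nonneg \<mu> by (simp add: zero_le_mult_iff)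
    fix y
    show "\<exists>N. cmod N = 1 \<and> (\<forall>x. \<exists>d\<ge>0. \<bar>(bdry x - bdry y) \<bullet> N\<bar> \<le> C * d powr (1 + \<mu>) \<and>
        d \<le> B * cmod (bdry x - bdry y) \<and>
        (\<forall>M. (\<forall>x y. cmod (bdry x - bdry y) \<le> M * \<bar>x - y\<bar>) \<longrightarrow> d \<le> M * \<bar>x - y\<bar>))"
    proof (intro exI[of _ "\<i> * g' (\<sigma> y)"] conjI allI)
      show "cmod (\<i> * g' (\<sigma> y)) = 1" by (simp add: norm_mult unit_speed)
      fix x
      have ca: "chord_arc B (range g)" using chord_arc l by simp
      obtain n :: int where n: "\<bar>\<sigma> x - \<sigma> y + of_int n * l\<bar> \<le> B * cmod (g (\<sigma> x) - g (\<sigma> y))"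
        "\<bar>\<sigma> x - \<sigma> y + of_int n * l\<bar> \<le> \<bar>\<sigma> x - \<sigma> y\<bar>"
        using chord_arc_lift[OF ca, of "\<sigma> x" "\<sigma> y"] by blast
      define d where "d = \<bar>\<sigma> x - \<sigma> y + of_int n * l\<bar>"
      have "\<bar>(bdry x - bdry y) \<bullet> (\<i> * g' (\<sigma> y))\<bar> \<le> C * d powr (1 + \<mu>)"
      proof -
        have "\<sigma> x + of_int n * l - \<sigma> y = \<sigma> x - \<sigma> y + of_int n * l" "(1 + \<mu>) * C / (1 + \<mu>) = C"
          using \<mu> by simp_all
        then show ?thesis
          using normal_deviation[of "\<sigma> x + of_int n * l" "\<sigma> y"] by (simp only: d_def \<sigma>(2) periodic_int)
      qed
      moreover have "d \<le> B * cmod (bdry x - bdry y)" using n(1) by (simp add: d_def \<sigma>(2))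
      moreover have "d \<le> M * \<bar>x - y\<bar>" if "\<forall>x y. cmod (bdry x - bdry y) \<le> M * \<bar>x - y\<bar>" for M
        using lift_lipschitz[OF \<sigma>, of M x y] that n(2) by (auto simp: d_def)
      ultimately show "\<exists>d\<ge>0. \<bar>(bdry x - bdry y) \<bullet> (\<i> * g' (\<sigma> y))\<bar> \<le> C * d powr (1 + \<mu>) \<and>
        d \<le> B * cmod (bdry x - bdry y) \<and>
        (\<forall>M. (\<forall>x y. cmod (bdry x - bdry y) \<le> M * \<bar>x - y\<bar>) \<longrightarrow> d \<le> M * \<bar>x - y\<bar>)"
        by (intro exI[of _ d]) (auto simp: d_def)
    qed
  qed (use B \<mu> in auto)
  define \<alpha> where "\<alpha> = 1 / (K * (1 + 2 * B)\<^sup>2)"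
  define A where "A = measure lebesgue \<Omega>"
  define H where "H = 4 * (1 + 2 * B) * sqrt (K * A / (pi * ln 2))"
  have bounded_\<Omega>: "bounded \<Omega>" using \<Omega> by (simp add: jordan_domain_def)
  have lm: "\<Omega> \<in> lmeasurable" using bounded_\<Omega> open_\<Omega>(1) by (rule lmeasurable_open)
  have A: "0 < A"
    unfolding A_def using open_not_negligible[OF open_\<Omega>] lm
    by (simp add: negligible_iff_measure zero_less_measure_iff)
  have cap: "cap_area \<phi> 0 \<le> A" for \<phi>
  proof -
    have "w ` cap \<phi> 0 \<subseteq> \<Omega>" using image by (auto simp: cap_def)
    moreover have o: "open (w ` cap \<phi> 0)" by (rule open_image) (auto simp: cap_def)
    ultimately have "measure lebesgue (w ` cap \<phi> 0) \<le> measure lebesgue \<Omega>"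
      using lm by (intro measure_mono_fmeasurable) auto
    then show ?thesis using o by (simp add: A_def cap_area_def)
  qed
  have \<alpha>: "0 < \<alpha>" "\<alpha> \<le> 1 / 9"
  proof -
    have "3\<^sup>2 \<le> (1 + 2 * B)\<^sup>2" using B by (intro power_mono) auto
    then have "1 * 3\<^sup>2 \<le> K * (1 + 2 * B)\<^sup>2" using K by (intro mult_mono) auto
    then have "9 \<le> K * (1 + 2 * B)\<^sup>2" by simp
    then show "0 < \<alpha>" "\<alpha> \<le> 1 / 9" unfolding \<alpha>_def by (auto simp: field_simps)
  qed
  interpret holder_boundary_map w K C B \<mu> \<alpha> H
  proof unfold_locales
    show "0 < H" using A B K by (simp add: H_def)
    show "\<exists>x y. bdry x \<noteq> bdry y"
    proof -
      have "l / 3 \<le> \<bar>\<sigma> 0 - \<sigma> 0\<bar>" if "bdry 0 = bdry (2 * pi / 3)"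
        using thirds[of 0 "\<sigma> 0" "\<sigma> 0"] \<sigma>(2)[of 0] that by simp
      then show ?thesis using l_pos by auto
    qed
  qed (use \<alpha> \<mu> bdry_holder_explicit[OF cap \<alpha>_def] in \<open>auto simp: H_def\<close>)
  have bound: "T powr (1 / \<epsilon>) \<le> lipschitz_bound K \<Omega> \<mu> B"
  proof -
    have C0: "0 \<le> C" by (rule C_nonneg)
    have e: "(2 - \<alpha>) / (\<mu> * \<alpha>) = 1 / \<epsilon>" by (simp add: \<epsilon>_def)
    have \<nu>e: "\<nu> * (1 / \<epsilon>) = 2 / \<alpha>" using \<alpha> \<mu> by (simp add: \<nu>_def \<epsilon>_def)
    define Y where "Y = pi / 2 * (K ^ 3 / (1 + K\<^sup>2)) * C * (1 / \<epsilon>)"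
    have BH: "B * H = 4 * B * (1 + 2 * B) * sqrt (K * measure lebesgue \<Omega> / (pi * ln 2))"
      by (simp add: H_def A_def)
    have "T = (pi * K / 4 * C * (1 / \<epsilon>)) * (B * H) powr \<nu> * pi powr \<epsilon>" by (simp add: T_def)
    then have "T powr (1 / \<epsilon>) = (pi * K / 4 * C * (1 / \<epsilon>)) powr (1 / \<epsilon>) * ((B * H) powr \<nu>) powr (1 / \<epsilon>) * (pi powr \<epsilon>) powr (1 / \<epsilon>)"
    proof -
      have split: "(x * y * z) powr r = x powr r * y powr r * z powr r" if "0 \<le> x" "0 \<le> y" "0 \<le> z" for x y z r :: real
        using that by (simp add: powr_mult)
      have "0 \<le> pi * K / 4 * C * (1 / \<epsilon>)" using C0 K exponents(1) by simp
      then show ?thesis unfolding \<open>T = _\<close> by (rule split) auto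
    qed
    also have "((B * H) powr \<nu>) powr (1 / \<epsilon>) = (B * H) powr (2 / \<alpha>)" unfolding powr_powr \<nu>e ..
    also have "(pi powr \<epsilon>) powr (1 / \<epsilon>) = pi" using exponents(1) by (simp add: powr_powr)
    also have "(pi * K / 4 * C * (1 / \<epsilon>)) powr (1 / \<epsilon>) * (B * H) powr (2 / \<alpha>) * pi
        \<le> Y powr (1 / \<epsilon>) * (B * H) powr (2 / \<alpha>) * (4 * pi)"
    proof (intro mult_mono powr_mono2)
      have "K * (1 + K\<^sup>2) \<le> 2 * K ^ 3"
      proof -
        have "K * 1 \<le> K * K\<^sup>2" using K by (intro mult_left_mono) (auto simp: one_le_power)
        then show ?thesis by (simp add: power3_eq_cube power2_eq_square algebra_simps)
      qed
      then have "K / 2 \<le> K ^ 3 / (1 + K\<^sup>2)" by (simp add: field_simps add_pos_nonneg)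
      then have "pi / 2 * (K / 2) * (C * (1 / \<epsilon>)) \<le> pi / 2 * (K ^ 3 / (1 + K\<^sup>2)) * (C * (1 / \<epsilon>))"
        using C0 exponents(1) by (intro mult_right_mono mult_left_mono) auto
      then show "pi * K / 4 * C * (1 / \<epsilon>) \<le> Y" by (simp add: Y_def mult_ac)
    qed (use C0 K exponents(1) \<alpha> B_pos H_pos in auto)
    also have "\<dots> = lipschitz_bound K \<Omega> \<mu> B"
      unfolding lipschitz_bound_def Let_def \<alpha>_def[symmetric] e BH[symmetric] C_def[symmetric] Y_def by (simp add: mult_ac)
    finally show ?thesis .
  qed
  show "cmod (w (cis x) - w (cis y)) \<le> lipschitz_bound K \<Omega> \<mu> B * \<bar>x - y\<bar>"
    using explicit_lipschitz(1)[of x y] mult_right_mono[OF bound, of "\<bar>x - y\<bar>"] by (simp add: bdry_def)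
  show "cmod (w z1 - w z2) \<le> lipschitz_bound K \<Omega> \<mu> B * cmod (z1 - z2)" if "z1 \<in> ball 0 1" "z2 \<in> ball 0 1"
    using explicit_lipschitz(2)[OF that] mult_right_mono[OF bound, of "cmod (z1 - z2)"] by simp
qed

theorem theorem2p1:
  fixes \<Omega> :: "complex set" and K :: real
  assumes "1 \<le> K" and "jordan_domain \<Omega>"
  shows "\<exists>L::real. \<forall>\<mu> B :: real.
    0 < \<mu> \<longrightarrow> \<mu> \<le> 1 \<longrightarrow> jordan_curve_C1_holder \<mu> (frontier \<Omega>) \<longrightarrow>
    1 < B \<longrightarrow> chord_arc B (frontier \<Omega>) \<longrightarrow>
      (let \<alpha> = 1 / (K * (1 + 2 * B)\<^sup>2) in
         L \<le> 4 * pi *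
             (pi / 2 * (K ^ 3 / (1 + K\<^sup>2)) * curve_const \<mu> (frontier \<Omega>) * ((2 - \<alpha>) / (\<mu> * \<alpha>)))
               powr ((2 - \<alpha>) / (\<mu> * \<alpha>)) *
             (4 * B * (1 + 2 * B) * sqrt (K * measure lebesgue \<Omega> / (pi * ln 2))) powr (2 / \<alpha>)) \<and>
      (\<forall>w f :: complex \<Rightarrow> complex.
         harmonic_on w (ball 0 1) \<and> normalized_quasiconformal K \<Omega> w \<and>
         (\<forall>\<zeta>\<in>sphere 0 1. f \<zeta> = w \<zeta>) \<and> (\<forall>z\<in>ball 0 1. w z = poisson_integral f z) \<longrightarrow>
           (AE \<phi> in lebesgue. \<phi> \<in> {0..2*pi} \<longrightarrow>
              (\<exists>D. ((\<lambda>x. f (cis x)) has_vector_derivative D) (at \<phi>) \<and> cmod D \<le> L)) \<and>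
           (\<forall>z1\<in>ball 0 1. \<forall>z2\<in>ball 0 1. cmod (w z1 - w z2) \<le> K * L * cmod (z1 - z2)))"
proof -
  define X where "X = {lipschitz_bound K \<Omega> \<mu> B | \<mu> B. 0 < \<mu> \<and> \<mu> \<le> 1 \<and>
     jordan_curve_C1_holder \<mu> (frontier \<Omega>) \<and> 1 < B \<and> chord_arc B (frontier \<Omega>)}"
  define L where "L = Inf X"
  have nonneg: "0 \<le> b" if "b \<in> X" for b
    using that by (auto simp: X_def lipschitz_bound_def Let_def)
  then have bdd: "bdd_below X" by (rule bdd_belowI)
  show ?thesis
  proof (intro exI[of _ L] allI impI conjI)
    fix \<mu> B :: real
    assume hyps: "0 < \<mu>" "\<mu> \<le> 1" "jordan_curve_C1_holder \<mu> (frontier \<Omega>)" "1 < B" "chord_arc B (frontier \<Omega>)"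
    then have mem: "lipschitz_bound K \<Omega> \<mu> B \<in> X" by (auto simp: X_def)
    then have ne: "X \<noteq> {}" by auto
    have L0: "0 \<le> L" unfolding L_def using ne nonneg by (rule cInf_greatest)
    have "L \<le> lipschitz_bound K \<Omega> \<mu> B" unfolding L_def using mem bdd by (rule cInf_lower)
    then show "let \<alpha> = 1 / (K * (1 + 2 * B)\<^sup>2) in
         L \<le> 4 * pi *
             (pi / 2 * (K ^ 3 / (1 + K\<^sup>2)) * curve_const \<mu> (frontier \<Omega>) * ((2 - \<alpha>) / (\<mu> * \<alpha>)))
               powr ((2 - \<alpha>) / (\<mu> * \<alpha>)) *
             (4 * B * (1 + 2 * B) * sqrt (K * measure lebesgue \<Omega> / (pi * ln 2))) powr (2 / \<alpha>)"
      by (simp add: lipschitz_bound_def Let_def)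
    fix w f :: "complex \<Rightarrow> complex"
    assume "harmonic_on w (ball 0 1) \<and> normalized_quasiconformal K \<Omega> w \<and>
         (\<forall>\<zeta>\<in>sphere 0 1. f \<zeta> = w \<zeta>) \<and> (\<forall>z\<in>ball 0 1. w z = poisson_integral f z)"
    then have w: "normalized_quasiconformal K \<Omega> w" "\<forall>\<zeta>\<in>sphere 0 1. f \<zeta> = w \<zeta>" "\<forall>z\<in>ball 0 1. w z = poisson_integral f z"
      by auto
    have inf: "c \<le> L * r" if "0 \<le> r" "\<And>b. b \<in> X \<Longrightarrow> c \<le> b * r" "r = 0 \<Longrightarrow> c \<le> 0" for c r :: real
    proof (cases "r = 0")
      case False
      then have "c / r \<le> L" unfolding L_def using that ne by (intro cInf_greatest) (auto simp: field_simps)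
      then show ?thesis using False that(1) by (simp add: field_simps)
    qed (use that in simp)
    have lip: "cmod (f (cis x) - f (cis y)) \<le> L * \<bar>x - y\<bar>" for x y
    proof (rule inf)
      fix b assume "b \<in> X"
      then show "cmod (f (cis x) - f (cis y)) \<le> b * \<bar>x - y\<bar>"
        using lipschitz_by_bound(1)[OF assms(2) _ _ _ _ _ w] w(2) by (auto simp: X_def)
    qed auto
    have "AE \<phi> in lebesgue. \<exists>D. ((\<lambda>x. f (cis x)) has_vector_derivative D) (at \<phi>)"
      using lip by (rule lipschitz_complex_differentiable_AE)
    then show "AE \<phi> in lebesgue. \<phi> \<in> {0..2*pi} \<longrightarrow>
              (\<exists>D. ((\<lambda>x. f (cis x)) has_vector_derivative D) (at \<phi>) \<and> cmod D \<le> L)"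
      by (rule eventually_mono) (use lipschitz_vector_derivative_le lip in blast)
    show "\<forall>z1\<in>ball 0 1. \<forall>z2\<in>ball 0 1. cmod (w z1 - w z2) \<le> K * L * cmod (z1 - z2)"
    proof (intro ballI)
      fix z1 z2 :: complex assume z: "z1 \<in> ball 0 1" "z2 \<in> ball 0 1"
      have "cmod (w z1 - w z2) \<le> L * cmod (z1 - z2)"
      proof (rule inf)
        fix b assume "b \<in> X"
        then show "cmod (w z1 - w z2) \<le> b * cmod (z1 - z2)"
          using lipschitz_by_bound(2)[OF assms(2) _ _ _ _ _ w z] by (auto simp: X_def)
      qed auto
      also have "\<dots> \<le> K * L * cmod (z1 - z2)"
        using assms(1) L0 mult_right_mono[of 1 K L] by (intro mult_right_mono) auto
      finally show "cmod (w z1 - w z2) \<le> K * L * cmod (z1 - z2)" .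
    qed
  qed
qed

end
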